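(* Let $\mathscr{A}$ be an abelian category with enough projective objects, let $n$ be a non-negative integer and let $Q$ be a finite and acyclic quiver with vertex set $Q_0$. For an $n$-tilting subcategory $\mathscr{T}$ of $\mathscr{A}$ put \[\mathscr{T}'=\mathrm{add}\bigl(\{e_i^{\rho}(T)\mid i\in Q_0,\ T\in\mathscr{T}\}\bigr).\] Then $\mathscr{T}'$ is an $(n+1)$-tilting subcategory of $\mathrm{Rep}(Q,\mathscr{A})$.
   Context: Subcategories are full. $\mathrm{add}$ of a family of objects is the full subcategory of direct summands of finite direct sums of members of the family. A subcategory is additively closed if it is closed under finite direct sums and direct summands. A right $\mathscr{X}$-approximation of $A$ is a morphism $X\to A$ with $X\in\mathscr{X}$ through which every morphism $X'\to A$ with $X'\in\mathscr{X}$ factors; $\mathscr{X}$ is contravariantly finite if every object has a right $\mathscr{X}$-approximation. For $n\ge0$, an additively closed subcategory $\mathscr{T}$ of an abelian category $\mathscr{A}$ with enough projectives is an $n$-tilting subcategory if (i) $\mathscr{T}$ is contravariantly finite in $\mathscr{A}$; (ii) $\mathrm{Ext}^i_{\mathscr{A}}(T_1,T_2)=0$ for all $T_1,T_2\in\mathscr{T}$ and all $i\ge1$; (iii) every $T\in\mathscr{T}$ has projective dimension at most $n$; (iv) for every projective $P$ in $\mathscr{A}$ there is an exact sequence $0\to P\to T^0\to T^1\to\cdots\to T^n\to0$ with all $T^i\in\mathscr{T}$. $\mathrm{Rep}(Q,\mathscr{A})$ is the category of representations of $Q$ in $\mathscr{A}$: an object $X$ assigns to each vertex $i$ an object $X_i$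 and to each arrow $\alpha:i\to j$ a morphism $X_\alpha:X_i\to X_j$; morphisms are families $(\varphi_i)_{i\in Q_0}$ commuting with the $X_\alpha$. It is abelian with enough projective objects, with kernels and cokernels computed vertexwise. The functor $e_i^{\rho}:\mathscr{A}\to\mathrm{Rep}(Q,\mathscr{A})$ is the right adjoint of the evaluation functor $e_i:X\mapsto X_i$; explicitly $e_i^{\rho}(A)_j=\bigoplus_{Q(j,i)}A$, where $Q(j,i)$ is the set of paths from $j$ to $i$, with structure morphisms the natural projections. *)

theory Defs
  imports
    "HOL-Algebra.Elementary_Groups"
    "HOL-Algebra.FiniteProduct"
    "HOL-Library.Extended_Nat"
    "Graph_Theory.Arc_Walk"
begin

section \<open>Abelian categories\<close>

text \<open>
  A category enriched with the data of an addition and zero morphisms. Composition and addition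
  take only the morphisms as arguments; different \<open>mor C A B\<close> need not be disjoint, so that a
  morphism does not have to carry its source and target.
\<close>

record ('o, 'm) add_cat =
  ob :: "'o set"
  mor :: "'o \<Rightarrow> 'o \<Rightarrow> 'm set"
  idm :: "'o \<Rightarrow> 'm"
  cmp :: "'m \<Rightarrow> 'm \<Rightarrow> 'm" (infixl "\<cdot>\<index>" 70)
  addm :: "'m \<Rightarrow> 'm \<Rightarrow> 'm"
  zerom :: "'o \<Rightarrow> 'o \<Rightarrow> 'm"

definition hom_group :: "('o, 'm) add_cat \<Rightarrow> 'o \<Rightarrow> 'o \<Rightarrow> 'm monoid" where
  "hom_group C A B = \<lparr>carrier = mor C A B, mult = addm C, one = zerom C A B\<rparr>"

locale preadditive_category =
  fixes C :: "('o, 'm) add_cat" (structure)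
  assumes idm_mor: "A \<in> ob C \<Longrightarrow> idm C A \<in> mor C A A"
    and cmp_mor: "\<lbrakk>A \<in> ob C; B \<in> ob C; D \<in> ob C; f \<in> mor C A B; g \<in> mor C B D\<rbrakk>
      \<Longrightarrow> g \<cdot> f \<in> mor C A D"
    and cmp_idm: "\<lbrakk>A \<in> ob C; B \<in> ob C; f \<in> mor C A B\<rbrakk> \<Longrightarrow> f \<cdot> idm C A = f"
    and idm_cmp: "\<lbrakk>A \<in> ob C; B \<in> ob C; f \<in> mor C A B\<rbrakk> \<Longrightarrow> idm C B \<cdot> f = f"
    and cmp_assoc: "\<lbrakk>A \<in> ob C; B \<in> ob C; D \<in> ob C; E \<in> ob C;
        f \<in> mor C A B; g \<in> mor C B D; h \<in> mor C D E\<rbrakk> \<Longrightarrow> h \<cdot> (g \<cdot> f) = (h \<cdot> g) \<cdot> f"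
    and hom_comm_group: "\<lbrakk>A \<in> ob C; B \<in> ob C\<rbrakk> \<Longrightarrow> comm_group (hom_group C A B)"
    and cmp_addm: "\<lbrakk>A \<in> ob C; B \<in> ob C; D \<in> ob C; f \<in> mor C A B; f' \<in> mor C A B; g \<in> mor C B D\<rbrakk>
      \<Longrightarrow> g \<cdot> addm C f f' = addm C (g \<cdot> f) (g \<cdot> f')"
    and addm_cmp: "\<lbrakk>A \<in> ob C; B \<in> ob C; D \<in> ob C; f \<in> mor C A B; g \<in> mor C B D; g' \<in> mor C B D\<rbrakk>
      \<Longrightarrow> addm C g g' \<cdot> f = addm C (g \<cdot> f) (g' \<cdot> f)"

definition is_zero_object :: "('o, 'm) add_cat \<Rightarrow> 'o \<Rightarrow> bool" where
  "is_zero_object C Z \<longleftrightarrow> Z \<in> ob C \<and>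
     (\<forall>A\<in>ob C. (\<exists>!f. f \<in> mor C A Z) \<and> (\<exists>!f. f \<in> mor C Z A))"

text \<open>
  \<open>S\<close> with injections \<open>\<iota>\<close> and projections \<open>\<pi>\<close> is a direct sum (biproduct) of the finite family
  \<open>(X i)\<close>, \<open>i \<in> I\<close>. The product in \<open>hom_group\<close>, which is written multiplicatively, is the sum of
  the \<open>\<iota> i \<cdot> \<pi> i\<close>.
\<close>

definition is_direct_sum ::
  "('o, 'm) add_cat \<Rightarrow> 'i set \<Rightarrow> ('i \<Rightarrow> 'o) \<Rightarrow> 'o \<Rightarrow> ('i \<Rightarrow> 'm) \<Rightarrow> ('i \<Rightarrow> 'm) \<Rightarrow> bool" where
  "is_direct_sum C I X S \<iota> \<pi> \<longleftrightarrow>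
     finite I \<and> S \<in> ob C \<and>
     (\<forall>i\<in>I. X i \<in> ob C \<and> \<iota> i \<in> mor C (X i) S \<and> \<pi> i \<in> mor C S (X i)) \<and>
     (\<forall>i\<in>I. \<forall>j\<in>I. \<pi> j \<cdot>\<^bsub>C\<^esub> \<iota> i = (if i = j then idm C (X i) else zerom C (X i) (X j))) \<and>
     finprod (hom_group C S S) (\<lambda>i. \<iota> i \<cdot>\<^bsub>C\<^esub> \<pi> i) I = idm C S"

definition is_mono :: "('o, 'm) add_cat \<Rightarrow> 'o \<Rightarrow> 'o \<Rightarrow> 'm \<Rightarrow> bool" where
  "is_mono C A B f \<longleftrightarrow> f \<in> mor C A B \<and>
     (\<forall>X\<in>ob C. \<forall>g\<in>mor C X A. \<forall>h\<in>mor C X A. f \<cdot>\<^bsub>C\<^esub> g = f \<cdot>\<^bsub>C\<^esub> h \<longrightarrow> g = h)"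

definition is_epi :: "('o, 'm) add_cat \<Rightarrow> 'o \<Rightarrow> 'o \<Rightarrow> 'm \<Rightarrow> bool" where
  "is_epi C A B f \<longleftrightarrow> f \<in> mor C A B \<and>
     (\<forall>X\<in>ob C. \<forall>g\<in>mor C B X. \<forall>h\<in>mor C B X. g \<cdot>\<^bsub>C\<^esub> f = h \<cdot>\<^bsub>C\<^esub> f \<longrightarrow> g = h)"

text \<open>\<open>k : K \<rightarrow> A\<close> is a kernel of \<open>f : A \<rightarrow> B\<close>.\<close>

definition is_kernel :: "('o, 'm) add_cat \<Rightarrow> 'o \<Rightarrow> 'o \<Rightarrow> 'm \<Rightarrow> 'o \<Rightarrow> 'm \<Rightarrow> bool" where
  "is_kernel C A B f K k \<longleftrightarrow>
     K \<in> ob C \<and> k \<in> mor C K A \<and> f \<cdot>\<^bsub>C\<^esub> k = zerom C K B \<and>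
     (\<forall>X\<in>ob C. \<forall>g\<in>mor C X A. f \<cdot>\<^bsub>C\<^esub> g = zerom C X B \<longrightarrow> (\<exists>!h. h \<in> mor C X K \<and> k \<cdot>\<^bsub>C\<^esub> h = g))"

text \<open>\<open>c : B \<rightarrow> D\<close> is a cokernel of \<open>f : A \<rightarrow> B\<close>.\<close>

definition is_cokernel :: "('o, 'm) add_cat \<Rightarrow> 'o \<Rightarrow> 'o \<Rightarrow> 'm \<Rightarrow> 'o \<Rightarrow> 'm \<Rightarrow> bool" where
  "is_cokernel C A B f D c \<longleftrightarrow>
     D \<in> ob C \<and> c \<in> mor C B D \<and> c \<cdot>\<^bsub>C\<^esub> f = zerom C A D \<and>
     (\<forall>X\<in>ob C. \<forall>g\<in>mor C B X. g \<cdot>\<^bsub>C\<^esub> f = zerom C A X \<longrightarrow> (\<exists>!h. h \<in> mor C D X \<and> h \<cdot>\<^bsub>C\<^esub> c = g))"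

locale abelian_category = preadditive_category +
  assumes ex_zero_object: "\<exists>Z. is_zero_object C Z"
    and ex_direct_sum: "\<lbrakk>A \<in> ob C; B \<in> ob C\<rbrakk>
      \<Longrightarrow> \<exists>S \<iota> \<pi>. is_direct_sum C (UNIV :: bool set) (\<lambda>b. if b then A else B) S \<iota> \<pi>"
    and ex_kernel: "\<lbrakk>A \<in> ob C; B \<in> ob C; f \<in> mor C A B\<rbrakk> \<Longrightarrow> \<exists>K k. is_kernel C A B f K k"
    and ex_cokernel: "\<lbrakk>A \<in> ob C; B \<in> ob C; f \<in> mor C A B\<rbrakk> \<Longrightarrow> \<exists>D c. is_cokernel C A B f D c"
    and mono_is_kernel: "\<lbrakk>A \<in> ob C; B \<in> ob C; is_mono C A B f\<rbrakk>
      \<Longrightarrow> \<exists>D\<in>ob C. \<exists>g\<in>mor C B D. is_kernel C B D g A f"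
    and epi_is_cokernel: "\<lbrakk>A \<in> ob C; B \<in> ob C; is_epi C A B f\<rbrakk>
      \<Longrightarrow> \<exists>D\<in>ob C. \<exists>g\<in>mor C D A. is_cokernel C D A g B f"

section \<open>Exactness, projective objects, Ext\<close>

text \<open>
  Exactness of \<open>A \<rightarrow> B \<rightarrow> D\<close> at \<open>B\<close>: the image of \<open>f\<close>, that is the kernel of the cokernel of \<open>f\<close>,
  is the kernel of \<open>g\<close>.
\<close>

definition exact_at :: "('o, 'm) add_cat \<Rightarrow> 'o \<Rightarrow> 'm \<Rightarrow> 'o \<Rightarrow> 'm \<Rightarrow> 'o \<Rightarrow> bool" where
  "exact_at C A f B g D \<longleftrightarrow> f \<in> mor C A B \<and> g \<in> mor C B D \<and>
     (\<exists>E c K k. is_cokernel C A B f E c \<and> is_kernel C B E c K k \<and> is_kernel C B D g K k)"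

text \<open>The sequence \<open>X 0 \<rightarrow> X 1 \<rightarrow> \<dots> \<rightarrow> X m\<close> with maps \<open>d k : X k \<rightarrow> X (k + 1)\<close> is exact.\<close>

definition exact_sequence :: "('o, 'm) add_cat \<Rightarrow> nat \<Rightarrow> (nat \<Rightarrow> 'o) \<Rightarrow> (nat \<Rightarrow> 'm) \<Rightarrow> bool" where
  "exact_sequence C m X d \<longleftrightarrow>
     (\<forall>k\<le>m. X k \<in> ob C) \<and> (\<forall>k<m. d k \<in> mor C (X k) (X (k + 1))) \<and>
     (\<forall>k. k + 1 < m \<longrightarrow> exact_at C (X k) (d k) (X (k + 1)) (d (k + 1)) (X (k + 2)))"

definition projective :: "('o, 'm) add_cat \<Rightarrow> 'o \<Rightarrow> bool" where
  "projective C P \<longleftrightarrow> P \<in> ob C \<and>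
     (\<forall>A\<in>ob C. \<forall>B\<in>ob C. \<forall>e. is_epi C A B e \<longrightarrow>
        (\<forall>f\<in>mor C P B. \<exists>g\<in>mor C P A. e \<cdot>\<^bsub>C\<^esub> g = f))"

definition enough_projectives :: "('o, 'm) add_cat \<Rightarrow> bool" where
  "enough_projectives C \<longleftrightarrow> (\<forall>A\<in>ob C. \<exists>P e. projective C P \<and> is_epi C P A e)"

text \<open>
  \<open>proj_dim C A\<close> is the least \<open>n\<close> for which there is an exact sequence
  \<open>0 \<rightarrow> P\<^sub>n \<rightarrow> \<dots> \<rightarrow> P\<^sub>0 \<rightarrow> A \<rightarrow> 0\<close> with all \<open>P\<^sub>i\<close> projective, and \<open>\<infinity>\<close> if there is none. In \<open>X\<close> the objects are
  numbered from the left: \<open>X 0 = 0\<close>, \<open>X (k + 1) = P\<^sub>n\<^sub>-\<^sub>k\<close>, \<open>X (n + 2) = A\<close>, \<open>X (n + 3) = 0\<close>.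
\<close>

definition has_proj_resolution_of_length :: "('o, 'm) add_cat \<Rightarrow> nat \<Rightarrow> 'o \<Rightarrow> bool" where
  "has_proj_resolution_of_length C n A \<longleftrightarrow>
     (\<exists>X d. exact_sequence C (n + 3) X d \<and> is_zero_object C (X 0) \<and>
        (\<forall>k\<le>n. projective C (X (k + 1))) \<and> X (n + 2) = A \<and> is_zero_object C (X (n + 3)))"

definition proj_dim :: "('o, 'm) add_cat \<Rightarrow> 'o \<Rightarrow> enat" where
  "proj_dim C A = (INF n \<in> {n. has_proj_resolution_of_length C n A}. enat n)"

text \<open>
  A projective resolution \<open>\<dots> \<rightarrow> P 1 \<rightarrow> P 0 \<rightarrow> A \<rightarrow> 0\<close> with \<open>d k : P (k + 1) \<rightarrow> P k\<close> and augmentation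
  \<open>\<epsilon> : P 0 \<rightarrow> A\<close>.
\<close>

definition proj_resolution ::
  "('o, 'm) add_cat \<Rightarrow> 'o \<Rightarrow> (nat \<Rightarrow> 'o) \<Rightarrow> (nat \<Rightarrow> 'm) \<Rightarrow> 'm \<Rightarrow> bool" where
  "proj_resolution C A P d \<epsilon> \<longleftrightarrow>
     (\<forall>k. projective C (P k)) \<and> is_epi C (P 0) A \<epsilon> \<and>
     exact_at C (P 1) (d 0) (P 0) \<epsilon> A \<and>
     (\<forall>k. exact_at C (P (k + 2)) (d (k + 1)) (P (k + 1)) (d k) (P k))"

definition cocycle_group ::
  "('o, 'm) add_cat \<Rightarrow> (nat \<Rightarrow> 'o) \<Rightarrow> (nat \<Rightarrow> 'm) \<Rightarrow> nat \<Rightarrow> 'o \<Rightarrow> 'm monoid" where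
  "cocycle_group C P d i B =
     (hom_group C (P i) B)
       \<lparr>carrier := {f \<in> mor C (P i) B. f \<cdot>\<^bsub>C\<^esub> d i = zerom C (P (i + 1)) B}\<rparr>"

definition coboundaries ::
  "('o, 'm) add_cat \<Rightarrow> (nat \<Rightarrow> 'o) \<Rightarrow> (nat \<Rightarrow> 'm) \<Rightarrow> nat \<Rightarrow> 'o \<Rightarrow> 'm set" where
  "coboundaries C P d i B =
     (case i of 0 \<Rightarrow> {zerom C (P 0) B} | Suc j \<Rightarrow> (\<lambda>g. g \<cdot>\<^bsub>C\<^esub> d j) ` mor C (P j) B)"

text \<open>
  The group of degree \<open>i\<close> extensions, as the cohomology of \<open>Hom(P, B)\<close> for a chosen projective
  resolution \<open>P\<close> of \<open>A\<close>. Resolutions exist when there are enough projectives, and the group does not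
  depend on the choice up to isomorphism.
\<close>

definition Ext :: "('o, 'm) add_cat \<Rightarrow> nat \<Rightarrow> 'o \<Rightarrow> 'o \<Rightarrow> 'm set monoid" where
  "Ext C i A B =
     (case (SOME (P, d, \<epsilon>). proj_resolution C A P d \<epsilon>) of
        (P, d, \<epsilon>) \<Rightarrow> cocycle_group C P d i B Mod coboundaries C P d i B)"

section \<open>Tilting subcategories\<close>

text \<open>All subcategories are full, so they are given by their sets of objects.\<close>

definition direct_summand :: "('o, 'm) add_cat \<Rightarrow> 'o \<Rightarrow> 'o \<Rightarrow> bool" where
  "direct_summand C X S \<longleftrightarrow>
     (\<exists>Y \<iota> \<pi>. is_direct_sum C (UNIV :: bool set) (\<lambda>b. if b then X else Y) S \<iota> \<pi>)"

definition add_hull :: "('o, 'm) add_cat \<Rightarrow> 'o set \<Rightarrow> 'o set" where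
  "add_hull C F = {X \<in> ob C. \<exists>(m::nat) G S \<iota> \<pi>.
     (\<forall>k<m. G k \<in> F) \<and> is_direct_sum C {..<m} G S \<iota> \<pi> \<and> direct_summand C X S}"

definition additively_closed :: "('o, 'm) add_cat \<Rightarrow> 'o set \<Rightarrow> bool" where
  "additively_closed C \<T> \<longleftrightarrow> \<T> \<subseteq> ob C \<and>
     (\<forall>(m::nat) G S \<iota> \<pi>. (\<forall>k<m. G k \<in> \<T>) \<longrightarrow> is_direct_sum C {..<m} G S \<iota> \<pi> \<longrightarrow> S \<in> \<T>) \<and>
     (\<forall>S\<in>\<T>. \<forall>X. direct_summand C X S \<longrightarrow> X \<in> \<T>)"

definition right_approximation :: "('o, 'm) add_cat \<Rightarrow> 'o set \<Rightarrow> 'o \<Rightarrow> 'o \<Rightarrow> 'm \<Rightarrow> bool" where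
  "right_approximation C \<X> A X f \<longleftrightarrow> X \<in> \<X> \<and> f \<in> mor C X A \<and>
     (\<forall>X'\<in>\<X>. \<forall>f'\<in>mor C X' A. \<exists>g\<in>mor C X' X. f \<cdot>\<^bsub>C\<^esub> g = f')"

definition contravariantly_finite :: "('o, 'm) add_cat \<Rightarrow> 'o set \<Rightarrow> bool" where
  "contravariantly_finite C \<X> \<longleftrightarrow> (\<forall>A\<in>ob C. \<exists>X f. right_approximation C \<X> A X f)"

text \<open>
  In \<open>tilting_coresolution\<close> the objects of \<open>0 \<rightarrow> P \<rightarrow> T\<^sup>0 \<rightarrow> \<dots> \<rightarrow> T\<^sup>n \<rightarrow> 0\<close> are numbered \<open>X 0 = 0\<close>, \<open>X 1 = P\<close>,
  \<open>X (k + 2) = T\<^sup>k\<close>, \<open>X (n + 3) = 0\<close>.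
\<close>

locale n_tilting_subcategory = abelian_category +
  fixes n :: nat and \<T> :: "'a set"
  assumes enough_proj: "enough_projectives C"
    and closed: "additively_closed C \<T>"
    and contravariant: "contravariantly_finite C \<T>"
    and Ext_vanishing: "\<lbrakk>T\<^sub>1 \<in> \<T>; T\<^sub>2 \<in> \<T>; 1 \<le> i\<rbrakk> \<Longrightarrow> trivial_group (Ext C i T\<^sub>1 T\<^sub>2)"
    and proj_dim_le: "T \<in> \<T> \<Longrightarrow> proj_dim C T \<le> enat n"
    and tilting_coresolution: "projective C P \<Longrightarrow>
      \<exists>X d. exact_sequence C (n + 3) X d \<and> is_zero_object C (X 0) \<and> X 1 = P \<and>
        (\<forall>k\<le>n. X (k + 2) \<in> \<T>) \<and> is_zero_object C (X (n + 3))"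

section \<open>Representations of quivers\<close>

text \<open>
  A quiver is a directed multigraph (loops allowed), and \<open>Q(j, i)\<close> consists of the arc lists of walks
  from \<open>j\<close> to \<open>i\<close>, including the trivial one for \<open>i = j\<close>; the first arc traversed comes first.
\<close>

definition paths :: "('v, 'e) pre_digraph \<Rightarrow> 'v \<Rightarrow> 'v \<Rightarrow> 'e list set" where
  "paths Q j i = {p. pre_digraph.awalk Q j p i}"

definition acyclic_quiver :: "('v, 'e) pre_digraph \<Rightarrow> bool" where
  "acyclic_quiver Q \<longleftrightarrow> (\<forall>i\<in>verts Q. paths Q i i = {[]})"

text \<open>
  Representations and their morphisms are extensional functions, so that equality is equality at the
  vertices and arrows of the quiver.
\<close>

record ('v, 'e, 'o, 'm) representation =
  at_vertex :: "'v \<Rightarrow> 'o"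
  at_arrow :: "'e \<Rightarrow> 'm"

definition Rep ::
  "('v, 'e) pre_digraph \<Rightarrow> ('o, 'm) add_cat \<Rightarrow> (('v, 'e, 'o, 'm) representation, 'v \<Rightarrow> 'm) add_cat" where
  "Rep Q C = \<lparr>
     ob = {X. at_vertex X \<in> verts Q \<rightarrow>\<^sub>E ob C \<and> at_arrow X \<in> extensional (arcs Q) \<and>
            (\<forall>a\<in>arcs Q. at_arrow X a \<in> mor C (at_vertex X (tail Q a)) (at_vertex X (head Q a)))},
     mor = (\<lambda>X Y. {\<phi> \<in> (\<Pi>\<^sub>E i\<in>verts Q. mor C (at_vertex X i) (at_vertex Y i)).
            \<forall>a\<in>arcs Q. \<phi> (head Q a) \<cdot>\<^bsub>C\<^esub> at_arrow X a = at_arrow Y a \<cdot>\<^bsub>C\<^esub> \<phi> (tail Q a)}),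
     idm = (\<lambda>X. \<lambda>i\<in>verts Q. idm C (at_vertex X i)),
     cmp = (\<lambda>\<psi> \<phi>. \<lambda>i\<in>verts Q. \<psi> i \<cdot>\<^bsub>C\<^esub> \<phi> i),
     addm = (\<lambda>\<phi> \<psi>. \<lambda>i\<in>verts Q. addm C (\<phi> i) (\<psi> i)),
     zerom = (\<lambda>X Y. \<lambda>i\<in>verts Q. zerom C (at_vertex X i) (at_vertex Y i))\<rparr>"

text \<open>A chosen direct sum of a finite family, with its projections.\<close>

definition dsum :: "('o, 'm) add_cat \<Rightarrow> 'i set \<Rightarrow> ('i \<Rightarrow> 'o) \<Rightarrow> 'o \<times> ('i \<Rightarrow> 'm) \<times> ('i \<Rightarrow> 'm)" where
  "dsum C I X = (SOME (S, \<iota>, \<pi>). is_direct_sum C I X S \<iota> \<pi>)"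

definition dsum_ob :: "('o, 'm) add_cat \<Rightarrow> 'i set \<Rightarrow> ('i \<Rightarrow> 'o) \<Rightarrow> 'o" where
  "dsum_ob C I X = fst (dsum C I X)"

definition dsum_proj :: "('o, 'm) add_cat \<Rightarrow> 'i set \<Rightarrow> ('i \<Rightarrow> 'o) \<Rightarrow> 'i \<Rightarrow> 'm" where
  "dsum_proj C I X = snd (snd (dsum C I X))"

text \<open>
  The representation \<open>e\<^sub>i\<^sup>\<rho>(A)\<close> with \<open>e\<^sub>i\<^sup>\<rho>(A)\<^sub>j = \<Oplus>\<^bsub>Q(j,i)\<^esub> A\<close>. Prolongation by an arrow \<open>a : j \<rightarrow> k\<close> embeds
  \<open>Q(k, i)\<close> into \<open>Q(j, i)\<close> via \<open>p \<mapsto> a # p\<close>, and the structure morphism at \<open>a\<close> is the corresponding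
  projection: its component at \<open>p\<close> is the projection onto the summand indexed by \<open>a # p\<close>.
\<close>

definition e_rho :: "('v, 'e) pre_digraph \<Rightarrow> ('o, 'm) add_cat \<Rightarrow> 'v \<Rightarrow> 'o \<Rightarrow> ('v, 'e, 'o, 'm) representation" where
  "e_rho Q C i A = \<lparr>
     at_vertex = (\<lambda>j\<in>verts Q. dsum_ob C (paths Q j i) (\<lambda>_. A)),
     at_arrow = (\<lambda>a\<in>arcs Q. THE f.
        f \<in> mor C (dsum_ob C (paths Q (tail Q a) i) (\<lambda>_. A)) (dsum_ob C (paths Q (head Q a) i) (\<lambda>_. A)) \<and>
        (\<forall>p\<in>paths Q (head Q a) i.
           dsum_proj C (paths Q (head Q a) i) (\<lambda>_. A) p \<cdot>\<^bsub>C\<^esub> f =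
           dsum_proj C (paths Q (tail Q a) i) (\<lambda>_. A) (a # p)))\<rparr>"

end

theory Submission
  imports Defs
begin

text \<open>
  Write \<open>\<T>'\<close> for the additive hull of the objects \<open>e\<^sub>i\<^sup>\<rho>(T)\<close>. Two facts connect \<open>\<T>'\<close> with \<open>\<T>\<close>. The objects of \<open>\<T>'\<close> lie
  in \<open>\<T>\<close> at every vertex (\<open>coind_add_vertex\<close>), because \<open>e\<^sub>i\<^sup>\<rho>(T)\<^sub>j\<close> is a finite direct sum of copies of \<open>T\<close>. And
  since \<open>e\<^sub>i\<^sup>\<rho>\<close> is right adjoint to the evaluation at \<open>i\<close> (\<open>coinduced_exists\<close>, \<open>coinduced_unique\<close>), a
  morphism of representations along which all morphisms into \<open>\<T>\<close> extend at every vertex is one along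
  which all morphisms into \<open>\<T>'\<close> extend (\<open>coind_add_relative_injective\<close>).

  Vanishing of Ext. Kernels, epimorphisms and projectivity pass from representations to the vertices,
  so a syzygy of a representation is a syzygy at every vertex. Now \<open>Ext\<^sup>m\<^sup>+\<^sup>1(X, B) = 0\<close> says that the
  morphisms from a syzygy of \<open>X\<close> to \<open>B\<close> extend to the projective object above it, and for \<open>B \<in> \<T>'\<close> the
  second fact reduces this to \<open>Ext\<^sup>m\<^sup>+\<^sup>1(X\<^sub>j, T) = 0\<close> (\<open>ext_vanishes_Rep\<close>).

  Approximations. A morphism \<open>e\<^sub>i\<^sup>\<rho>(T) \<rightarrow> X\<close> is a family of morphisms \<open>T \<rightarrow> X\<^sub>j\<close>, one for each path \<open>j \<rightarrow> i\<close>, subject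
  to equations that do not involve \<open>T\<close>. It is therefore a morphism \<open>T \<rightarrow> G\<close> for an equaliser \<open>G\<close> of finite
  direct sums of the \<open>X\<^sub>j\<close>, and a right \<open>\<T>\<close>-approximation of \<open>G\<close> yields a right approximation of \<open>X\<close> by
  objects \<open>e\<^sub>i\<^sup>\<rho>(T)\<close> (\<open>coinduced_right_approximation\<close>).

  Projective dimension and coresolutions. Both increase by one, for the same reason. Let \<open>\<S>\<close> be a class
  of objects of the base category and \<open>\<S>'\<close> one of representations that is projective relative to the
  vertexwise \<open>\<S>\<close>-epimorphisms. If \<open>Y\<close> lies in \<open>\<S>\<close> at every vertex, then the kernel of an
  \<open>\<S>'\<close>-approximation of \<open>Y\<close> lies in \<open>\<S>'\<close> (\<open>syzygy_retract\<close>): this is the standard sequence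
  \<open>0 \<rightarrow> \<Oplus>\<^sub>a L\<^bsub>h(a)\<^esub>(Y\<^bsub>t(a)\<^esub>) \<rightarrow> \<Oplus>\<^sub>j L\<^sub>j(Y\<^sub>j) \<rightarrow> Y \<rightarrow> 0\<close>, with \<open>L\<^sub>j\<close> the left adjoint of the evaluation at \<open>j\<close> and
  \<open>h(a)\<close>, \<open>t(a)\<close> head and tail, in a form that needs no bookkeeping with paths. Hence \<open>\<S>\<close>-dimension at most \<open>n\<close> at the vertices gives an
  \<open>\<S>'\<close>-resolution of length \<open>n + 1\<close> (\<open>resolved_of_vertexwise_pdim_le\<close>). For the projective objects this
  bounds the projective dimension of the objects of \<open>\<T>'\<close>. For \<open>\<T>\<close> in the opposite category it gives the
  coresolutions, because \<open>Rep(Q, \<A>)\<^sup>o\<^sup>p = Rep(Q\<^sup>o\<^sup>p, \<A>\<^sup>o\<^sup>p)\<close>. There \<open>\<T>\<close>-dimension at most \<open>n\<close> means a coresolution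
  whose inclusions are left \<open>\<T>\<close>-approximations; that a given coresolution is of this kind follows from
  the vanishing of Ext (\<open>resolved_op_pdim_le\<close>).

  Resolutions are compared one syzygy at a time: a stable retract of an object has as its syzygies
  stable retracts of the syzygies of that object (\<open>stable_retract_syzygy\<close>). This shows that the choices
  in Ext and in relative dimensions are immaterial, without chain maps or homotopies of complexes.
\<close>

section \<open>Morphisms, kernels and monomorphisms\<close>

text \<open>
  Hom sets may overlap, so a morphism does not determine its source and target, and every law has to
  be told between which objects its morphisms run.
\<close>

definition arr :: "('o, 'm) add_cat \<Rightarrow> 'o \<Rightarrow> 'o \<Rightarrow> 'm \<Rightarrow> bool" where
  "arr C A B f \<longleftrightarrow> A \<in> ob C \<and> B \<in> ob C \<and> f \<in> mor C A B"

context preadditive_category begin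

abbreviation padd (infixl "\<boxplus>" 65) where "f \<boxplus> g \<equiv> addm C f g"

lemma comp_arr [intro]: "\<lbrakk>arr C A B f; arr C B D g\<rbrakk> \<Longrightarrow> arr C A D (g \<cdot> f)"
  unfolding arr_def using cmp_mor by blast

lemma id_arr [intro]: "A \<in> ob C \<Longrightarrow> arr C A A (idm C A)"
  unfolding arr_def using idm_mor by blast

lemma assoc: "\<lbrakk>arr C A B f; arr C B D g; arr C D E h\<rbrakk> \<Longrightarrow> (h \<cdot> g) \<cdot> f = h \<cdot> (g \<cdot> f)"
  unfolding arr_def using cmp_assoc by metis

lemma id_right: "arr C A B f \<Longrightarrow> f \<cdot> idm C A = f"
  unfolding arr_def using cmp_idm by blast

lemma id_left: "arr C A B f \<Longrightarrow> idm C B \<cdot> f = f"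
  unfolding arr_def using idm_cmp by blast

lemma distrib_left: "\<lbrakk>arr C A B f; arr C A B f'; arr C B D g\<rbrakk> \<Longrightarrow> g \<cdot> (f \<boxplus> f') = g \<cdot> f \<boxplus> g \<cdot> f'"
  unfolding arr_def using cmp_addm by blast

lemma distrib_right: "\<lbrakk>arr C A B f; arr C B D g; arr C B D g'\<rbrakk> \<Longrightarrow> (g \<boxplus> g') \<cdot> f = g \<cdot> f \<boxplus> g' \<cdot> f"
  unfolding arr_def using addm_cmp by blast

lemma zero_arr [intro]: "\<lbrakk>A \<in> ob C; B \<in> ob C\<rbrakk> \<Longrightarrow> arr C A B (zerom C A B)"
proof -
  assume a: "A \<in> ob C" "B \<in> ob C"
  interpret comm_group "hom_group C A B" by (rule hom_comm_group[OF a])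
  show ?thesis using one_closed a by (simp add: arr_def hom_group_def)
qed

lemma add_arr [intro]: "\<lbrakk>arr C A B f; arr C A B g\<rbrakk> \<Longrightarrow> arr C A B (f \<boxplus> g)"
proof -
  assume a: "arr C A B f" "arr C A B g"
  then interpret comm_group "hom_group C A B" by (intro hom_comm_group) (auto simp: arr_def)
  show ?thesis using m_closed[of f g] a by (simp add: arr_def hom_group_def)
qed

lemma add_assoc:
  assumes "arr C A B f" "arr C A B g" "arr C A B h"
  shows "f \<boxplus> g \<boxplus> h = f \<boxplus> (g \<boxplus> h)"
proof -
  interpret comm_group "hom_group C A B" using assms by (intro hom_comm_group) (auto simp: arr_def)
  show ?thesis using m_assoc[of f g h] assms by (simp add: arr_def hom_group_def)
qed

lemma add_comm:
  assumes "arr C A B f" "arr C A B g"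
  shows "f \<boxplus> g = g \<boxplus> f"
proof -
  interpret comm_group "hom_group C A B" using assms by (intro hom_comm_group) (auto simp: arr_def)
  show ?thesis using m_comm[of f g] assms by (simp add: arr_def hom_group_def)
qed

lemma add_zero:
  assumes "arr C A B f"
  shows "f \<boxplus> zerom C A B = f" and "zerom C A B \<boxplus> f = f"
proof -
  interpret comm_group "hom_group C A B" using assms by (intro hom_comm_group) (auto simp: arr_def)
  show "f \<boxplus> zerom C A B = f" using r_one[of f] assms by (simp add: arr_def hom_group_def)
  show "zerom C A B \<boxplus> f = f" using l_one[of f] assms by (simp add: arr_def hom_group_def)
qed

lemma add_cancel:
  assumes "arr C A B f" "arr C A B g" "arr C A B h" "f \<boxplus> g = f \<boxplus> h"
  shows "g = h"
proof -
  interpret comm_group "hom_group C A B" using assms by (intro hom_comm_group) (auto simp: arr_def)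
  show ?thesis using Units_l_cancel[of f g h] assms Units_eq by (auto simp: arr_def hom_group_def)
qed

lemma ex_difference:
  assumes "arr C A B f" "arr C A B g"
  obtains d where "arr C A B d" "f = g \<boxplus> d"
proof -
  interpret comm_group "hom_group C A B" using assms by (intro hom_comm_group) (auto simp: arr_def)
  define d where "d = inv\<^bsub>hom_group C A B\<^esub> g \<otimes>\<^bsub>hom_group C A B\<^esub> f"
  have c: "f \<in> carrier (hom_group C A B)" "g \<in> carrier (hom_group C A B)"
    using assms by (auto simp: arr_def hom_group_def)
  have "d \<in> carrier (hom_group C A B)" using c by (simp add: d_def)
  moreover have "g \<otimes>\<^bsub>hom_group C A B\<^esub> d = f" using c by (simp add: d_def m_assoc[symmetric])
  ultimately show thesis using assms that[of d] by (simp add: arr_def hom_group_def)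
qed

lemma comp_zero:
  assumes g: "arr C B D g" and A: "A \<in> ob C"
  shows "g \<cdot> zerom C A B = zerom C A D"
proof -
  have z: "arr C A B (zerom C A B)" using assms zero_arr by (auto simp: arr_def)
  have gz: "arr C A D (g \<cdot> zerom C A B)" using z g by blast
  have "g \<cdot> zerom C A B \<boxplus> g \<cdot> zerom C A B = g \<cdot> zerom C A B \<boxplus> zerom C A D"
    using distrib_left[OF z z g] add_zero[OF z] add_zero[OF gz] by simp
  then show ?thesis using add_cancel gz g A by (metis arr_def zero_arr)
qed

lemma zero_comp:
  assumes f: "arr C A B f" and D: "D \<in> ob C"
  shows "zerom C B D \<cdot> f = zerom C A D"
proof -
  have z: "arr C B D (zerom C B D)" using assms zero_arr by (auto simp: arr_def)
  have gz: "arr C A D (zerom C B D \<cdot> f)" using z f by blast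
  have "zerom C B D \<cdot> f \<boxplus> zerom C B D \<cdot> f = zerom C B D \<cdot> f \<boxplus> zerom C A D"
    using distrib_right[OF f z z] add_zero[OF z] add_zero[OF gz] by simp
  then show ?thesis using add_cancel gz f D by (metis arr_def zero_arr)
qed

end

context preadditive_category begin

lemma kernel_arr: "\<lbrakk>is_kernel C A B f K k; A \<in> ob C\<rbrakk> \<Longrightarrow> arr C K A k"
  by (simp add: is_kernel_def arr_def)

lemma kernel_zero: "is_kernel C A B f K k \<Longrightarrow> f \<cdot> k = zerom C K B"
  by (simp add: is_kernel_def)

lemma kernel_factor:
  assumes "is_kernel C A B f K k" "arr C X A g" "f \<cdot> g = zerom C X B"
  obtains h where "arr C X K h" "k \<cdot> h = g"
  using assms unfolding is_kernel_def arr_def by blast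

lemma kernel_cancel:
  assumes k: "is_kernel C A B f K k" and f: "arr C A B f" and "arr C X K g" "arr C X K h" "k \<cdot> g = k \<cdot> h"
  shows "g = h"
proof -
  have ka: "arr C K A k" using k f by (simp add: is_kernel_def arr_def)
  have "f \<cdot> (k \<cdot> g) = zerom C X B"
    using assoc[OF assms(3) ka f] kernel_zero[OF k] zero_comp[OF assms(3)] f by (simp add: arr_def)
  moreover have "k \<cdot> g \<in> mor C X A" "X \<in> ob C" using assms(3) ka by (auto simp: arr_def intro: cmp_mor)
  ultimately have "\<exists>!h. h \<in> mor C X K \<and> k \<cdot> h = k \<cdot> g" using k unfolding is_kernel_def by blast
  then show ?thesis using assms by (metis arr_def)
qed

lemma is_kernelI:
  assumes "arr C K A k" "arr C A B f" "f \<cdot> k = zerom C K B"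
    and "\<And>X g. \<lbrakk>arr C X A g; f \<cdot> g = zerom C X B\<rbrakk> \<Longrightarrow> \<exists>h. arr C X K h \<and> k \<cdot> h = g"
    and "\<And>X h h'. \<lbrakk>arr C X K h; arr C X K h'; k \<cdot> h = k \<cdot> h'\<rbrakk> \<Longrightarrow> h = h'"
  shows "is_kernel C A B f K k"
  unfolding is_kernel_def
proof (intro conjI ballI impI)
  fix X g assume X: "X \<in> ob C" "g \<in> mor C X A" "f \<cdot> g = zerom C X B"
  then obtain h where h: "arr C X K h" "k \<cdot> h = g" using assms(2,4) by (metis arr_def)
  then show "\<exists>!h. h \<in> mor C X K \<and> k \<cdot> h = g"
    using assms(5) by (metis arr_def)
qed (use assms in \<open>auto simp: arr_def\<close>)

text \<open>This replaces the subtraction of morphisms in most of the arguments below.\<close>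

lemma kernel_difference:
  assumes k: "is_kernel C A B f K k" and f: "arr C A B f"
    and x: "arr C X A x" and y: "arr C X A y" and eq: "f \<cdot> x = f \<cdot> y"
  obtains s where "arr C X K s" "y = x \<boxplus> k \<cdot> s"
proof -
  obtain d where d: "arr C X A d" "y = x \<boxplus> d" using ex_difference[OF y x] by blast
  have fx: "arr C X B (f \<cdot> x)" and fd: "arr C X B (f \<cdot> d)" using x d f by blast+
  have z: "arr C X B (zerom C X B)" using fx by (intro zero_arr) (auto simp: arr_def)
  have "f \<cdot> x \<boxplus> f \<cdot> d = f \<cdot> x \<boxplus> zerom C X B"
    using distrib_left[OF x d(1) f] eq d(2) add_zero[OF fx] by simp
  then have "f \<cdot> d = zerom C X B" by (rule add_cancel[OF fx fd z])
  from kernel_factor[OF k d(1) this] show thesis using that d by metis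
qed

lemma is_mono_iff:
  assumes "arr C A B f"
  shows "is_mono C A B f \<longleftrightarrow> (\<forall>X x. arr C X A x \<longrightarrow> f \<cdot> x = zerom C X B \<longrightarrow> x = zerom C X A)"
proof
  assume m: "is_mono C A B f"
  show "\<forall>X x. arr C X A x \<longrightarrow> f \<cdot> x = zerom C X B \<longrightarrow> x = zerom C X A"
  proof (intro allI impI)
    fix X x assume x: "arr C X A x" "f \<cdot> x = zerom C X B"
    have "f \<cdot> x = f \<cdot> zerom C X A" using comp_zero[OF assms, of X] x by (simp add: arr_def)
    moreover have "arr C X A (zerom C X A)" using x(1) by (intro zero_arr) (auto simp: arr_def)
    ultimately show "x = zerom C X A" using m x(1) unfolding is_mono_def arr_def by blast
  qed
next
  assume m: "\<forall>X x. arr C X A x \<longrightarrow> f \<cdot> x = zerom C X B \<longrightarrow> x = zerom C X A"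
  show "is_mono C A B f"
    unfolding is_mono_def
  proof (intro conjI ballI impI)
    fix X g h assume "X \<in> ob C" "g \<in> mor C X A" "h \<in> mor C X A" and eq: "f \<cdot> g = f \<cdot> h"
    then have g: "arr C X A g" and h: "arr C X A h" using assms by (auto simp: arr_def)
    obtain d where d: "arr C X A d" "h = g \<boxplus> d" using ex_difference[OF h g] by blast
    have fg: "arr C X B (f \<cdot> g)" and fd: "arr C X B (f \<cdot> d)" using g d assms by blast+
    have z: "arr C X B (zerom C X B)" using fg by (intro zero_arr) (auto simp: arr_def)
    have "f \<cdot> g \<boxplus> f \<cdot> d = f \<cdot> g \<boxplus> zerom C X B"
      using distrib_left[OF g d(1) assms] eq d(2) add_zero[OF fg] by simp
    then have "f \<cdot> d = zerom C X B" by (rule add_cancel[OF fg fd z])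
    then have "d = zerom C X A" using m d by blast
    then show "g = h" using d add_zero[OF g] by simp
  qed (use assms in \<open>simp add: arr_def\<close>)
qed

lemma mono_cancel:
  assumes "is_mono C A B f" "arr C X A g" "arr C X A h" "f \<cdot> g = f \<cdot> h"
  shows "g = h"
  using assms unfolding is_mono_def arr_def by blast

lemma kernel_is_mono:
  assumes "is_kernel C A B f K k" "arr C A B f"
  shows "is_mono C K A k"
  using assms kernel_arr[OF assms(1)] kernel_cancel[OF assms] unfolding is_mono_def
  by (auto simp: arr_def)

lemma zero_object_arr:
  assumes Z: "is_zero_object C Z" and A: "A \<in> ob C"
  shows "arr C Z A f \<Longrightarrow> f = zerom C Z A" and "arr C A Z f \<Longrightarrow> f = zerom C A Z"
proof -
  have *: "\<exists>!f. f \<in> mor C A Z" "\<exists>!f. f \<in> mor C Z A" "Z \<in> ob C" using Z A by (auto simp: is_zero_object_def)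
  have z: "zerom C A Z \<in> mor C A Z" "zerom C Z A \<in> mor C Z A"
    using zero_arr[OF A *(3)] zero_arr[OF *(3) A] by (auto simp: arr_def)
  show "arr C Z A f \<Longrightarrow> f = zerom C Z A" "arr C A Z f \<Longrightarrow> f = zerom C A Z"
    using * z by (auto simp: arr_def)
qed

end

section \<open>The opposite category\<close>

text \<open>
  Reversing the morphisms is an involution on the records themselves and exchanges kernels with
  cokernels, so that dual statements follow by simplification.
\<close>

definition op_cat :: "('o, 'm) add_cat \<Rightarrow> ('o, 'm) add_cat" where
  "op_cat C = \<lparr>ob = ob C, mor = (\<lambda>A B. mor C B A), idm = idm C, cmp = (\<lambda>g f. cmp C f g),
     addm = addm C, zerom = (\<lambda>A B. zerom C B A)\<rparr>"

lemma op_simps [simp]: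
  "ob (op_cat C) = ob C" "mor (op_cat C) A B = mor C B A" "idm (op_cat C) = idm C"
  "cmp (op_cat C) g f = cmp C f g" "addm (op_cat C) = addm C" "zerom (op_cat C) A B = zerom C B A"
  by (simp_all add: op_cat_def)

lemma op_op [simp]: "op_cat (op_cat C) = C"
  by (simp add: op_cat_def)

lemma hom_group_op [simp]: "hom_group (op_cat C) A B = hom_group C B A"
  by (simp add: hom_group_def)

lemma arr_op [simp]: "arr (op_cat C) A B f = arr C B A f"
  by (auto simp: arr_def)

lemma is_kernel_op [simp]: "is_kernel (op_cat C) A B f K k = is_cokernel C B A f K k"
  by (simp add: is_kernel_def is_cokernel_def)

lemma is_cokernel_op [simp]: "is_cokernel (op_cat C) A B f K k = is_kernel C B A f K k"
  by (simp add: is_kernel_def is_cokernel_def)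

lemma is_mono_op [simp]: "is_mono (op_cat C) A B f = is_epi C B A f"
  by (simp add: is_mono_def is_epi_def)

lemma is_epi_op [simp]: "is_epi (op_cat C) A B f = is_mono C B A f"
  by (simp add: is_mono_def is_epi_def)

lemma is_zero_object_op [simp]: "is_zero_object (op_cat C) Z = is_zero_object C Z"
  by (auto simp: is_zero_object_def)

lemma is_direct_sum_op: "is_direct_sum C I X S \<iota> \<pi> \<Longrightarrow> is_direct_sum (op_cat C) I X S \<pi> \<iota>"
  unfolding is_direct_sum_def by (auto split: if_splits)

lemma is_direct_sum_op_iff [simp]: "is_direct_sum (op_cat C) I X S \<iota> \<pi> = is_direct_sum C I X S \<pi> \<iota>"
  using is_direct_sum_op[of C I X S \<pi> \<iota>] is_direct_sum_op[of "op_cat C" I X S \<iota> \<pi>] by auto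

lemma direct_summand_opI: "direct_summand C X S \<Longrightarrow> direct_summand (op_cat C) X S"
  unfolding direct_summand_def by (elim exE) (rule exI, rule exI, rule exI, erule is_direct_sum_op)

lemma direct_summand_op [simp]: "direct_summand (op_cat C) X S = direct_summand C X S"
  using direct_summand_opI[of C X S] direct_summand_opI[of "op_cat C" X S] by auto

lemma add_hull_op [simp]: "add_hull (op_cat C) F = add_hull C F"
  unfolding add_hull_def by simp blast

lemma additively_closed_op [simp]: "additively_closed (op_cat C) F = additively_closed C F"
  unfolding additively_closed_def by simp blast

lemma preadditive_op: "preadditive_category C \<Longrightarrow> preadditive_category (op_cat C)"
proof -
  assume "preadditive_category C"
  then interpret preadditive_category C .
  show ?thesis
  proof (rule preadditive_category.intro)
    show "cmp (op_cat C) h (cmp (op_cat C) g f) = cmp (op_cat C) (cmp (op_cat C) h g) f"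
      if "A \<in> ob (op_cat C)" "B \<in> ob (op_cat C)" "D \<in> ob (op_cat C)" "E \<in> ob (op_cat C)"
        "f \<in> mor (op_cat C) A B" "g \<in> mor (op_cat C) B D" "h \<in> mor (op_cat C) D E" for A B D E f g h
      using that cmp_assoc[of E D B A h g f] by simp
  qed (simp_all add: idm_mor cmp_mor cmp_idm idm_cmp hom_comm_group cmp_addm addm_cmp)
qed

lemma abelian_op: "abelian_category C \<Longrightarrow> abelian_category (op_cat C)"
proof -
  assume "abelian_category C"
  then interpret abelian_category C .
  interpret op: preadditive_category "op_cat C" by (rule preadditive_op) unfold_locales
  show ?thesis
  proof unfold_locales
    show "\<exists>S \<iota> \<pi>. is_direct_sum (op_cat C) (UNIV :: bool set) (\<lambda>b. if b then A else B) S \<iota> \<pi>"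
      if "A \<in> ob (op_cat C)" "B \<in> ob (op_cat C)" for A B
      using ex_direct_sum[of A B] that by simp blast
  qed (use ex_zero_object ex_kernel ex_cokernel mono_is_kernel epi_is_cokernel in \<open>auto\<close>)
qed

section \<open>Relative projectivity\<close>

text \<open>
  Everything is relative to a class \<open>\<P>\<close> of objects. It is used with \<open>\<P>\<close> the projective objects, and in an
  opposite category with \<open>\<P>\<close> a tilting subcategory, where \<open>rel_epi\<close> describes left approximations.
\<close>

definition rel_epi :: "('o, 'm) add_cat \<Rightarrow> 'o set \<Rightarrow> 'o \<Rightarrow> 'o \<Rightarrow> 'm \<Rightarrow> bool" where
  "rel_epi C \<P> A B e \<longleftrightarrow> arr C A B e \<and>
     (\<forall>P\<in>\<P>. \<forall>f. arr C P B f \<longrightarrow> (\<exists>g. arr C P A g \<and> e \<cdot>\<^bsub>C\<^esub> g = f))"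

definition short_exact :: "('o, 'm) add_cat \<Rightarrow> 'o \<Rightarrow> 'm \<Rightarrow> 'o \<Rightarrow> 'm \<Rightarrow> 'o \<Rightarrow> bool" where
  "short_exact C L k Q e K \<longleftrightarrow> arr C L Q k \<and> arr C Q K e \<and> is_kernel C Q K e L k \<and> is_epi C Q K e"

definition presentation :: "('o, 'm) add_cat \<Rightarrow> 'o set \<Rightarrow> 'o \<Rightarrow> 'm \<Rightarrow> 'o \<Rightarrow> 'm \<Rightarrow> 'o \<Rightarrow> bool" where
  "presentation C \<P> L k Q e K \<longleftrightarrow> Q \<in> \<P> \<and> short_exact C L k Q e K \<and> rel_epi C \<P> Q K e"

text \<open>
  The identity of \<open>A'\<close> factors through \<open>A\<close> up to a morphism that factors through \<open>\<P>\<close>. Two choices of a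
  syzygy are related in this way, and so are an object and its direct summands.
\<close>

definition stable_retract :: "('o, 'm) add_cat \<Rightarrow> 'o set \<Rightarrow> 'o \<Rightarrow> 'o \<Rightarrow> bool" where
  "stable_retract C \<P> A' A \<longleftrightarrow> (\<exists>u v P s t. P \<in> \<P> \<and> arr C A' A u \<and> arr C A A' v \<and>
     arr C A' P s \<and> arr C P A' t \<and> addm C (v \<cdot>\<^bsub>C\<^esub> u) (t \<cdot>\<^bsub>C\<^esub> s) = idm C A')"

definition extends_along :: "('o, 'm) add_cat \<Rightarrow> 'o \<Rightarrow> 'm \<Rightarrow> 'o \<Rightarrow> 'o \<Rightarrow> bool" where
  "extends_along C L k Q B \<longleftrightarrow> (\<forall>h. arr C L B h \<longrightarrow> (\<exists>w. arr C Q B w \<and> w \<cdot>\<^bsub>C\<^esub> k = h))"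

text \<open>
  For \<open>\<P>\<close> the projective objects this is \<open>Ext\<^sup>m\<^sup>+\<^sup>1(A, B) = 0\<close>: dimension shifting along \<open>m\<close> syzygies, and then the
  vanishing of \<open>Ext\<^sup>1\<close>.
\<close>

primrec ext_vanishes :: "('o, 'm) add_cat \<Rightarrow> 'o set \<Rightarrow> nat \<Rightarrow> 'o \<Rightarrow> 'o \<Rightarrow> bool" where
  "ext_vanishes C \<P> 0 A B = (\<forall>L k Q e. presentation C \<P> L k Q e A \<longrightarrow> extends_along C L k Q B)"
| "ext_vanishes C \<P> (Suc m) A B = (\<forall>L k Q e. presentation C \<P> L k Q e A \<longrightarrow> ext_vanishes C \<P> m L B)"

text \<open>
  The steps of \<open>pdim_le\<close> are \<open>\<P>\<close>-epimorphisms, which makes the length independent of choices. The steps of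
  \<open>resolved\<close> are merely short exact, as in the definition of the projective dimension.
\<close>

primrec pdim_le :: "('o, 'm) add_cat \<Rightarrow> 'o set \<Rightarrow> nat \<Rightarrow> 'o \<Rightarrow> bool" where
  "pdim_le C \<P> 0 A = (A \<in> \<P>)"
| "pdim_le C \<P> (Suc n) A = (\<exists>L k Q e. presentation C \<P> L k Q e A \<and> pdim_le C \<P> n L)"

primrec resolved :: "('o, 'm) add_cat \<Rightarrow> 'o set \<Rightarrow> nat \<Rightarrow> 'o \<Rightarrow> bool" where
  "resolved C \<P> 0 A = (A \<in> \<P>)"
| "resolved C \<P> (Suc n) A = (\<exists>L k Q e. Q \<in> \<P> \<and> short_exact C L k Q e A \<and> resolved C \<P> n L)"

context preadditive_category begin

lemma rel_epi_lift:
  assumes "rel_epi C \<P> A B e" "P \<in> \<P>" "arr C P B f"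
  obtains g where "arr C P A g" "e \<cdot> g = f"
  using assms unfolding rel_epi_def by blast

text \<open>
  One step of the comparison of resolutions. Lift \<open>u\<close>, \<open>v\<close> and \<open>t\<close> to morphisms \<open>U\<close>, \<open>V\<close> and \<open>T\<close> into the objects
  of the presentations. Then \<open>V U + T s e'\<close> and the identity of \<open>Q'\<close> agree after \<open>e'\<close>, so they differ by
  \<open>k' \<sigma>\<close> for some \<open>\<sigma>\<close>; restricted to the kernel \<open>L'\<close> the middle summand disappears. Here \<open>\<sigma>\<close> is the piece of a
  homotopy that this degree contributes.
\<close>

lemma stable_retract_kernel:
  assumes p': "presentation C \<P> L' k' Q' e' K'" and p: "presentation C \<P> L k Q e K" and sr: "stable_retract C \<P> K' K"
  obtains U V u v \<sigma> where "arr C Q' Q U" "arr C Q Q' V" "arr C L' L u" "arr C L L' v" "arr C Q' L' \<sigma>"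
    "k \<cdot> u = U \<cdot> k'" "k' \<cdot> v = V \<cdot> k" "idm C L' = v \<cdot> u \<boxplus> \<sigma> \<cdot> k'"
proof -
  from sr obtain u v P s t where P: "P \<in> \<P>" and u: "arr C K' K u" and v: "arr C K K' v"
    and s: "arr C K' P s" and t: "arr C P K' t" and id: "v \<cdot> u \<boxplus> t \<cdot> s = idm C K'"
    unfolding stable_retract_def by blast
  from p' have Q': "Q' \<in> \<P>" and k': "arr C L' Q' k'" and e': "arr C Q' K' e'"
    and ker': "is_kernel C Q' K' e' L' k'" and re': "rel_epi C \<P> Q' K' e'"
    unfolding presentation_def short_exact_def by auto
  from p have Q: "Q \<in> \<P>" and k: "arr C L Q k" and e: "arr C Q K e"
    and ker: "is_kernel C Q K e L k" and re: "rel_epi C \<P> Q K e"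
    unfolding presentation_def short_exact_def by auto
  have obs: "L' \<in> ob C" "L \<in> ob C" "Q \<in> ob C" "Q' \<in> ob C" "K \<in> ob C" "K' \<in> ob C"
    using k k' e e' by (auto simp: arr_def)
  obtain U where U: "arr C Q' Q U" "e \<cdot> U = u \<cdot> e'" using rel_epi_lift[OF re Q' comp_arr[OF e' u]] .
  obtain V where V: "arr C Q Q' V" "e' \<cdot> V = v \<cdot> e" using rel_epi_lift[OF re' Q comp_arr[OF e v]] .
  obtain T where T: "arr C P Q' T" "e' \<cdot> T = t" using rel_epi_lift[OF re' P t] .
  have VU: "arr C Q' Q' (V \<cdot> U)" and se: "arr C Q' P (s \<cdot> e')" using U V s e' by blast+
  have Tse: "arr C Q' Q' (T \<cdot> (s \<cdot> e'))" using T se by blast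
  define W where "W = V \<cdot> U \<boxplus> T \<cdot> (s \<cdot> e')"
  have W: "arr C Q' Q' W" unfolding W_def using VU Tse by blast
  have "e' \<cdot> W = e' \<cdot> (V \<cdot> U) \<boxplus> e' \<cdot> (T \<cdot> (s \<cdot> e'))"
    unfolding W_def by (rule distrib_left[OF VU Tse e'])
  also have "e' \<cdot> (V \<cdot> U) = (v \<cdot> u) \<cdot> e'"
    using assoc[OF U(1) V(1) e'] assoc[OF U(1) e v] assoc[OF e' u v] U V by simp
  also have "e' \<cdot> (T \<cdot> (s \<cdot> e')) = (t \<cdot> s) \<cdot> e'"
    using assoc[OF se T(1) e'] assoc[OF e' s t] T by simp
  also have "(v \<cdot> u) \<cdot> e' \<boxplus> (t \<cdot> s) \<cdot> e' = e' \<cdot> idm C Q'"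
    using distrib_right[OF e' comp_arr[OF u v] comp_arr[OF s t]] id id_left[OF e'] id_right[OF e'] by simp
  finally have "e' \<cdot> W = e' \<cdot> idm C Q'" .
  from kernel_difference[OF ker' e' W id_arr[OF obs(4)] this]
  obtain \<sigma> where \<sigma>: "arr C Q' L' \<sigma>" "idm C Q' = W \<boxplus> k' \<cdot> \<sigma>" .
  have "e \<cdot> (U \<cdot> k') = u \<cdot> (e' \<cdot> k')"
    using assoc[OF k' U(1) e] assoc[OF k' e' u] U by simp
  also have "\<dots> = zerom C L' K" using kernel_zero[OF ker'] comp_zero[OF u obs(1)] by simp
  finally obtain u' where u': "arr C L' L u'" "k \<cdot> u' = U \<cdot> k'"
    using kernel_factor[OF ker comp_arr[OF k' U(1)]] by blast
  have "e' \<cdot> (V \<cdot> k) = v \<cdot> (e \<cdot> k)"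
    using assoc[OF k V(1) e'] assoc[OF k e v] V by simp
  also have "\<dots> = zerom C L K'" using kernel_zero[OF ker] comp_zero[OF v obs(2)] by simp
  finally obtain v' where v': "arr C L L' v'" "k' \<cdot> v' = V \<cdot> k"
    using kernel_factor[OF ker' comp_arr[OF k V(1)]] by blast
  have vu': "arr C L' L' (v' \<cdot> u')" and sk: "arr C L' L' (\<sigma> \<cdot> k')" using u' v' \<sigma> k' by blast+
  have "W \<cdot> k' = (V \<cdot> U) \<cdot> k' \<boxplus> (T \<cdot> (s \<cdot> e')) \<cdot> k'"
    unfolding W_def by (rule distrib_right[OF k' VU Tse])
  also have "(V \<cdot> U) \<cdot> k' = k' \<cdot> (v' \<cdot> u')"
    using assoc[OF k' U(1) V(1)] assoc[OF u'(1) k V(1)] assoc[OF u'(1) v'(1) k'] u' v' by simp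
  also have "(T \<cdot> (s \<cdot> e')) \<cdot> k' = zerom C L' Q'"
    using assoc[OF k' se T(1)] assoc[OF k' e' s] kernel_zero[OF ker'] comp_zero[OF s obs(1)]
      comp_zero[OF T(1) obs(1)] by simp
  finally have Wk: "W \<cdot> k' = k' \<cdot> (v' \<cdot> u')" using add_zero(1)[OF comp_arr[OF vu' k']] by simp
  have "k' \<cdot> idm C L' = idm C Q' \<cdot> k'" using id_left[OF k'] id_right[OF k'] by simp
  also have "\<dots> = W \<cdot> k' \<boxplus> (k' \<cdot> \<sigma>) \<cdot> k'"
    unfolding \<sigma>(2) by (rule distrib_right[OF k' W comp_arr[OF \<sigma>(1) k']])
  also have "\<dots> = k' \<cdot> (v' \<cdot> u' \<boxplus> \<sigma> \<cdot> k')"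
    using Wk assoc[OF k' \<sigma>(1) k'] distrib_left[OF vu' sk k'] by simp
  finally have "idm C L' = v' \<cdot> u' \<boxplus> \<sigma> \<cdot> k'"
    using kernel_cancel[OF ker' e' id_arr[OF obs(1)] add_arr[OF vu' sk]] by blast
  then show thesis using that U V u' v' \<sigma> by blast
qed

lemma stable_retract_syzygy:
  assumes "presentation C \<P> L' k' Q' e' K'" "presentation C \<P> L k Q e K" "stable_retract C \<P> K' K"
  shows "stable_retract C \<P> L' L"
proof -
  obtain U V u v \<sigma> where a: "arr C Q' Q U" "arr C Q Q' V" "arr C L' L u" "arr C L L' v" "arr C Q' L' \<sigma>"
    "idm C L' = v \<cdot> u \<boxplus> \<sigma> \<cdot> k'" using stable_retract_kernel[OF assms] by metis
  have "Q' \<in> \<P>" "arr C L' Q' k'" using assms(1) by (auto simp: presentation_def short_exact_def)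
  then show ?thesis unfolding stable_retract_def using a by metis
qed

text \<open>
  \<open>Ext\<^sup>1\<close> is additive in its first argument and vanishes on \<open>\<P>\<close>: an extension of \<open>h\<close> is an extension of \<open>h v\<close>,
  pulled back along \<open>U\<close>, corrected by \<open>h \<sigma>\<close>.
\<close>

lemma extends_along_stable_retract:
  assumes "presentation C \<P> L' k' Q' e' K'" "presentation C \<P> L k Q e K" "stable_retract C \<P> K' K"
    and ext: "extends_along C L k Q B"
  shows "extends_along C L' k' Q' B"
  unfolding extends_along_def
proof (intro allI impI)
  fix h assume h: "arr C L' B h"
  have k: "arr C L Q k" and k': "arr C L' Q' k'" using assms(1,2) by (auto simp: presentation_def short_exact_def)
  obtain U V u v \<sigma> where U: "arr C Q' Q U" and V: "arr C Q Q' V" and u: "arr C L' L u"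
    and v: "arr C L L' v" and \<sigma>: "arr C Q' L' \<sigma>" and ku: "k \<cdot> u = U \<cdot> k'"
    and id: "idm C L' = v \<cdot> u \<boxplus> \<sigma> \<cdot> k'" using stable_retract_kernel[OF assms(1-3)] by metis
  obtain w where w: "arr C Q B w" "w \<cdot> k = h \<cdot> v"
    using ext comp_arr[OF v h] unfolding extends_along_def by blast
  have wU: "arr C Q' B (w \<cdot> U)" and h\<sigma>: "arr C Q' B (h \<cdot> \<sigma>)" using w U h \<sigma> by blast+
  have "(w \<cdot> U \<boxplus> h \<cdot> \<sigma>) \<cdot> k' = (w \<cdot> U) \<cdot> k' \<boxplus> (h \<cdot> \<sigma>) \<cdot> k'"
    by (rule distrib_right[OF k' wU h\<sigma>])
  also have "(w \<cdot> U) \<cdot> k' = h \<cdot> (v \<cdot> u)"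
    using assoc[OF k' U w(1)] assoc[OF u k w(1)] assoc[OF u v h] ku w(2) by simp
  also have "(h \<cdot> \<sigma>) \<cdot> k' = h \<cdot> (\<sigma> \<cdot> k')" by (rule assoc[OF k' \<sigma> h])
  also have "h \<cdot> (v \<cdot> u) \<boxplus> h \<cdot> (\<sigma> \<cdot> k') = h"
    using distrib_left[OF comp_arr[OF u v] comp_arr[OF k' \<sigma>] h] id id_right[OF h] by simp
  finally show "\<exists>w. arr C Q' B w \<and> w \<cdot> k' = h" using wU h\<sigma> by blast
qed

lemma stable_retract_refl:
  assumes "A \<in> ob C" "P \<in> \<P>" "P \<in> ob C"
  shows "stable_retract C \<P> A A"
proof -
  have i: "arr C A A (idm C A)" and z: "arr C A P (zerom C A P)" "arr C P A (zerom C P A)"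
    using assms by blast+
  have "idm C A \<cdot> idm C A \<boxplus> zerom C P A \<cdot> zerom C A P = idm C A"
    using id_left[OF i] comp_zero[OF z(2) assms(1)] add_zero[OF i] by simp
  then show ?thesis unfolding stable_retract_def using i z assms(2) by metis
qed

lemma ext_vanishes_stable_retract:
  assumes "ext_vanishes C \<P> m A B" "stable_retract C \<P> A' A"
    and enough: "\<And>A. A \<in> ob C \<Longrightarrow> \<exists>L k Q e. presentation C \<P> L k Q e A"
  shows "ext_vanishes C \<P> m A' B"
  using assms(1,2)
proof (induction m arbitrary: A A')
  case 0
  have "A \<in> ob C" using 0(2) unfolding stable_retract_def arr_def by blast
  then obtain L k Q e where p: "presentation C \<P> L k Q e A" using enough by blast
  then have "extends_along C L k Q B" using 0(1)[unfolded ext_vanishes.simps] by blast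
  then show ?case
    unfolding ext_vanishes.simps using extends_along_stable_retract[OF _ p 0(2)] by blast
next
  case (Suc m)
  have "A \<in> ob C" using Suc(3) unfolding stable_retract_def arr_def by blast
  then obtain L k Q e where p: "presentation C \<P> L k Q e A" using enough by blast
  then have "ext_vanishes C \<P> m L B" using Suc(2)[unfolded ext_vanishes.simps] by blast
  then show ?case
    unfolding ext_vanishes.simps using Suc(1) stable_retract_syzygy[OF _ p Suc(3)] by blast
qed

lemma presentation_refl: "presentation C \<P> L k Q e A \<Longrightarrow> stable_retract C \<P> A A"
  by (rule stable_retract_refl[of _ Q]) (auto simp: presentation_def short_exact_def arr_def)

lemma ext_vanishes_0_iff:
  assumes "presentation C \<P> L k Q e A"
  shows "ext_vanishes C \<P> 0 A B \<longleftrightarrow> extends_along C L k Q B"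
  unfolding ext_vanishes.simps using extends_along_stable_retract[OF _ assms presentation_refl[OF assms]] assms by blast

lemma ext_vanishes_Suc_iff:
  assumes p: "presentation C \<P> L k Q e A"
    and enough: "\<And>A. A \<in> ob C \<Longrightarrow> \<exists>L k Q e. presentation C \<P> L k Q e A"
  shows "ext_vanishes C \<P> (Suc m) A B \<longleftrightarrow> ext_vanishes C \<P> m L B"
  unfolding ext_vanishes.simps
  using ext_vanishes_stable_retract[OF _ stable_retract_syzygy[OF _ p presentation_refl[OF p]] enough] p by blast

end

section \<open>Finite direct sums\<close>

definition retract :: "('o, 'm) add_cat \<Rightarrow> 'o \<Rightarrow> 'o \<Rightarrow> bool" where
  "retract C X S \<longleftrightarrow> (\<exists>s r. arr C X S s \<and> arr C S X r \<and> r \<cdot>\<^bsub>C\<^esub> s = idm C X)"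

definition sum2 :: "('o, 'm) add_cat \<Rightarrow> 'o \<Rightarrow> 'o \<Rightarrow> 'o \<Rightarrow> 'm \<Rightarrow> 'm \<Rightarrow> 'm \<Rightarrow> 'm \<Rightarrow> bool" where
  "sum2 C A B S i\<^sub>1 i\<^sub>2 p\<^sub>1 p\<^sub>2 \<longleftrightarrow> is_direct_sum C (UNIV :: bool set) (\<lambda>b. if b then A else B) S
     (\<lambda>b. if b then i\<^sub>1 else i\<^sub>2) (\<lambda>b. if b then p\<^sub>1 else p\<^sub>2)"

context preadditive_category begin

lemma finprod_insert_arr:
  assumes "A \<in> ob C" "B \<in> ob C" "finite F" "i \<notin> F" "\<And>j. j \<in> insert i F \<Longrightarrow> arr C A B (f j)"
  shows "finprod (hom_group C A B) f (insert i F) = f i \<boxplus> finprod (hom_group C A B) f F"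
proof -
  interpret comm_group "hom_group C A B" using assms by (intro hom_comm_group)
  show ?thesis using finprod_insert[of F i f] assms by (auto simp: arr_def hom_group_def Pi_def)
qed

lemma finprod_empty_arr: "\<lbrakk>A \<in> ob C; B \<in> ob C\<rbrakk> \<Longrightarrow> finprod (hom_group C A B) f {} = zerom C A B"
proof -
  assume a: "A \<in> ob C" "B \<in> ob C"
  interpret comm_group "hom_group C A B" using a by (intro hom_comm_group)
  show ?thesis using finprod_empty by (simp add: hom_group_def)
qed

lemma finprod_arr:
  assumes "A \<in> ob C" "B \<in> ob C" "\<And>j. j \<in> F \<Longrightarrow> arr C A B (f j)"
  shows "arr C A B (finprod (hom_group C A B) f F)"
proof -
  interpret comm_group "hom_group C A B" using assms by (intro hom_comm_group)
  show ?thesis using finprod_closed[of f F] assms by (auto simp: arr_def hom_group_def Pi_def)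
qed

lemma comp_finprod:
  assumes A: "A \<in> ob C" and g: "arr C B D g" and "finite F" "\<And>j. j \<in> F \<Longrightarrow> arr C A B (f j)"
  shows "g \<cdot> finprod (hom_group C A B) f F = finprod (hom_group C A D) (\<lambda>j. g \<cdot> f j) F"
  using assms(3,4)
proof (induction F rule: finite_induct)
  case empty
  have "B \<in> ob C" "D \<in> ob C" using g by (auto simp: arr_def)
  then show ?case using comp_zero[OF g A] A by (simp only: finprod_empty_arr)
next
  case (insert i F)
  have B: "B \<in> ob C" "D \<in> ob C" using g by (auto simp: arr_def)
  have fi: "arr C A B (f i)" and fj: "\<And>j. j \<in> F \<Longrightarrow> arr C A B (f j)" using insert by auto
  have fin: "arr C A B (finprod (hom_group C A B) f F)" using A B fj by (intro finprod_arr)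
  have "g \<cdot> finprod (hom_group C A B) f (insert i F) = g \<cdot> (f i \<boxplus> finprod (hom_group C A B) f F)"
    using finprod_insert_arr[OF A B(1) insert(1,2,4)] by simp
  also have "\<dots> = g \<cdot> f i \<boxplus> finprod (hom_group C A D) (\<lambda>j. g \<cdot> f j) F"
    using distrib_left[OF fi fin g] insert.IH[OF fj] by simp
  also have "\<dots> = finprod (hom_group C A D) (\<lambda>j. g \<cdot> f j) (insert i F)"
    using finprod_insert_arr[OF A B(2) insert(1,2) comp_arr[OF insert(4) g]] by simp
  finally show ?case .
qed

lemma finprod_comp:
  assumes D: "D \<in> ob C" and g: "arr C A B g" and "finite F" "\<And>j. j \<in> F \<Longrightarrow> arr C B D (f j)"
  shows "finprod (hom_group C B D) f F \<cdot> g = finprod (hom_group C A D) (\<lambda>j. f j \<cdot> g) F"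
proof -
  interpret op: preadditive_category "op_cat C" by (rule preadditive_op) unfold_locales
  show ?thesis using op.comp_finprod[of D B A g F f] assms by simp
qed

lemma finprod_arr_cong:
  assumes "\<And>j. j \<in> F \<Longrightarrow> f j = g j" "\<And>j. j \<in> F \<Longrightarrow> arr C A B (g j)" "A \<in> ob C" "B \<in> ob C"
  shows "finprod (hom_group C A B) f F = finprod (hom_group C A B) g F"
proof -
  interpret comm_group "hom_group C A B" using assms by (intro hom_comm_group)
  show ?thesis using assms by (intro finprod_cong') (auto simp: arr_def hom_group_def)
qed

lemma finprod_arr_single:
  assumes "finite F" "i \<in> F" "arr C A B (f i)" "A \<in> ob C" "B \<in> ob C"
    and "\<And>j. \<lbrakk>j \<in> F; j \<noteq> i\<rbrakk> \<Longrightarrow> f j = zerom C A B"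
  shows "finprod (hom_group C A B) f F = f i"
proof -
  interpret comm_group "hom_group C A B" using assms by (intro hom_comm_group)
  have "finprod (hom_group C A B) f F = finprod (hom_group C A B) (\<lambda>j. if i = j then f i else \<one>\<^bsub>hom_group C A B\<^esub>) F"
    using assms by (intro finprod_arr_cong) (auto simp: hom_group_def)
  also have "\<dots> = f i"
    using finprod_singleton[OF assms(2,1), of "\<lambda>_. f i"] assms(3) by (simp add: arr_def hom_group_def)
  finally show ?thesis .
qed

lemma direct_sum_arr:
  assumes "is_direct_sum C I X S \<iota> \<pi>" "i \<in> I"
  shows "arr C (X i) S (\<iota> i)" "arr C S (X i) (\<pi> i)"
  using assms by (auto simp: is_direct_sum_def arr_def)

lemma direct_sum_delta:
  assumes "is_direct_sum C I X S \<iota> \<pi>" "i \<in> I"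
  shows "\<pi> i \<cdot> \<iota> i = idm C (X i)" "\<lbrakk>j \<in> I; j \<noteq> i\<rbrakk> \<Longrightarrow> \<pi> j \<cdot> \<iota> i = zerom C (X i) (X j)"
  using assms by (auto simp: is_direct_sum_def)

text \<open>
  Both universal properties of a direct sum come from the formula \<open>\<Sum>\<^sub>i \<iota>\<^sub>i \<pi>\<^sub>i = 1\<close>. Conversely, \<open>direct_sumI\<close>
  recovers the formula, because all \<open>\<pi>\<^sub>j\<close> take the same value on both of its sides.
\<close>

lemma direct_sum_joint_mono:
  assumes ds: "is_direct_sum C I X S \<iota> \<pi>" and f: "arr C Y S f" and g: "arr C Y S g"
    and eq: "\<And>i. i \<in> I \<Longrightarrow> \<pi> i \<cdot> f = \<pi> i \<cdot> g"
  shows "f = g"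
proof -
  have fin: "finite I" "S \<in> ob C" "Y \<in> ob C" "finprod (hom_group C S S) (\<lambda>i. \<iota> i \<cdot> \<pi> i) I = idm C S"
    using ds f by (auto simp: is_direct_sum_def arr_def)
  have *: "h = finprod (hom_group C Y S) (\<lambda>i. \<iota> i \<cdot> (\<pi> i \<cdot> h)) I" if h: "arr C Y S h" for h
  proof -
    have "h = finprod (hom_group C S S) (\<lambda>i. \<iota> i \<cdot> \<pi> i) I \<cdot> h" using fin id_left[OF h] by simp
    also have "\<dots> = finprod (hom_group C Y S) (\<lambda>i. (\<iota> i \<cdot> \<pi> i) \<cdot> h) I"
      using direct_sum_arr[OF ds] by (intro finprod_comp fin h) blast
    also have "\<dots> = finprod (hom_group C Y S) (\<lambda>i. \<iota> i \<cdot> (\<pi> i \<cdot> h)) I"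
      using assoc[OF h direct_sum_arr(2,1)[OF ds]] direct_sum_arr[OF ds] h fin
      by (intro finprod_arr_cong) blast+
    finally show ?thesis .
  qed
  have "f = finprod (hom_group C Y S) (\<lambda>i. \<iota> i \<cdot> (\<pi> i \<cdot> f)) I" by (rule *[OF f])
  also have "\<dots> = finprod (hom_group C Y S) (\<lambda>i. \<iota> i \<cdot> (\<pi> i \<cdot> g)) I"
    using comp_arr[OF comp_arr[OF g direct_sum_arr(2)[OF ds]] direct_sum_arr(1)[OF ds]] eq fin
    by (intro finprod_arr_cong) auto
  also have "\<dots> = g" by (rule *[OF g, symmetric])
  finally show ?thesis .
qed

lemma direct_sum_tuple:
  assumes ds: "is_direct_sum C I X S \<iota> \<pi>" and Y: "Y \<in> ob C"
    and f: "\<And>i. i \<in> I \<Longrightarrow> arr C Y (X i) (f i)"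
  obtains g where "arr C Y S g" "\<And>i. i \<in> I \<Longrightarrow> \<pi> i \<cdot> g = f i"
proof
  have fin: "finite I" "S \<in> ob C" using ds by (auto simp: is_direct_sum_def)
  define g where "g = finprod (hom_group C Y S) (\<lambda>i. \<iota> i \<cdot> f i) I"
  have *: "arr C Y S (\<iota> i \<cdot> f i)" if "i \<in> I" for i using direct_sum_arr[OF ds that] f[OF that] by blast
  show "arr C Y S g" unfolding g_def using fin Y * by (intro finprod_arr)
  fix j assume j: "j \<in> I"
  have Xj: "X j \<in> ob C" using f[OF j] by (simp add: arr_def)
  have d: "\<pi> j \<cdot> (\<iota> i \<cdot> f i) = (if i = j then f j else zerom C Y (X j))" if i: "i \<in> I" for i
    using assoc[OF f[OF i] direct_sum_arr(1)[OF ds i] direct_sum_arr(2)[OF ds j]] direct_sum_delta[OF ds i] j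
      id_left[OF f[OF j]] zero_comp[OF f[OF i] Xj] by auto
  have "\<pi> j \<cdot> g = finprod (hom_group C Y (X j)) (\<lambda>i. \<pi> j \<cdot> (\<iota> i \<cdot> f i)) I"
    unfolding g_def by (rule comp_finprod[OF Y direct_sum_arr(2)[OF ds j] fin(1) *])
  also have "\<dots> = \<pi> j \<cdot> (\<iota> j \<cdot> f j)"
    using d j f[OF j] fin Y Xj by (intro finprod_arr_single) auto
  finally show "\<pi> j \<cdot> g = f j" using d[OF j] by simp
qed

lemma direct_sum_joint_epi:
  assumes ds: "is_direct_sum C I X S \<iota> \<pi>" and f: "arr C S Y f" and g: "arr C S Y g"
    and eq: "\<And>i. i \<in> I \<Longrightarrow> f \<cdot> \<iota> i = g \<cdot> \<iota> i"
  shows "f = g"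
proof -
  interpret op: preadditive_category "op_cat C" by (rule preadditive_op) unfold_locales
  show ?thesis using op.direct_sum_joint_mono[of I X S \<pi> \<iota> Y f g] assms by simp
qed

lemma direct_sum_cotuple:
  assumes ds: "is_direct_sum C I X S \<iota> \<pi>" and Y: "Y \<in> ob C"
    and f: "\<And>i. i \<in> I \<Longrightarrow> arr C (X i) Y (f i)"
  obtains g where "arr C S Y g" "\<And>i. i \<in> I \<Longrightarrow> g \<cdot> \<iota> i = f i"
proof -
  interpret op: preadditive_category "op_cat C" by (rule preadditive_op) unfold_locales
  show ?thesis using op.direct_sum_tuple[of I X S \<pi> \<iota> Y f] assms that by auto
qed

lemma direct_sumI:
  assumes fin: "finite I" and S: "S \<in> ob C"
    and a: "\<And>i. i \<in> I \<Longrightarrow> arr C (X i) S (\<iota> i)" "\<And>i. i \<in> I \<Longrightarrow> arr C S (X i) (\<pi> i)"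
    and d: "\<And>i j. \<lbrakk>i \<in> I; j \<in> I\<rbrakk> \<Longrightarrow> \<pi> j \<cdot> \<iota> i = (if i = j then idm C (X i) else zerom C (X i) (X j))"
    and mono: "\<And>f g. \<lbrakk>arr C S S f; arr C S S g; \<And>i. i \<in> I \<Longrightarrow> \<pi> i \<cdot> f = \<pi> i \<cdot> g\<rbrakk> \<Longrightarrow> f = g"
  shows "is_direct_sum C I X S \<iota> \<pi>"
proof -
  have *: "arr C S S (\<iota> i \<cdot> \<pi> i)" if "i \<in> I" for i using a[OF that] by blast
  have "finprod (hom_group C S S) (\<lambda>i. \<iota> i \<cdot> \<pi> i) I = idm C S"
  proof (rule mono)
    show "arr C S S (finprod (hom_group C S S) (\<lambda>i. \<iota> i \<cdot> \<pi> i) I)" using S * by (intro finprod_arr)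
    show "arr C S S (idm C S)" using S by blast
    fix j assume j: "j \<in> I"
    have Xj: "X j \<in> ob C" using a[OF j] by (simp add: arr_def)
    have e: "\<pi> j \<cdot> (\<iota> i \<cdot> \<pi> i) = (if i = j then \<pi> j else zerom C S (X j))" if i: "i \<in> I" for i
      using assoc[OF a(2)[OF i] a(1)[OF i] a(2)[OF j]] d[OF i j] id_left[OF a(2)[OF j]]
        zero_comp[OF a(2)[OF i] Xj] by auto
    have "\<pi> j \<cdot> finprod (hom_group C S S) (\<lambda>i. \<iota> i \<cdot> \<pi> i) I
        = finprod (hom_group C S (X j)) (\<lambda>i. \<pi> j \<cdot> (\<iota> i \<cdot> \<pi> i)) I"
      by (rule comp_finprod[OF S a(2)[OF j] fin *])
    also have "\<dots> = \<pi> j \<cdot> (\<iota> j \<cdot> \<pi> j)"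
      using e j a(2)[OF j] fin S Xj by (intro finprod_arr_single) auto
    finally show "\<pi> j \<cdot> finprod (hom_group C S S) (\<lambda>i. \<iota> i \<cdot> \<pi> i) I = \<pi> j \<cdot> idm C S"
      using e[OF j] id_right[OF a(2)[OF j]] by simp
  qed
  then show ?thesis using assms unfolding is_direct_sum_def arr_def by auto
qed

lemma direct_sum_reindex:
  assumes ds: "is_direct_sum C I X S \<iota> \<pi>" and h: "bij_betw h J I"
  shows "is_direct_sum C J (\<lambda>j. X (h j)) S (\<lambda>j. \<iota> (h j)) (\<lambda>j. \<pi> (h j))"
proof (rule direct_sumI)
  have I: "I = h ` J" and inj: "inj_on h J" using h by (auto simp: bij_betw_def)
  show "finite J" using ds h bij_betw_finite by (auto simp: is_direct_sum_def)
  show "S \<in> ob C" using ds by (simp add: is_direct_sum_def)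
  fix i assume "i \<in> J"
  then show "arr C (X (h i)) S (\<iota> (h i))" "arr C S (X (h i)) (\<pi> (h i))"
    using direct_sum_arr[OF ds] I by auto
  fix j assume "j \<in> J"
  then show "\<pi> (h j) \<cdot> \<iota> (h i) = (if i = j then idm C (X (h i)) else zerom C (X (h i)) (X (h j)))"
    using direct_sum_delta[OF ds, of "h i"] I \<open>i \<in> J\<close> inj by (auto simp: inj_on_eq_iff)
next
  fix f g assume "arr C S S f" "arr C S S g" "\<And>j. j \<in> J \<Longrightarrow> \<pi> (h j) \<cdot> f = \<pi> (h j) \<cdot> g"
  note fg = this
  show "f = g"
  proof (rule direct_sum_joint_mono[OF ds fg(1,2)])
    fix i assume "i \<in> I"
    then obtain j where "j \<in> J" "i = h j" using h by (auto simp: bij_betw_def)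
    then show "\<pi> i \<cdot> f = \<pi> i \<cdot> g" using fg(3) by simp
  qed
qed

lemma sum2_ob: "sum2 C A B S i\<^sub>1 i\<^sub>2 p\<^sub>1 p\<^sub>2 \<Longrightarrow> A \<in> ob C \<and> B \<in> ob C \<and> S \<in> ob C"
  unfolding sum2_def is_direct_sum_def by (metis UNIV_I)

lemma sum2_arr:
  assumes "sum2 C A B S i\<^sub>1 i\<^sub>2 p\<^sub>1 p\<^sub>2"
  shows "arr C A S i\<^sub>1" "arr C B S i\<^sub>2" "arr C S A p\<^sub>1" "arr C S B p\<^sub>2"
  using direct_sum_arr[OF assms[unfolded sum2_def], of True] direct_sum_arr[OF assms[unfolded sum2_def], of False]
  by simp_all

lemma sum2_delta:
  assumes "sum2 C A B S i\<^sub>1 i\<^sub>2 p\<^sub>1 p\<^sub>2"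
  shows "p\<^sub>1 \<cdot> i\<^sub>1 = idm C A" "p\<^sub>2 \<cdot> i\<^sub>2 = idm C B" "p\<^sub>1 \<cdot> i\<^sub>2 = zerom C B A" "p\<^sub>2 \<cdot> i\<^sub>1 = zerom C A B"
  using direct_sum_delta[OF assms[unfolded sum2_def], of True] direct_sum_delta[OF assms[unfolded sum2_def], of False]
  by auto

lemma sum2_joint_mono:
  assumes "sum2 C A B S i\<^sub>1 i\<^sub>2 p\<^sub>1 p\<^sub>2" "arr C Y S f" "arr C Y S g" "p\<^sub>1 \<cdot> f = p\<^sub>1 \<cdot> g" "p\<^sub>2 \<cdot> f = p\<^sub>2 \<cdot> g"
  shows "f = g"
  using direct_sum_joint_mono[OF assms(1)[unfolded sum2_def] assms(2,3)] assms(4,5) by auto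

lemma sum2_tuple:
  assumes "sum2 C A B S i\<^sub>1 i\<^sub>2 p\<^sub>1 p\<^sub>2" "arr C Y A f" "arr C Y B g"
  obtains h where "arr C Y S h" "p\<^sub>1 \<cdot> h = f" "p\<^sub>2 \<cdot> h = g"
proof -
  have Y: "Y \<in> ob C" using assms(2) by (simp add: arr_def)
  show thesis
  proof (rule direct_sum_tuple[OF assms(1)[unfolded sum2_def] Y, of "\<lambda>b. if b then f else g"])
    fix h assume h: "arr C Y S h" "\<And>b. b \<in> UNIV \<Longrightarrow> (if b then p\<^sub>1 else p\<^sub>2) \<cdot> h = (if b then f else g)"
    from h(1) h(2)[of True] h(2)[of False] show thesis using that by simp
  qed (use assms(2,3) in auto)
qed

lemma sum2_cotuple:
  assumes "sum2 C A B S i\<^sub>1 i\<^sub>2 p\<^sub>1 p\<^sub>2" "arr C A Y f" "arr C B Y g"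
  obtains h where "arr C S Y h" "h \<cdot> i\<^sub>1 = f" "h \<cdot> i\<^sub>2 = g"
proof -
  have Y: "Y \<in> ob C" using assms(2) by (simp add: arr_def)
  show thesis
  proof (rule direct_sum_cotuple[OF assms(1)[unfolded sum2_def] Y, of "\<lambda>b. if b then f else g"])
    fix h assume h: "arr C S Y h" "\<And>b. b \<in> UNIV \<Longrightarrow> h \<cdot> (if b then i\<^sub>1 else i\<^sub>2) = (if b then f else g)"
    from h(1) h(2)[of True] h(2)[of False] show thesis using that by simp
  qed (use assms(2,3) in auto)
qed

lemma sum2I:
  assumes "arr C A S i\<^sub>1" "arr C B S i\<^sub>2" "arr C S A p\<^sub>1" "arr C S B p\<^sub>2"
    and "p\<^sub>1 \<cdot> i\<^sub>1 = idm C A" "p\<^sub>2 \<cdot> i\<^sub>2 = idm C B" "p\<^sub>1 \<cdot> i\<^sub>2 = zerom C B A" "p\<^sub>2 \<cdot> i\<^sub>1 = zerom C A B"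
    and id: "i\<^sub>1 \<cdot> p\<^sub>1 \<boxplus> i\<^sub>2 \<cdot> p\<^sub>2 = idm C S"
  shows "sum2 C A B S i\<^sub>1 i\<^sub>2 p\<^sub>1 p\<^sub>2"
  unfolding sum2_def
proof (rule direct_sumI)
  show "S \<in> ob C" using assms(1) by (simp add: arr_def)
  fix f g assume f: "arr C S S f" and g: "arr C S S g"
    and eq: "\<And>b. b \<in> UNIV \<Longrightarrow> (if b then p\<^sub>1 else p\<^sub>2) \<cdot> f = (if b then p\<^sub>1 else p\<^sub>2) \<cdot> g"
  have *: "h = i\<^sub>1 \<cdot> (p\<^sub>1 \<cdot> h) \<boxplus> i\<^sub>2 \<cdot> (p\<^sub>2 \<cdot> h)" if h: "arr C S S h" for h
    using id_left[OF h] id distrib_right[OF h comp_arr[OF assms(3,1)] comp_arr[OF assms(4,2)]]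
      assoc[OF h assms(3,1)] assoc[OF h assms(4,2)] by simp
  show "f = g" using *[OF f] *[OF g] eq[of True] eq[of False] by simp
qed (use assms in auto)

lemma sum2_of_direct_sum:
  assumes "is_direct_sum C (UNIV :: bool set) (\<lambda>b. if b then A else B) S \<iota> \<pi>"
  shows "sum2 C A B S (\<iota> True) (\<iota> False) (\<pi> True) (\<pi> False)"
proof -
  have "(\<lambda>b. if b then \<iota> True else \<iota> False) = \<iota>" "(\<lambda>b. if b then \<pi> True else \<pi> False) = \<pi>" by auto
  then show ?thesis using assms by (simp add: sum2_def)
qed

lemma retract_trans:
  assumes "retract C X Y" "retract C Y Z"
  shows "retract C X Z"
proof -
  obtain s r where s: "arr C X Y s" and r: "arr C Y X r" and rs: "r \<cdot> s = idm C X" using assms(1) by (auto simp: retract_def)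
  obtain s' r' where s': "arr C Y Z s'" and r': "arr C Z Y r'" and rs': "r' \<cdot> s' = idm C Y" using assms(2) by (auto simp: retract_def)
  have "(r \<cdot> r') \<cdot> (s' \<cdot> s) = idm C X"
    using assoc[OF comp_arr[OF s s'] r' r] assoc[OF s s' r'] rs rs' id_left[OF s] by simp
  then show ?thesis unfolding retract_def using s s' r r' by blast
qed

lemma retract_refl: "X \<in> ob C \<Longrightarrow> retract C X X"
  unfolding retract_def using id_arr id_left by blast

lemma direct_summand_retract:
  assumes "direct_summand C X S" shows "retract C X S"
proof -
  obtain Y \<iota> \<pi> where "is_direct_sum C (UNIV :: bool set) (\<lambda>b. if b then X else Y) S \<iota> \<pi>"
    using assms by (auto simp: direct_summand_def)
  from sum2_of_direct_sum[OF this] show ?thesis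
    unfolding retract_def by (metis sum2_arr(1,3) sum2_delta(1))
qed

text \<open>
  The complement is the kernel of the retraction.
\<close>

lemma retract_direct_summand:
  assumes "retract C X S" and kernels: "\<And>A B f. arr C A B f \<Longrightarrow> \<exists>K k. is_kernel C A B f K k"
  shows "direct_summand C X S"
proof -
  obtain s r where s: "arr C X S s" and r: "arr C S X r" and rs: "r \<cdot> s = idm C X" using assms by (auto simp: retract_def)
  obtain Y y where k: "is_kernel C S X r Y y" using kernels[OF r] by blast
  have S: "S \<in> ob C" and X: "X \<in> ob C" using r by (auto simp: arr_def)
  have y: "arr C Y S y" using kernel_arr[OF k S] .
  have Y: "Y \<in> ob C" using y by (simp add: arr_def)
  have sr: "arr C S S (s \<cdot> r)" using s r by blast
  have "r \<cdot> (s \<cdot> r) = r \<cdot> idm C S"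
    using assoc[OF r s r] rs id_left[OF r] id_right[OF r] by simp
  from kernel_difference[OF k r sr id_arr[OF S] this]
  obtain q where q: "arr C S Y q" "idm C S = s \<cdot> r \<boxplus> y \<cdot> q" .
  have yq: "arr C S S (y \<cdot> q)" using q y by blast
  have "s \<boxplus> y \<cdot> (q \<cdot> s) = s \<boxplus> zerom C X S"
    using id_left[OF s] q(2) distrib_right[OF s sr yq] assoc[OF s r s] rs id_right[OF s] assoc[OF s q(1) y]
      add_zero(1)[OF s] by simp
  then have "y \<cdot> (q \<cdot> s) = zerom C X S"
    using add_cancel[OF s comp_arr[OF comp_arr[OF s q(1)] y] zero_arr[OF X S]] by blast
  then have qs: "q \<cdot> s = zerom C X Y"
    using kernel_cancel[OF k r comp_arr[OF s q(1)] zero_arr[OF X Y]] comp_zero[OF y X] by simp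
  have "y \<cdot> idm C Y = (s \<cdot> r) \<cdot> y \<boxplus> (y \<cdot> q) \<cdot> y"
    using id_left[OF y] id_right[OF y] q(2) distrib_right[OF y sr yq] by simp
  also have "\<dots> = y \<cdot> (q \<cdot> y)"
    using assoc[OF y r s] kernel_zero[OF k] comp_zero[OF s Y] assoc[OF y q(1) y]
      add_zero(2)[OF comp_arr[OF comp_arr[OF y q(1)] y]] by simp
  finally have qy: "q \<cdot> y = idm C Y"
    using kernel_cancel[OF k r id_arr[OF Y] comp_arr[OF y q(1)]] by simp
  have "sum2 C X Y S s y r q"
    using s y r q(1) rs qy kernel_zero[OF k] qs q(2) by (intro sum2I) simp_all
  then show ?thesis unfolding direct_summand_def sum2_def by blast
qed

lemma rel_epi_add_hull:
  assumes e: "rel_epi C F A B e"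
  shows "rel_epi C (add_hull C F) A B e"
  unfolding rel_epi_def
proof (intro conjI ballI allI impI)
  show ea: "arr C A B e" using e by (simp add: rel_epi_def)
  fix P f assume "P \<in> add_hull C F" and f: "arr C P B f"
  then obtain m :: nat and G S \<iota> \<pi> where G: "\<And>k. k < m \<Longrightarrow> G k \<in> F"
    and ds: "is_direct_sum C {..<m} G S \<iota> \<pi>" and "direct_summand C P S" unfolding add_hull_def by blast
  then obtain s r where s: "arr C P S s" and r: "arr C S P r" and rs: "r \<cdot> s = idm C P"
    using direct_summand_retract unfolding retract_def by blast
  have A: "A \<in> ob C" using ea by (simp add: arr_def)
  have fr: "arr C S B (f \<cdot> r)" using f r by blast
  have "\<exists>g. arr C (G k) A g \<and> e \<cdot> g = (f \<cdot> r) \<cdot> \<iota> k" if "k \<in> {..<m}" for k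
    using rel_epi_lift[OF e, of "G k" "(f \<cdot> r) \<cdot> \<iota> k"] G that direct_sum_arr(1)[OF ds that] fr by auto
  then obtain g where g: "\<And>k. k \<in> {..<m} \<Longrightarrow> arr C (G k) A (g k)"
    "\<And>k. k \<in> {..<m} \<Longrightarrow> e \<cdot> g k = (f \<cdot> r) \<cdot> \<iota> k" by metis
  obtain h where h: "arr C S A h" "\<And>k. k \<in> {..<m} \<Longrightarrow> h \<cdot> \<iota> k = g k"
    using direct_sum_cotuple[OF ds A g(1)] by blast
  have eh: "arr C S B (e \<cdot> h)" using h ea by blast
  have "e \<cdot> h = f \<cdot> r"
    using direct_sum_joint_epi[OF ds eh fr] assoc[OF direct_sum_arr(1)[OF ds] h(1) ea] h(2) g(2) by simp
  then have "e \<cdot> (h \<cdot> s) = f" using assoc[OF s h(1) ea] assoc[OF s r f] rs id_right[OF f] by simp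
  then show "\<exists>g. arr C P A g \<and> e \<cdot> g = f" using s h(1) by blast
qed

lemma additively_closed_direct_sum:
  assumes "additively_closed C \<T>" "is_direct_sum C I X S \<iota> \<pi>" "\<And>i. i \<in> I \<Longrightarrow> X i \<in> \<T>"
  shows "S \<in> \<T>"
proof -
  have "finite I" using assms(2) by (simp add: is_direct_sum_def)
  then obtain h where "bij_betw h {0..<card I} I" using ex_bij_betw_nat_finite by blast
  then have h: "bij_betw h {..<card I} I" by (simp add: atLeast0LessThan)
  have "\<forall>k<card I. X (h k) \<in> \<T>" using h assms(3) by (auto simp: bij_betw_def)
  then show ?thesis
    using assms(1)[unfolded additively_closed_def, THEN conjunct2, THEN conjunct1, rule_format,
        OF _ direct_sum_reindex[OF assms(2) h]] by blast
qed

end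

context abelian_category begin

lemma ex_kernel': "arr C A B f \<Longrightarrow> \<exists>K k. is_kernel C A B f K k"
  using ex_kernel by (auto simp: arr_def)

lemma ex_sum2:
  assumes "A \<in> ob C" "B \<in> ob C"
  obtains S i\<^sub>1 i\<^sub>2 p\<^sub>1 p\<^sub>2 where "sum2 C A B S i\<^sub>1 i\<^sub>2 p\<^sub>1 p\<^sub>2"
  using ex_direct_sum[OF assms] sum2_of_direct_sum by blast

lemma ex_finite_direct_sum:
  assumes "finite I" "\<And>i. i \<in> I \<Longrightarrow> X i \<in> ob C"
  shows "\<exists>S \<iota> \<pi>. is_direct_sum C I X S \<iota> \<pi>"
  using assms
proof (induction I rule: finite_induct)
  case empty
  obtain Z where Z: "is_zero_object C Z" using ex_zero_object by blast
  then have "Z \<in> ob C" by (simp add: is_zero_object_def)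
  moreover have "f = g" if "arr C Z Z f" "arr C Z Z g" for f g
    using zero_object_arr(1)[OF Z] that by (metis arr_def)
  ultimately have "is_direct_sum C {} X Z (\<lambda>_. idm C Z) (\<lambda>_. idm C Z)"
    by (intro direct_sumI) auto
  then show ?case by blast
next
  case (insert i I)
  then obtain S \<iota> \<pi> where ds: "is_direct_sum C I X S \<iota> \<pi>" by auto
  have ob: "X i \<in> ob C" "S \<in> ob C" using insert ds by (auto simp: is_direct_sum_def)
  obtain S' i\<^sub>1 i\<^sub>2 p\<^sub>1 p\<^sub>2 where s2: "sum2 C (X i) S S' i\<^sub>1 i\<^sub>2 p\<^sub>1 p\<^sub>2" using ex_sum2[OF ob] .
  note a = sum2_arr[OF s2] and d = sum2_delta[OF s2]
  note A = direct_sum_arr[OF ds] and D = direct_sum_delta[OF ds]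
  let ?\<iota> = "\<lambda>j. if j = i then i\<^sub>1 else i\<^sub>2 \<cdot> \<iota> j" and ?\<pi> = "\<lambda>j. if j = i then p\<^sub>1 else \<pi> j \<cdot> p\<^sub>2"
  have "is_direct_sum C (insert i I) X S' ?\<iota> ?\<pi>"
  proof (rule direct_sumI)
    show "finite (insert i I)" "S' \<in> ob C" using insert sum2_ob[OF s2] by auto
    show "arr C (X j) S' (?\<iota> j)" "arr C S' (X j) (?\<pi> j)" if "j \<in> insert i I" for j
      using that a A by auto
    fix j k assume jk: "j \<in> insert i I" "k \<in> insert i I"
    have 1: "p\<^sub>1 \<cdot> (i\<^sub>2 \<cdot> \<iota> j) = zerom C (X j) (X i)" if "j \<in> I"
      using assoc[OF A(1)[OF that] a(2,3)] d(3) zero_comp[OF A(1)[OF that] ob(1)] by simp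
    have 2: "(\<pi> k \<cdot> p\<^sub>2) \<cdot> i\<^sub>1 = zerom C (X i) (X k)" if "k \<in> I"
      using assoc[OF a(1,4) A(2)[OF that]] d(4) comp_zero[OF A(2)[OF that] ob(1)] by simp
    have 3: "(\<pi> k \<cdot> p\<^sub>2) \<cdot> (i\<^sub>2 \<cdot> \<iota> j) = \<pi> k \<cdot> \<iota> j" if "j \<in> I" "k \<in> I"
      using assoc[OF comp_arr[OF A(1)[OF that(1)] a(2)] a(4) A(2)[OF that(2)]]
        assoc[OF A(1)[OF that(1)] a(2,4)] d(2) id_left[OF A(1)[OF that(1)]] by simp
    show "?\<pi> k \<cdot> ?\<iota> j = (if j = k then idm C (X j) else zerom C (X j) (X k))"
      using jk 1 2 3 d(1) D[of j] insert(2) by auto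
  next
    fix f g assume f: "arr C S' S' f" and g: "arr C S' S' g"
      and eq: "\<And>j. j \<in> insert i I \<Longrightarrow> ?\<pi> j \<cdot> f = ?\<pi> j \<cdot> g"
    have "p\<^sub>2 \<cdot> f = p\<^sub>2 \<cdot> g"
    proof (rule direct_sum_joint_mono[OF ds comp_arr[OF f a(4)] comp_arr[OF g a(4)]])
      fix j assume j: "j \<in> I"
      then have "j \<noteq> i" using insert(2) by blast
      then show "\<pi> j \<cdot> (p\<^sub>2 \<cdot> f) = \<pi> j \<cdot> (p\<^sub>2 \<cdot> g)"
        using j eq[of j] assoc[OF f a(4) A(2)[OF j]] assoc[OF g a(4) A(2)[OF j]] by auto
    qed
    then show "f = g" using sum2_joint_mono[OF s2 f g] eq[of i] by simp
  qed
  then show ?case by blast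
qed

lemma additively_closed_retract:
  assumes "additively_closed C \<T>" "S \<in> \<T>" "retract C X S"
  shows "X \<in> \<T>"
  using retract_direct_summand[OF assms(3) ex_kernel'] assms(1,2) unfolding additively_closed_def by blast

lemma additively_closed_zero:
  assumes "additively_closed C \<T>" "is_zero_object C Z"
  shows "Z \<in> \<T>"
proof -
  have "Z \<in> ob C" using assms(2) by (simp add: is_zero_object_def)
  moreover have "f = g" if "arr C Z Z f" "arr C Z Z g" for f g
    using zero_object_arr(1)[OF assms(2)] that by (metis arr_def)
  ultimately have "is_direct_sum C {} (\<lambda>_::nat. Z) Z (\<lambda>_. idm C Z) (\<lambda>_. idm C Z)"
    by (intro direct_sumI) auto
  then show ?thesis using additively_closed_direct_sum[OF assms(1)] by blast
qed

lemma additively_closed_sum2: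
  assumes "additively_closed C \<T>" "sum2 C A B S i\<^sub>1 i\<^sub>2 p\<^sub>1 p\<^sub>2" "A \<in> \<T>" "B \<in> \<T>"
  shows "S \<in> \<T>"
  using additively_closed_direct_sum[OF assms(1) assms(2)[unfolded sum2_def]] assms(3,4) by auto

lemma add_hull_intro:
  assumes "A \<in> ob C" "\<And>k. k < m \<Longrightarrow> G k \<in> F" "is_direct_sum C {..<m::nat} G S \<iota> \<pi>" "direct_summand C A S"
  shows "A \<in> add_hull C F"
  using assms unfolding add_hull_def by blast

lemma add_hullI:
  assumes ds: "is_direct_sum C I X S \<iota> \<pi>" and X: "\<And>i. i \<in> I \<Longrightarrow> X i \<in> F" and "retract C A S"
  shows "A \<in> add_hull C F"
proof -
  have "finite I" using ds by (simp add: is_direct_sum_def)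
  then obtain h where "bij_betw h {0..<card I} I" using ex_bij_betw_nat_finite by blast
  then have h: "bij_betw h {..<card I} I" by (simp add: atLeast0LessThan)
  have "\<forall>k<card I. X (h k) \<in> F" using h X by (auto simp: bij_betw_def)
  moreover have "direct_summand C A S" by (rule retract_direct_summand[OF assms(3) ex_kernel'])
  moreover have "A \<in> ob C" using assms(3) by (auto simp: retract_def arr_def)
  ultimately show ?thesis using add_hull_intro[OF _ _ direct_sum_reindex[OF ds h]] by blast
qed

lemma add_hullE:
  assumes "A \<in> add_hull C F"
  obtains m :: nat and G S \<iota> \<pi> where "\<And>k. k < m \<Longrightarrow> G k \<in> F" "is_direct_sum C {..<m} G S \<iota> \<pi>" "retract C A S"
  using assms direct_summand_retract unfolding add_hull_def by blast

text \<open>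
  A finite direct sum of retracts of direct sums is a retract of the iterated direct sum, which is a
  direct sum indexed by pairs.
\<close>

lemma add_hull_additively_closed: "additively_closed C (add_hull C F)"
  unfolding additively_closed_def
proof (intro conjI allI impI ballI)
  show "add_hull C F \<subseteq> ob C" by (auto simp: add_hull_def)
next
  fix S X assume "S \<in> add_hull C F" "direct_summand C X S"
  from \<open>S \<in> add_hull C F\<close> show "X \<in> add_hull C F"
  proof (rule add_hullE)
    fix m :: nat and G U \<iota> \<pi>
    assume G: "\<And>k. k < m \<Longrightarrow> G k \<in> F" and ds: "is_direct_sum C {..<m} G U \<iota> \<pi>" and "retract C S U"
    then have "retract C X U" using retract_trans direct_summand_retract[OF \<open>direct_summand C X S\<close>] by blast
    then show ?thesis using G by (intro add_hullI[OF ds]) auto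
  qed
next
  fix m :: nat and G S \<iota> \<pi>
  assume G: "\<forall>k<m. G k \<in> add_hull C F" and ds: "is_direct_sum C {..<m} G S \<iota> \<pi>"
  have "\<exists>n H U j q. (\<forall>l<n. H l \<in> F) \<and> is_direct_sum C {..<n::nat} H U j q \<and> retract C (G k) U" if "k < m" for k
    using G that add_hullE by metis
  then obtain n H U j q where H: "\<And>k l. \<lbrakk>k < m; l < n k\<rbrakk> \<Longrightarrow> H k l \<in> F"
    and dU: "\<And>k. k < m \<Longrightarrow> is_direct_sum C {..<n k::nat} (H k) (U k) (j k) (q k)"
    and rU: "\<And>k. k < m \<Longrightarrow> retract C (G k) (U k)" by metis
  obtain s r where s: "\<And>k. k < m \<Longrightarrow> arr C (G k) (U k) (s k)"
    and r: "\<And>k. k < m \<Longrightarrow> arr C (U k) (G k) (r k)" and rs: "\<And>k. k < m \<Longrightarrow> r k \<cdot> s k = idm C (G k)"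
    using rU unfolding retract_def by metis
  have U: "U k \<in> ob C" if "k \<in> {..<m}" for k using s that by (simp add: arr_def)
  obtain V \<alpha> \<beta> where dV: "is_direct_sum C {..<m} U V \<alpha> \<beta>"
    using ex_finite_direct_sum[of "{..<m}" U] U by auto
  note \<iota>a = direct_sum_arr(1)[OF ds] and \<pi>a = direct_sum_arr(2)[OF ds]
  note \<alpha>a = direct_sum_arr(1)[OF dV] and \<beta>a = direct_sum_arr(2)[OF dV]
  have S: "S \<in> ob C" and V: "V \<in> ob C" using ds dV by (auto simp: is_direct_sum_def)
  have s\<pi>: "arr C S (U k) (s k \<cdot> \<pi> k)" and r\<beta>: "arr C V (G k) (r k \<cdot> \<beta> k)" if "k \<in> {..<m}" for k
    using comp_arr[OF \<pi>a[OF that] s] comp_arr[OF \<beta>a[OF that] r] that by auto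
  obtain a where a: "arr C S V a" "\<And>k. k \<in> {..<m} \<Longrightarrow> \<beta> k \<cdot> a = s k \<cdot> \<pi> k"
    using direct_sum_tuple[OF dV S s\<pi>] by blast
  obtain b where b: "arr C V S b" "\<And>k. k \<in> {..<m} \<Longrightarrow> \<pi> k \<cdot> b = r k \<cdot> \<beta> k"
    using direct_sum_tuple[OF ds V r\<beta>] by blast
  have "b \<cdot> a = idm C S"
  proof (rule direct_sum_joint_mono[OF ds comp_arr[OF a(1) b(1)] id_arr[OF S]])
    fix k assume k: "k \<in> {..<m}"
    then have km: "k < m" by simp
    have "\<pi> k \<cdot> (b \<cdot> a) = r k \<cdot> (s k \<cdot> \<pi> k)"
      using assoc[OF a(1) b(1) \<pi>a[OF k]] b(2)[OF k] assoc[OF a(1) \<beta>a[OF k] r[OF km]] a(2)[OF k] by simp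
    also have "\<dots> = \<pi> k" using assoc[OF \<pi>a[OF k] s[OF km] r[OF km]] rs[OF km] id_left[OF \<pi>a[OF k]] by simp
    finally show "\<pi> k \<cdot> (b \<cdot> a) = \<pi> k \<cdot> idm C S" using id_right[OF \<pi>a[OF k]] by simp
  qed
  then have SV: "retract C S V" unfolding retract_def using a(1) b(1) by blast
  let ?I = "Sigma {..<m} (\<lambda>k. {..<n k})"
  note jA = direct_sum_arr(1)[OF dU] and qA = direct_sum_arr(2)[OF dU]
  have "is_direct_sum C ?I (\<lambda>(k, l). H k l) V (\<lambda>(k, l). \<alpha> k \<cdot> j k l) (\<lambda>(k, l). q k l \<cdot> \<beta> k)"
  proof (rule direct_sumI)
    show "finite ?I" by simp
    show "arr C (case x of (k, l) \<Rightarrow> H k l) V (case x of (k, l) \<Rightarrow> \<alpha> k \<cdot> j k l)"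
      "arr C V (case x of (k, l) \<Rightarrow> H k l) (case x of (k, l) \<Rightarrow> q k l \<cdot> \<beta> k)" if "x \<in> ?I" for x
      using that comp_arr[OF jA \<alpha>a] comp_arr[OF \<beta>a qA] by auto
    fix x y assume "x \<in> ?I" "y \<in> ?I"
    then obtain k l k' l' where xy: "x = (k, l)" "y = (k', l')" and k: "k < m" "l < n k" and k': "k' < m" "l' < n k'"
      by auto
    have ms: "k \<in> {..<m}" "l \<in> {..<n k}" "k' \<in> {..<m}" "l' \<in> {..<n k'}" using k k' by auto
    have e: "(q k' l' \<cdot> \<beta> k') \<cdot> (\<alpha> k \<cdot> j k l) = q k' l' \<cdot> ((\<beta> k' \<cdot> \<alpha> k) \<cdot> j k l)"
      using assoc[OF comp_arr[OF jA[OF k(1) ms(2)] \<alpha>a[OF ms(1)]] \<beta>a[OF ms(3)] qA[OF k'(1) ms(4)]]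
        assoc[OF jA[OF k(1) ms(2)] \<alpha>a[OF ms(1)] \<beta>a[OF ms(3)]] by simp
    show "(case y of (k, l) \<Rightarrow> q k l \<cdot> \<beta> k) \<cdot> (case x of (k, l) \<Rightarrow> \<alpha> k \<cdot> j k l)
       = (if x = y then idm C (case x of (k, l) \<Rightarrow> H k l) else zerom C (case x of (k, l) \<Rightarrow> H k l) (case y of (k, l) \<Rightarrow> H k l))"
    proof (cases "k = k'")
      case True
      have "q k l' \<cdot> (idm C (U k) \<cdot> j k l) = (if l = l' then idm C (H k l) else zerom C (H k l) (H k l'))"
        using id_left[OF jA[OF k(1) ms(2)]] direct_sum_delta[OF dU[OF k(1)] ms(2)] ms(4) True by auto
      then show ?thesis using e direct_sum_delta(1)[OF dV ms(1)] True xy by auto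
    next
      case False
      have "H k l \<in> ob C" using jA[OF k(1) ms(2)] by (simp add: arr_def)
      then have "q k' l' \<cdot> (zerom C (U k) (U k') \<cdot> j k l) = zerom C (H k l) (H k' l')"
        using zero_comp[OF jA[OF k(1) ms(2)] U[OF ms(3)]] comp_zero[OF qA[OF k'(1) ms(4)]] by simp
      then show ?thesis using e direct_sum_delta(2)[OF dV ms(1) ms(3)] False xy by auto
    qed
  next
    fix f g assume f: "arr C V V f" and g: "arr C V V g"
      and eq: "\<And>x. x \<in> ?I \<Longrightarrow> (case x of (k, l) \<Rightarrow> q k l \<cdot> \<beta> k) \<cdot> f = (case x of (k, l) \<Rightarrow> q k l \<cdot> \<beta> k) \<cdot> g"
    show "f = g"
    proof (rule direct_sum_joint_mono[OF dV f g])
      fix k assume k: "k \<in> {..<m}"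
      then have km: "k < m" by simp
      show "\<beta> k \<cdot> f = \<beta> k \<cdot> g"
      proof (rule direct_sum_joint_mono[OF dU[OF km] comp_arr[OF f \<beta>a[OF k]] comp_arr[OF g \<beta>a[OF k]]])
        fix l assume l: "l \<in> {..<n k}"
        show "q k l \<cdot> (\<beta> k \<cdot> f) = q k l \<cdot> (\<beta> k \<cdot> g)"
          using eq[of "(k, l)"] k l assoc[OF f \<beta>a[OF k] qA[OF km l]] assoc[OF g \<beta>a[OF k] qA[OF km l]] by simp
      qed
    qed
  qed (use V in auto)
  then show "S \<in> add_hull C F" by (rule add_hullI[OF _ _ SV]) (use H in auto)
qed

end

section \<open>Exactness in abelian categories\<close>

context preadditive_category begin

lemma is_epi_iff:
  assumes "arr C A B f"
  shows "is_epi C A B f \<longleftrightarrow> (\<forall>X x. arr C B X x \<longrightarrow> x \<cdot> f = zerom C A X \<longrightarrow> x = zerom C B X)"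
proof -
  interpret op: preadditive_category "op_cat C" by (rule preadditive_op) unfold_locales
  show ?thesis using op.is_mono_iff[of B A f] assms by simp
qed

lemma epi_cancel:
  assumes "is_epi C A B f" "arr C B X g" "arr C B X h" "g \<cdot> f = h \<cdot> f"
  shows "g = h"
  using assms unfolding is_epi_def arr_def by blast

lemma cokernel_arr: "\<lbrakk>is_cokernel C A B f D c; B \<in> ob C\<rbrakk> \<Longrightarrow> arr C B D c"
  by (simp add: is_cokernel_def arr_def)

lemma cokernel_zero: "is_cokernel C A B f D c \<Longrightarrow> c \<cdot> f = zerom C A D"
  by (simp add: is_cokernel_def)

lemma cokernel_factor:
  assumes "is_cokernel C A B f D c" "arr C B X g" "g \<cdot> f = zerom C A X"
  obtains h where "arr C D X h" "h \<cdot> c = g"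
  using assms unfolding is_cokernel_def arr_def by blast

lemma cokernel_is_epi:
  assumes "is_cokernel C A B f D c" "arr C A B f"
  shows "is_epi C B D c"
proof -
  interpret op: preadditive_category "op_cat C" by (rule preadditive_op) unfold_locales
  show ?thesis using op.kernel_is_mono[of B A f D c] assms by simp
qed

lemma is_cokernelI:
  assumes "arr C B D c" "arr C A B f" "c \<cdot> f = zerom C A D"
    and "\<And>X g. \<lbrakk>arr C B X g; g \<cdot> f = zerom C A X\<rbrakk> \<Longrightarrow> \<exists>h. arr C D X h \<and> h \<cdot> c = g"
    and "\<And>X h h'. \<lbrakk>arr C D X h; arr C D X h'; h \<cdot> c = h' \<cdot> c\<rbrakk> \<Longrightarrow> h = h'"
  shows "is_cokernel C A B f D c"
proof -
  interpret op: preadditive_category "op_cat C" by (rule preadditive_op) unfold_locales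
  show ?thesis using op.is_kernelI[of D B c A f] assms by simp
qed

lemma mono_comp:
  assumes m: "is_mono C A B f" and n: "is_mono C B D g" and obs: "A \<in> ob C" "B \<in> ob C" "D \<in> ob C"
  shows "is_mono C A D (g \<cdot> f)"
proof -
  have f: "arr C A B f" and g: "arr C B D g" using m n obs by (auto simp: is_mono_def arr_def)
  show ?thesis
    unfolding is_mono_iff[OF comp_arr[OF f g]]
  proof (intro allI impI)
    fix X x assume x: "arr C X A x" "(g \<cdot> f) \<cdot> x = zerom C X D"
    then have "f \<cdot> x = zerom C X B"
      using assoc[OF x(1) f g] comp_arr[OF x(1) f] n[unfolded is_mono_iff[OF g]] by simp
    then show "x = zerom C X A" using x(1) m[unfolded is_mono_iff[OF f]] by blast
  qed
qed

lemma kernel_of_mono_comp: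
  assumes k: "is_kernel C A B f K k" and m: "is_mono C B D m" and f: "arr C A B f" and g: "arr C B D m"
  shows "is_kernel C A D (m \<cdot> f) K k"
proof (rule is_kernelI)
  have obs: "A \<in> ob C" "B \<in> ob C" "D \<in> ob C" using f g by (auto simp: arr_def)
  show ka: "arr C K A k" using kernel_arr[OF k obs(1)] .
  show "arr C A D (m \<cdot> f)" using f g by blast
  have K: "K \<in> ob C" using ka by (simp add: arr_def)
  show "m \<cdot> f \<cdot> k = zerom C K D" using assoc[OF ka f g] kernel_zero[OF k] comp_zero[OF g K] by simp
  show "\<exists>h. arr C X K h \<and> k \<cdot> h = x" if x: "arr C X A x" "m \<cdot> f \<cdot> x = zerom C X D" for X x
  proof -
    have "f \<cdot> x = zerom C X B"
      using assoc[OF x(1) f g] x(2) comp_arr[OF x(1) f] m[unfolded is_mono_iff[OF g]] by simp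
    then show ?thesis using kernel_factor[OF k x(1)] by metis
  qed
  show "h = h'" if "arr C X K h" "arr C X K h'" "k \<cdot> h = k \<cdot> h'" for X h h'
    using kernel_cancel[OF k f that] .
qed

lemma kernel_of_mono_comp_cancel:
  assumes k: "is_kernel C A D (m \<cdot> f) K k" and m: "is_mono C B D m" and f: "arr C A B f" and g: "arr C B D m"
  shows "is_kernel C A B f K k"
proof (rule is_kernelI)
  have obs: "A \<in> ob C" "B \<in> ob C" "D \<in> ob C" using f g by (auto simp: arr_def)
  show ka: "arr C K A k" using kernel_arr[OF k obs(1)] .
  show "arr C A B f" by (rule f)
  have K: "K \<in> ob C" using ka by (simp add: arr_def)
  show "f \<cdot> k = zerom C K B"
    using assoc[OF ka f g] kernel_zero[OF k] comp_arr[OF ka f] m[unfolded is_mono_iff[OF g]] by simp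
  show "\<exists>h. arr C X K h \<and> k \<cdot> h = x" if x: "arr C X A x" "f \<cdot> x = zerom C X B" for X x
  proof -
    have X: "X \<in> ob C" using x(1) by (simp add: arr_def)
    have "m \<cdot> f \<cdot> x = zerom C X D" using assoc[OF x(1) f g] x(2) comp_zero[OF g X] by simp
    then show ?thesis using kernel_factor[OF k x(1)] by metis
  qed
  show "h = h'" if "arr C X K h" "arr C X K h'" "k \<cdot> h = k \<cdot> h'" for X h h'
    using kernel_cancel[OF k comp_arr[OF f g] that] .
qed

lemma id_epi: "A \<in> ob C \<Longrightarrow> is_epi C A A (idm C A)"
  unfolding is_epi_def using id_right idm_mor by (auto simp: arr_def cmp_idm)

lemma zero_kernel_of_mono:
  assumes m: "is_mono C A B f" and f: "arr C A B f" and Z: "is_zero_object C Z"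
  shows "is_kernel C A B f Z (zerom C Z A)"
proof (rule is_kernelI)
  have obs: "A \<in> ob C" "B \<in> ob C" "Z \<in> ob C" using f Z by (auto simp: arr_def is_zero_object_def)
  show z: "arr C Z A (zerom C Z A)" using obs by blast
  show "arr C A B f" by (rule f)
  show "f \<cdot> zerom C Z A = zerom C Z B" using comp_zero[OF f obs(3)] .
  show "\<exists>h. arr C X Z h \<and> zerom C Z A \<cdot> h = g" if g: "arr C X A g" "f \<cdot> g = zerom C X B" for X g
  proof -
    have X: "X \<in> ob C" using g by (simp add: arr_def)
    have "g = zerom C X A" using g m[unfolded is_mono_iff[OF f]] by blast
    then show ?thesis using zero_arr[OF X obs(3)] zero_comp[OF zero_arr[OF X obs(3)] obs(1)] by metis
  qed
  show "h = h'" if "arr C X Z h" "arr C X Z h'" "zerom C Z A \<cdot> h = zerom C Z A \<cdot> h'" for X h h'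
    using zero_object_arr(2)[OF Z] that by (metis arr_def)
qed

lemma kernel_of_zero:
  assumes "A \<in> ob C" "B \<in> ob C"
  shows "is_kernel C A B (zerom C A B) A (idm C A)"
  using assms id_arr[OF assms(1)] zero_arr[OF assms] id_left id_right[OF zero_arr[OF assms]]
  by (intro is_kernelI) auto

end

context abelian_category begin

lemma epi_cokernel_of_kernel:
  assumes e: "is_epi C A B e" and ea: "arr C A B e" and k: "is_kernel C A B e K k"
  shows "is_cokernel C K A k B e"
proof -
  have obs: "A \<in> ob C" "B \<in> ob C" using ea by (auto simp: arr_def)
  obtain D g where D: "D \<in> ob C" "g \<in> mor C D A" "is_cokernel C D A g B e"
    using epi_is_cokernel[OF obs e] by blast
  have g: "arr C D A g" using D obs by (simp add: arr_def)
  have ka: "arr C K A k" using kernel_arr[OF k obs(1)] .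
  obtain h where h: "arr C D K h" "k \<cdot> h = g" using kernel_factor[OF k g cokernel_zero[OF D(3)]] .
  show ?thesis
  proof (rule is_cokernelI[OF ea ka kernel_zero[OF k]])
    fix X x assume x: "arr C A X x" "x \<cdot> k = zerom C K X"
    have X: "X \<in> ob C" using x by (simp add: arr_def)
    have "x \<cdot> g = zerom C D X" using assoc[OF h(1) ka x(1)] h(2) x(2) zero_comp[OF h(1) X] by simp
    then show "\<exists>h. arr C B X h \<and> h \<cdot> e = x" using cokernel_factor[OF D(3) x(1)] by metis
  qed (rule epi_cancel[OF e])
qed

lemma mono_kernel_of_cokernel:
  assumes "is_mono C A B m" "arr C A B m" "is_cokernel C A B m D c"
  shows "is_kernel C B D c A m"
proof -
  interpret op: abelian_category "op_cat C" by (rule abelian_op) unfold_locales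
  show ?thesis using op.epi_cokernel_of_kernel[of B A m D c] assms by simp
qed

lemma short_exact_op: "short_exact (op_cat C) L k Q e K \<longleftrightarrow> short_exact C K e Q k L"
proof
  assume "short_exact (op_cat C) L k Q e K"
  then have a: "arr C Q L k" "arr C K Q e" "is_cokernel C K Q e L k" "is_mono C K Q e"
    by (auto simp: short_exact_def)
  then show "short_exact C K e Q k L"
    unfolding short_exact_def using mono_kernel_of_cokernel cokernel_is_epi by blast
next
  assume "short_exact C K e Q k L"
  then have a: "arr C Q L k" "arr C K Q e" "is_kernel C Q L k K e" "is_epi C Q L k"
    by (auto simp: short_exact_def)
  then show "short_exact (op_cat C) L k Q e K"
    unfolding short_exact_def using epi_cokernel_of_kernel kernel_is_mono by simp
qed

text \<open>
  The existence of images. If \<open>h f' = 0\<close>, then \<open>f\<close> factors through the subobject \<open>ker h\<close> of \<open>K\<close>. As a subobject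
  of \<open>B\<close> this is the kernel of some \<open>q\<close>, and \<open>q\<close> factors through the cokernel of \<open>f\<close>, hence vanishes on \<open>K\<close>.
  So \<open>ker h\<close> is all of \<open>K\<close>.
\<close>

lemma image_epi:
  assumes f: "arr C A B f" and c: "is_cokernel C A B f E c" and k: "is_kernel C B E c K k"
    and f': "arr C A K f'" "k \<cdot> f' = f"
  shows "is_epi C A K f'"
  unfolding is_epi_iff[OF f'(1)]
proof (intro allI impI)
  fix X h assume h: "arr C K X h" "h \<cdot> f' = zerom C A X"
  have obs: "A \<in> ob C" "B \<in> ob C" "K \<in> ob C" "X \<in> ob C" using f f' h by (auto simp: arr_def)
  have ca: "arr C B E c" using cokernel_arr[OF c obs(2)] .
  have ka: "arr C K B k" using kernel_arr[OF k obs(2)] .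
  obtain L l where l: "is_kernel C K X h L l" using ex_kernel'[OF h(1)] by blast
  have la: "arr C L K l" using kernel_arr[OF l obs(3)] .
  have L: "L \<in> ob C" using la by (simp add: arr_def)
  obtain f'' where f'': "arr C A L f''" "l \<cdot> f'' = f'" using kernel_factor[OF l f'(1) h(2)] .
  have kl: "arr C L B (k \<cdot> l)" using ka la by blast
  have "is_mono C L B (k \<cdot> l)"
    using mono_comp[OF kernel_is_mono[OF l h(1)] kernel_is_mono[OF k ca]] obs L by blast
  then obtain D q where D: "D \<in> ob C" "q \<in> mor C B D" "is_kernel C B D q L (k \<cdot> l)"
    using mono_is_kernel[OF L obs(2)] by blast
  have q: "arr C B D q" using D obs by (simp add: arr_def)
  have "q \<cdot> f = (q \<cdot> (k \<cdot> l)) \<cdot> f''"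
    using f'(2) f''(2) assoc[OF f''(1) kl q] assoc[OF f''(1) la ka] by simp
  also have "\<dots> = zerom C A D" using kernel_zero[OF D(3)] zero_comp[OF f''(1) D(1)] by simp
  finally obtain q' where q': "arr C E D q'" "q' \<cdot> c = q" using cokernel_factor[OF c q] by blast
  have "q \<cdot> k = zerom C K D"
    using q'(2) assoc[OF ka ca q'(1)] kernel_zero[OF k] comp_zero[OF q'(1) obs(3)] by simp
  then obtain t where t: "arr C K L t" "(k \<cdot> l) \<cdot> t = k" using kernel_factor[OF D(3) ka] by blast
  have "k \<cdot> (l \<cdot> t) = k \<cdot> idm C K" using assoc[OF t(1) la ka] t(2) id_right[OF ka] by simp
  then have lt: "l \<cdot> t = idm C K" using kernel_cancel[OF k ca comp_arr[OF t(1) la] id_arr[OF obs(3)]] by simp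
  have "h = h \<cdot> (l \<cdot> t)" using lt id_right[OF h(1)] by simp
  also have "\<dots> = zerom C K X" using assoc[OF t(1) la h(1)] kernel_zero[OF l] zero_comp[OF t(1) obs(4)] by simp
  finally show "h = zerom C K X" .
qed

text \<open>
  The next two lemmas put exactness into the form in which it is used: \<open>f\<close> is an epimorphism followed by
  the kernel of \<open>g\<close>.
\<close>

lemma exact_atE:
  assumes ex: "exact_at C A f B g D" and obs: "A \<in> ob C" "B \<in> ob C" "D \<in> ob C"
  obtains K k f' where "is_kernel C B D g K k" "arr C A K f'" "is_epi C A K f'" "k \<cdot> f' = f"
proof -
  from ex obtain E c K k where c: "is_cokernel C A B f E c" and k: "is_kernel C B E c K k"
    and gk: "is_kernel C B D g K k" and f: "arr C A B f" unfolding exact_at_def arr_def using obs by blast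
  obtain f' where f': "arr C A K f'" "k \<cdot> f' = f" using kernel_factor[OF k f cokernel_zero[OF c]] .
  show thesis using that[OF gk f'(1) image_epi[OF f c k f'] f'(2)] .
qed

lemma exact_atI:
  assumes g: "arr C B D g" and k: "is_kernel C B D g K k" and f': "arr C A K f'" and e: "is_epi C A K f'"
  shows "exact_at C A (k \<cdot> f') B g D"
proof -
  have obs: "A \<in> ob C" "B \<in> ob C" "D \<in> ob C" "K \<in> ob C" using f' g by (auto simp: arr_def)
  have ka: "arr C K B k" using kernel_arr[OF k obs(2)] .
  have f: "arr C A B (k \<cdot> f')" using ka f' by blast
  obtain E c where c: "is_cokernel C A B (k \<cdot> f') E c" using ex_cokernel[of A B "k \<cdot> f'"] f by (auto simp: arr_def)
  have ca: "arr C B E c" using cokernel_arr[OF c obs(2)] .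
  have E: "E \<in> ob C" using ca by (simp add: arr_def)
  have "is_cokernel C K B k E c"
  proof (rule is_cokernelI[OF ca ka])
    have "(c \<cdot> k) \<cdot> f' = zerom C K E \<cdot> f'"
      using assoc[OF f' ka ca] cokernel_zero[OF c] zero_comp[OF f' E] by simp
    then show "c \<cdot> k = zerom C K E"
      using epi_cancel[OF e comp_arr[OF ka ca] zero_arr[OF obs(4) E]] by simp
    fix X x assume x: "arr C B X x" "x \<cdot> k = zerom C K X"
    have X: "X \<in> ob C" using x by (simp add: arr_def)
    have "x \<cdot> (k \<cdot> f') = zerom C A X"
      using assoc[OF f' ka x(1)] x(2) zero_comp[OF f' X] by simp
    then show "\<exists>h. arr C E X h \<and> h \<cdot> c = x" using cokernel_factor[OF c x(1)] by metis
  qed (rule epi_cancel[OF cokernel_is_epi[OF c f]])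
  then have "is_kernel C B E c K k"
    using mono_kernel_of_cokernel[OF kernel_is_mono[OF k g] ka] by blast
  then show ?thesis unfolding exact_at_def using c k f g by (auto simp: arr_def)
qed

lemma exact_at_op:
  assumes ex: "exact_at C A f B g D" and obs: "A \<in> ob C" "B \<in> ob C" "D \<in> ob C"
  shows "exact_at (op_cat C) D g B f A"
proof -
  from ex obtain E c K k where c: "is_cokernel C A B f E c" and k: "is_kernel C B E c K k"
    and gk: "is_kernel C B D g K k" and f: "arr C A B f" and g: "arr C B D g"
    unfolding exact_at_def arr_def using obs by blast
  have "is_cokernel C K B k E c"
    by (rule epi_cokernel_of_kernel[OF cokernel_is_epi[OF c f] cokernel_arr[OF c obs(2)] k])
  then show ?thesis
    unfolding exact_at_def using gk c f g by (auto simp: arr_def)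
qed

lemma mono_epi_iso:
  assumes m: "is_mono C A B f" and e: "is_epi C A B f" and f: "arr C A B f"
  obtains g where "arr C B A g" "f \<cdot> g = idm C B" "g \<cdot> f = idm C A"
proof -
  have obs: "A \<in> ob C" "B \<in> ob C" using f by (auto simp: arr_def)
  obtain D q where D: "D \<in> ob C" "q \<in> mor C B D" "is_kernel C B D q A f"
    using mono_is_kernel[OF obs m] by blast
  have q: "arr C B D q" using D obs by (simp add: arr_def)
  have "q \<cdot> f = zerom C B D \<cdot> f" using kernel_zero[OF D(3)] zero_comp[OF f D(1)] by simp
  then have q0: "q = zerom C B D" using epi_cancel[OF e q zero_arr[OF obs(2) D(1)]] by simp
  then have "q \<cdot> idm C B = zerom C B D" using id_right[OF q] by simp
  then obtain g where g: "arr C B A g" "f \<cdot> g = idm C B" using kernel_factor[OF D(3) id_arr[OF obs(2)]] by blast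
  have "f \<cdot> (g \<cdot> f) = f \<cdot> idm C A" using assoc[OF f g(1) f] g(2) id_left[OF f] id_right[OF f] by simp
  then have "g \<cdot> f = idm C A" using mono_cancel[OF m comp_arr[OF f g(1)] id_arr[OF obs(1)]] by simp
  then show thesis using that g by blast
qed

lemma epi_before_zero:
  assumes ex: "exact_at C A f B g Z" and Z: "is_zero_object C Z" and f: "arr C A B f" and g: "arr C B Z g"
  shows "is_epi C A B f"
proof -
  have obs: "A \<in> ob C" "B \<in> ob C" "Z \<in> ob C" using f g by (auto simp: arr_def)
  obtain K k f' where k: "is_kernel C B Z g K k" "arr C A K f'" "is_epi C A K f'" "k \<cdot> f' = f"
    using exact_atE[OF ex obs] .
  have ka: "arr C K B k" using kernel_arr[OF k(1) obs(2)] .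
  have K: "K \<in> ob C" using ka by (simp add: arr_def)
  have i: "arr C B B (idm C B)" using obs by blast
  have "g = zerom C B Z" using zero_object_arr(2)[OF Z obs(2)] g by blast
  then obtain t where t: "arr C B K t" "k \<cdot> t = idm C B"
    using kernel_factor[OF k(1) i] zero_comp[OF i obs(3)] by auto
  show ?thesis
    unfolding is_epi_iff[OF f]
  proof (intro allI impI)
    fix Y x assume x: "arr C B Y x" "x \<cdot> f = zerom C A Y"
    have Y: "Y \<in> ob C" using x by (simp add: arr_def)
    have "(x \<cdot> k) \<cdot> f' = zerom C K Y \<cdot> f'"
      using assoc[OF k(2) ka x(1)] k(4) x(2) zero_comp[OF k(2) Y] by simp
    then have "x \<cdot> k = zerom C K Y" using epi_cancel[OF k(3) comp_arr[OF ka x(1)] zero_arr[OF K Y]] by simp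
    then have "x \<cdot> (k \<cdot> t) = zerom C B Y" using assoc[OF t(1) ka x(1)] zero_comp[OF t(1) Y] by simp
    then show "x = zerom C B Y" using t(2) id_right[OF x(1)] by simp
  qed
qed

lemma mono_after_zero:
  assumes ex: "exact_at C Z g A f B" and Z: "is_zero_object C Z" and g: "arr C Z A g" and f: "arr C A B f"
  shows "is_mono C A B f"
proof -
  interpret op: abelian_category "op_cat C" by (rule abelian_op) unfold_locales
  have "Z \<in> ob C" "A \<in> ob C" "B \<in> ob C" using f g by (auto simp: arr_def)
  then show ?thesis using op.epi_before_zero[of B f A g Z] exact_at_op[OF ex] Z f g by simp
qed

section \<open>Splicing short exact sequences\<close>

text \<open>
  The last object \<open>A\<close> and the zero object after it are peeled off: the sequence continues with the kernel
  \<open>L\<close> of the last epimorphism in place of its source. The converse lemma below splices \<open>L\<close> back in.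
\<close>

lemma resolved_of_exact_sequence:
  assumes \<P>: "additively_closed C \<P>"
  shows "\<lbrakk>exact_sequence C (n + 3) X d; is_zero_object C (X 0); is_zero_object C (X (n + 3));
    \<And>k. k \<le> n \<Longrightarrow> X (k + 1) \<in> \<P>\<rbrakk> \<Longrightarrow> resolved C \<P> n (X (n + 2))"
proof (induction n arbitrary: X d)
  case 0
  have ob: "X k \<in> ob C" if "k \<le> 3" for k using 0(1) that by (simp add: exact_sequence_def)
  have d: "arr C (X k) (X (k + 1)) (d k)" if "k < 3" for k
    using 0(1) that ob[of k] ob[of "k + 1"] by (simp add: exact_sequence_def arr_def)
  have ex: "exact_at C (X k) (d k) (X (k + 1)) (d (k + 1)) (X (k + 2))" if "k < 2" for k
    using 0(1) that by (simp add: exact_sequence_def)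
  have d1: "arr C (X 1) (X 2) (d 1)" using d[of 1] by (simp add: numeral_2_eq_2)
  have mono: "is_mono C (X 1) (X 2) (d 1)"
    using mono_after_zero[OF ex[of 0] 0(2)] d[of 0] d1 by (simp add: numeral_2_eq_2)
  have "is_epi C (X 1) (X 2) (d 1)"
    using epi_before_zero[OF ex[of 1]] 0(3) d1 d[of 2] by (simp add: numeral_2_eq_2 numeral_3_eq_3)
  then obtain g where "arr C (X 2) (X 1) g" "d 1 \<cdot> g = idm C (X 2)" using mono_epi_iso[OF mono _ d1] by blast
  then have "retract C (X 2) (X 1)" unfolding retract_def using d1 by blast
  then have "X 2 \<in> \<P>" using additively_closed_retract[OF \<P>] 0(4)[of 0] by simp
  then show ?case by (simp add: numeral_2_eq_2)
next
  case (Suc n)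
  have ob: "X k \<in> ob C" if "k \<le> n + 4" for k using Suc(2) that by (simp add: exact_sequence_def)
  have d: "arr C (X k) (X (k + 1)) (d k)" if "k < n + 4" for k
    using Suc(2) that ob[of k] ob[of "k + 1"] by (simp add: exact_sequence_def arr_def)
  have ex: "exact_at C (X k) (d k) (X (k + 1)) (d (k + 1)) (X (k + 2))" if "k < n + 3" for k
    using Suc(2) that by (simp add: exact_sequence_def)
  have Z: "is_zero_object C (X (n + 4))" using Suc(4) by (simp add: add.commute)
  have D: "arr C (X (n + 1)) (X (n + 2)) (d (n + 1))" "arr C (X (n + 2)) (X (n + 3)) (d (n + 2))"
    "arr C (X (n + 3)) (X (n + 4)) (d (n + 3))"
    using d[of "n + 1"] d[of "n + 2"] d[of "n + 3"] by (simp_all add: numeral_eq_Suc)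
  have E: "exact_at C (X (n + 1)) (d (n + 1)) (X (n + 2)) (d (n + 2)) (X (n + 3))"
    "exact_at C (X (n + 2)) (d (n + 2)) (X (n + 3)) (d (n + 3)) (X (n + 4))"
    using ex[of "n + 1"] ex[of "n + 2"] by (simp_all add: numeral_eq_Suc)
  obtain L l f where l: "is_kernel C (X (n + 2)) (X (n + 3)) (d (n + 2)) L l" "arr C (X (n + 1)) L f"
    "is_epi C (X (n + 1)) L f" "l \<cdot> f = d (n + 1)"
    using exact_atE[OF E(1) ob ob ob] by auto
  have la: "arr C L (X (n + 2)) l" using kernel_arr[OF l(1)] ob by simp
  have L: "L \<in> ob C" using la by (simp add: arr_def)
  have lm: "is_mono C L (X (n + 2)) l" by (rule kernel_is_mono[OF l(1) D(2)])
  have epi: "is_epi C (X (n + 2)) (X (n + 3)) (d (n + 2))" by (rule epi_before_zero[OF E(2) Z D(2,3)])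
  have s: "short_exact C L l (X (n + 2)) (d (n + 2)) (X (n + 3))" unfolding short_exact_def using la D(2) l(1) epi by blast
  define X' where "X' = X(n + 2 := L, n + 3 := X (n + 4))"
  define d' where "d' = d(n + 1 := f, n + 2 := zerom C L (X (n + 4)))"
  have z: "arr C L (X (n + 4)) (zerom C L (X (n + 4)))" using L ob by auto
  have "exact_sequence C (n + 3) X' d'"
    unfolding exact_sequence_def
  proof (intro conjI allI impI)
    fix k assume "k \<le> n + 3"
    then show "X' k \<in> ob C" using ob L by (auto simp: X'_def)
  next
    fix k assume k: "k < n + 3"
    then consider "k = n + 2" | "k = n + 1" | "k \<le> n" by linarith
    then show "d' k \<in> mor C (X' k) (X' (k + 1))"
      using d[of k] l(2) z by cases (auto simp: X'_def d'_def arr_def)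
  next
    fix k assume k: "k + 1 < n + 3"
    then consider "k = n + 1" | "k = n" | "k < n" by linarith
    then show "exact_at C (X' k) (d' k) (X' (k + 1)) (d' (k + 1)) (X' (k + 2))"
    proof cases
      case 1
      have "exact_at C (X (n + 1)) (idm C L \<cdot> f) L (zerom C L (X (n + 4))) (X (n + 4))"
        by (rule exact_atI[OF z kernel_of_zero[OF L ob] l(2,3)]) simp
      then show ?thesis using 1 id_left[OF l(2)] by (simp add: X'_def d'_def)
    next
      case 2
      have En: "exact_at C (X n) (d n) (X (n + 1)) (l \<cdot> f) (X (n + 2))" using ex[of n] l(4) by simp
      obtain K k' f' where K: "is_kernel C (X (n + 1)) (X (n + 2)) (l \<cdot> f) K k'" "arr C (X n) K f'"
        "is_epi C (X n) K f'" "k' \<cdot> f' = d n" using exact_atE[OF En ob ob ob] by auto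
      from exact_atI[OF l(2) kernel_of_mono_comp_cancel[OF K(1) lm l(2) la] K(2,3)]
      show ?thesis using 2 K(4) by (simp add: X'_def d'_def)
    next
      case 3
      then show ?thesis using ex[of k] by (simp add: X'_def d'_def)
    qed
  qed
  moreover have "is_zero_object C (X' 0)" "is_zero_object C (X' (n + 3))" using Suc(3) Z by (auto simp: X'_def)
  moreover have "X' (k + 1) \<in> \<P>" if "k \<le> n" for k using Suc(5)[of k] that by (simp add: X'_def)
  ultimately have "resolved C \<P> n (X' (n + 2))" by (rule Suc(1))
  then have "resolved C \<P> n L" by (simp add: X'_def)
  moreover have "X (n + 2) \<in> \<P>" using Suc(5)[of "n + 1"] by simp
  ultimately have "resolved C \<P> (Suc n) (X (n + 3))" using s unfolding resolved.simps by blast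
  then show ?case by (simp add: numeral_eq_Suc)
qed

lemma exact_sequence_of_resolved:
  assumes "\<P> \<subseteq> ob C"
  shows "resolved C \<P> n A \<Longrightarrow> \<exists>X d. exact_sequence C (n + 3) X d \<and> is_zero_object C (X 0) \<and>
    (\<forall>k\<le>n. X (k + 1) \<in> \<P>) \<and> X (n + 2) = A \<and> is_zero_object C (X (n + 3))"
proof (induction n arbitrary: A)
  case 0
  obtain Z where Z: "is_zero_object C Z" using ex_zero_object by blast
  then have Zo: "Z \<in> ob C" by (simp add: is_zero_object_def)
  have A: "A \<in> \<P>" "A \<in> ob C" using 0 assms by auto
  have i: "arr C A A (idm C A)" using A by blast
  have z: "arr C A Z (zerom C A Z)" "arr C Z A (zerom C Z A)" using A Zo by blast+
  have im: "is_mono C A A (idm C A)" by (rule kernel_is_mono[OF kernel_of_zero[OF A(2) Zo] z(1)])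
  define X where "X k = (if k = 1 \<or> k = 2 then A else Z)" for k :: nat
  define d where "d k = (if k = 0 then zerom C Z A else if k = 1 then idm C A else zerom C A Z)" for k :: nat
  have e1: "exact_at C Z (zerom C Z A) A (idm C A) A"
    using exact_atI[OF i zero_kernel_of_mono[OF im i Z] id_arr[OF Zo] id_epi[OF Zo]] id_right[OF z(2)] by simp
  have e2: "exact_at C A (idm C A) A (zerom C A Z) Z"
    using exact_atI[OF z(1) kernel_of_zero[OF A(2) Zo] i id_epi[OF A(2)]] id_right[OF i] by simp
  have "exact_sequence C (0 + 3) X d"
    unfolding exact_sequence_def
  proof (intro conjI allI impI)
    fix k :: nat
    show "X k \<in> ob C" using A Zo by (simp add: X_def)
    show "d k \<in> mor C (X k) (X (k + 1))" if "k < 0 + 3"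
    proof -
      from that consider "k = 0" | "k = 1" | "k = 2" by linarith
      then show ?thesis using i z by cases (auto simp: X_def d_def arr_def)
    qed
    assume "k + 1 < 0 + 3"
    then consider "k = 0" | "k = 1" by linarith
    then show "exact_at C (X k) (d k) (X (k + 1)) (d (k + 1)) (X (k + 2))"
      using e1 e2 by cases (simp_all add: X_def d_def)
  qed
  moreover have "X 0 = Z" "X 1 = A" "X (0 + 2) = A" "X (0 + 3) = Z" by (simp_all add: X_def)
  ultimately show ?case using Z A by (intro exI[of _ X] exI[of _ d]) auto
next
  case (Suc n)
  obtain L l Q e where Q: "Q \<in> \<P>" and s: "short_exact C L l Q e A" and "resolved C \<P> n L"
    using Suc(2) by auto
  then obtain X d where ex: "exact_sequence C (n + 3) X d" and Z0: "is_zero_object C (X 0)"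
    and P: "\<forall>k\<le>n. X (k + 1) \<in> \<P>" and L: "X (n + 2) = L" and Z: "is_zero_object C (X (n + 3))"
    using Suc(1) by blast
  have la: "arr C L Q l" and e: "arr C Q A e" and k: "is_kernel C Q A e L l" and ee: "is_epi C Q A e"
    using s by (auto simp: short_exact_def)
  have obs: "L \<in> ob C" "Q \<in> ob C" "A \<in> ob C" using la e by (auto simp: arr_def)
  have ob: "X k \<in> ob C" if "k \<le> n + 3" for k using ex that by (simp add: exact_sequence_def)
  have d: "arr C (X k) (X (k + 1)) (d k)" if "k < n + 3" for k
    using ex that ob[of k] ob[of "k + 1"] by (simp add: exact_sequence_def arr_def)
  have E: "exact_at C (X k) (d k) (X (k + 1)) (d (k + 1)) (X (k + 2))" if "k < n + 2" for k
    using ex that by (simp add: exact_sequence_def)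
  have dL: "arr C (X (n + 1)) L (d (n + 1))" using d[of "n + 1"] L by (simp add: numeral_eq_Suc)
  define Z' where "Z' = X (n + 3)"
  have Zo: "Z' \<in> ob C" using ob by (simp add: Z'_def)
  have z: "arr C A Z' (zerom C A Z')" using obs Zo by blast
  have lm: "is_mono C L Q l" by (rule kernel_is_mono[OF k e])
  define X' where "X' = X(n + 2 := Q, n + 3 := A, n + 4 := Z')"
  define d' where "d' = d(n + 1 := l \<cdot> d (n + 1), n + 2 := e, n + 3 := zerom C A Z')"
  \<comment> \<open>The last map onto \<open>L\<close> is an epimorphism, because \<open>L\<close> is followed by zero.\<close>
  have EL: "exact_at C (X (n + 1)) (d (n + 1)) L (d (n + 2)) Z'"
    using E[of "n + 1"] L by (simp add: Z'_def numeral_eq_Suc)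
  have d2: "arr C L Z' (d (n + 2))" using d[of "n + 2"] L by (simp add: Z'_def numeral_eq_Suc)
  have epi: "is_epi C (X (n + 1)) L (d (n + 1))"
    by (rule epi_before_zero[OF EL _ dL d2]) (use Z in \<open>simp add: Z'_def\<close>)
  have "exact_sequence C (n + 4) X' d'"
    unfolding exact_sequence_def
  proof (intro conjI allI impI)
    fix k assume "k \<le> n + 4"
    then show "X' k \<in> ob C" using ob obs Zo by (auto simp: X'_def)
  next
    fix k assume k: "k < n + 4"
    then consider "k = n + 3" | "k = n + 2" | "k = n + 1" | "k \<le> n" by linarith
    then show "d' k \<in> mor C (X' k) (X' (k + 1))"
      using d[of k] e z comp_arr[OF dL la] by cases (auto simp: X'_def d'_def arr_def)
  next
    fix j assume "j + 1 < n + 4"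
    then consider "j = n + 2" | "j = n + 1" | "j = n" | "j < n" by linarith
    then show "exact_at C (X' j) (d' j) (X' (j + 1)) (d' (j + 1)) (X' (j + 2))"
    proof cases
      case 1
      have "exact_at C Q e A (zerom C A Z') Z'"
        using exact_atI[OF z kernel_of_zero[OF obs(3) Zo] e ee] id_left[OF e] by simp
      then show ?thesis using 1 by (simp add: X'_def d'_def)
    next
      case 2
      have "exact_at C (X (n + 1)) (l \<cdot> d (n + 1)) Q e A" by (rule exact_atI[OF e k dL epi])
      then show ?thesis using 2 by (simp add: X'_def d'_def)
    next
      case 3
      have En: "exact_at C (X n) (d n) (X (n + 1)) (d (n + 1)) L" using E[of n] L by simp
      obtain K k' f' where K: "is_kernel C (X (n + 1)) L (d (n + 1)) K k'" "arr C (X n) K f'"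
        "is_epi C (X n) K f'" "k' \<cdot> f' = d n" using exact_atE[OF En ob ob obs(1)] by auto
      from exact_atI[OF comp_arr[OF dL la] kernel_of_mono_comp[OF K(1) lm dL la] K(2,3)]
      show ?thesis using 3 K(4) by (simp add: X'_def d'_def)
    next
      case 4
      then show ?thesis using E[of j] by (simp add: X'_def d'_def)
    qed
  qed
  moreover have "X' (k + 1) \<in> \<P>" if "k \<le> Suc n" for k
  proof (cases "k = Suc n")
    case True
    then show ?thesis using Q by (simp add: X'_def)
  next
    case False
    then show ?thesis using P that by (simp add: X'_def)
  qed
  moreover have "is_zero_object C (X' 0)" "is_zero_object C (X' (n + 4))" "X' (n + 3) = A"
    using Z0 Z by (auto simp: X'_def Z'_def)
  moreover have "Suc n + 3 = n + 4" "Suc n + 2 = n + 3" by simp_all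
  ultimately show ?case by metis
qed

lemma exact_sequence_op:
  assumes "exact_sequence C (m + 1) X d"
  shows "exact_sequence (op_cat C) (m + 1) (\<lambda>k. X (m + 1 - k)) (\<lambda>k. d (m - k))"
  unfolding exact_sequence_def
proof (intro conjI allI impI)
  have ob: "X k \<in> ob C" if "k \<le> m + 1" for k using assms that by (simp add: exact_sequence_def)
  have d: "d k \<in> mor C (X k) (X (k + 1))" if "k < m + 1" for k
    using assms that by (simp add: exact_sequence_def)
  have ex: "exact_at C (X k) (d k) (X (k + 1)) (d (k + 1)) (X (k + 2))" if "k < m" for k
    using assms that by (simp add: exact_sequence_def)
  show "X (m + 1 - k) \<in> ob (op_cat C)" for k using ob by simp
  show "d (m - k) \<in> mor (op_cat C) (X (m + 1 - k)) (X (m + 1 - (k + 1)))" if "k < m + 1" for k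
    using d[of "m - k"] that by (simp add: Suc_diff_le)
  fix k assume k: "k + 1 < m + 1"
  define j where "j = m - 1 - k"
  have j: "j < m" "m + 1 - k = j + 2" "m + 1 - (k + 1) = j + 1" "m + 1 - (k + 2) = j" "m - k = j + 1" "m - (k + 1) = j"
    using k by (auto simp: j_def)
  show "exact_at (op_cat C) (X (m + 1 - k)) (d (m - k)) (X (m + 1 - (k + 1))) (d (m - (k + 1))) (X (m + 1 - (k + 2)))"
    unfolding j(2-6) by (rule exact_at_op[OF ex[OF j(1)] ob ob ob]) (use j(1) in auto)
qed

end

section \<open>Relative projective dimension\<close>

context preadditive_category begin

lemma sum2_comp:
  assumes s: "sum2 C A B S i\<^sub>1 i\<^sub>2 p\<^sub>1 p\<^sub>2" and r: "arr C S Z r" and h: "arr C Y S h"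
  shows "r \<cdot> h = (r \<cdot> i\<^sub>1) \<cdot> (p\<^sub>1 \<cdot> h) \<boxplus> (r \<cdot> i\<^sub>2) \<cdot> (p\<^sub>2 \<cdot> h)"
proof -
  note a = sum2_arr[OF s] and d = sum2_delta[OF s]
  have obs: "A \<in> ob C" "B \<in> ob C" "S \<in> ob C" using sum2_ob[OF s] by auto
  have p1h: "arr C Y A (p\<^sub>1 \<cdot> h)" and p2h: "arr C Y B (p\<^sub>2 \<cdot> h)" using a h by blast+
  have i1: "arr C Y S (i\<^sub>1 \<cdot> (p\<^sub>1 \<cdot> h))" and i2: "arr C Y S (i\<^sub>2 \<cdot> (p\<^sub>2 \<cdot> h))" using a p1h p2h by blast+
  have "h = i\<^sub>1 \<cdot> (p\<^sub>1 \<cdot> h) \<boxplus> i\<^sub>2 \<cdot> (p\<^sub>2 \<cdot> h)"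
  proof (rule sum2_joint_mono[OF s h add_arr[OF i1 i2]])
    have "p\<^sub>1 \<cdot> (i\<^sub>1 \<cdot> (p\<^sub>1 \<cdot> h)) = p\<^sub>1 \<cdot> h"
      using assoc[OF p1h a(1,3)] d(1) id_left[OF p1h] by simp
    moreover have "p\<^sub>1 \<cdot> (i\<^sub>2 \<cdot> (p\<^sub>2 \<cdot> h)) = zerom C Y A"
      using assoc[OF p2h a(2,3)] d(3) zero_comp[OF p2h obs(1)] by simp
    ultimately show "p\<^sub>1 \<cdot> h = p\<^sub>1 \<cdot> (i\<^sub>1 \<cdot> (p\<^sub>1 \<cdot> h) \<boxplus> i\<^sub>2 \<cdot> (p\<^sub>2 \<cdot> h))"
      using distrib_left[OF i1 i2 a(3)] add_zero[OF p1h] by simp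
    have "p\<^sub>2 \<cdot> (i\<^sub>2 \<cdot> (p\<^sub>2 \<cdot> h)) = p\<^sub>2 \<cdot> h"
      using assoc[OF p2h a(2,4)] d(2) id_left[OF p2h] by simp
    moreover have "p\<^sub>2 \<cdot> (i\<^sub>1 \<cdot> (p\<^sub>1 \<cdot> h)) = zerom C Y B"
      using assoc[OF p1h a(1,4)] d(4) zero_comp[OF p1h obs(2)] by simp
    ultimately show "p\<^sub>2 \<cdot> h = p\<^sub>2 \<cdot> (i\<^sub>1 \<cdot> (p\<^sub>1 \<cdot> h) \<boxplus> i\<^sub>2 \<cdot> (p\<^sub>2 \<cdot> h))"
      using distrib_left[OF i1 i2 a(4)] add_zero[OF p2h] by simp
  qed
  then have "r \<cdot> h = r \<cdot> (i\<^sub>1 \<cdot> (p\<^sub>1 \<cdot> h)) \<boxplus> r \<cdot> (i\<^sub>2 \<cdot> (p\<^sub>2 \<cdot> h))"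
    using distrib_left[OF i1 i2 r] by simp
  then show ?thesis using assoc[OF p1h a(1) r] assoc[OF p2h a(2) r] by simp
qed

end

lemma additively_closed_ob: "additively_closed C \<T> \<Longrightarrow> \<T> \<subseteq> ob C"
  unfolding additively_closed_def by (rule conjunct1)

context abelian_category begin

text \<open>
  If \<open>A'\<close> is a stable retract of \<open>A\<close> through \<open>P\<close> and \<open>Q \<rightarrow> A\<close> is a presentation, then \<open>Q \<oplus> P \<rightarrow> A'\<close> is one of \<open>A'\<close>,
  and the syzygies are again related.
\<close>

lemma pdim_le_stable_retract:
  assumes \<P>: "additively_closed C \<P>"
  shows "\<lbrakk>stable_retract C \<P> A' A; pdim_le C \<P> n A\<rbrakk> \<Longrightarrow> pdim_le C \<P> n A'"
proof (induction n arbitrary: A A')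
  case 0
  from 0(1) obtain u v P s t where P: "P \<in> \<P>" and u: "arr C A' A u" and v: "arr C A A' v"
    and s: "arr C A' P s" and t: "arr C P A' t" and id: "v \<cdot> u \<boxplus> t \<cdot> s = idm C A'"
    unfolding stable_retract_def by blast
  have "A \<in> ob C" "P \<in> ob C" using u s by (auto simp: arr_def)
  then obtain S i\<^sub>1 i\<^sub>2 p\<^sub>1 p\<^sub>2 where s2: "sum2 C A P S i\<^sub>1 i\<^sub>2 p\<^sub>1 p\<^sub>2" using ex_sum2 by blast
  obtain h where h: "arr C A' S h" "p\<^sub>1 \<cdot> h = u" "p\<^sub>2 \<cdot> h = s" using sum2_tuple[OF s2 u s] .
  obtain r where r: "arr C S A' r" "r \<cdot> i\<^sub>1 = v" "r \<cdot> i\<^sub>2 = t" using sum2_cotuple[OF s2 v t] .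
  have "r \<cdot> h = idm C A'" using sum2_comp[OF s2 r(1) h(1)] r h id by simp
  then have "retract C A' S" unfolding retract_def using r h by blast
  moreover have "S \<in> \<P>" using additively_closed_sum2[OF \<P> s2] 0(2) P by simp
  ultimately show ?case using additively_closed_retract[OF \<P>] by simp
next
  case (Suc n)
  from Suc(2) obtain u v P s t where P: "P \<in> \<P>" and u: "arr C A' A u" and v: "arr C A A' v"
    and s: "arr C A' P s" and t: "arr C P A' t" and id: "v \<cdot> u \<boxplus> t \<cdot> s = idm C A'"
    unfolding stable_retract_def by blast
  obtain L k Q e where p: "presentation C \<P> L k Q e A" and L: "pdim_le C \<P> n L" using Suc(3) by auto
  have Q: "Q \<in> \<P>" and e: "arr C Q A e" and re: "rel_epi C \<P> Q A e" and ep: "is_epi C Q A e"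
    using p by (auto simp: presentation_def short_exact_def)
  have obs: "Q \<in> ob C" "P \<in> ob C" "A' \<in> ob C" using e t by (auto simp: arr_def)
  obtain S i\<^sub>1 i\<^sub>2 p\<^sub>1 p\<^sub>2 where s2: "sum2 C Q P S i\<^sub>1 i\<^sub>2 p\<^sub>1 p\<^sub>2" using ex_sum2[OF obs(1,2)] .
  note a = sum2_arr[OF s2]
  have S: "S \<in> \<P>" using additively_closed_sum2[OF \<P> s2 Q P] .
  obtain r where r: "arr C S A' r" "r \<cdot> i\<^sub>1 = v \<cdot> e" "r \<cdot> i\<^sub>2 = t" using sum2_cotuple[OF s2 comp_arr[OF e v] t] .
  have rr: "rel_epi C \<P> S A' r"
    unfolding rel_epi_def
  proof (intro conjI ballI allI impI)
    fix R f assume R: "R \<in> \<P>" and f: "arr C R A' f"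
    obtain g where g: "arr C R Q g" "e \<cdot> g = u \<cdot> f" using rel_epi_lift[OF re R comp_arr[OF f u]] .
    obtain h where h: "arr C R S h" "p\<^sub>1 \<cdot> h = g" "p\<^sub>2 \<cdot> h = s \<cdot> f" using sum2_tuple[OF s2 g(1) comp_arr[OF f s]] .
    have "r \<cdot> h = (v \<cdot> e) \<cdot> g \<boxplus> t \<cdot> (s \<cdot> f)" using sum2_comp[OF s2 r(1) h(1)] r h by simp
    also have "\<dots> = (v \<cdot> u) \<cdot> f \<boxplus> (t \<cdot> s) \<cdot> f"
      using assoc[OF g(1) e v] g(2) assoc[OF f u v] assoc[OF f s t] by simp
    also have "\<dots> = f"
      using distrib_right[OF f comp_arr[OF u v] comp_arr[OF s t]] id id_left[OF f] by simp
    finally show "\<exists>g. arr C R S g \<and> r \<cdot> g = f" using h by blast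
  qed (rule r)
  have er: "is_epi C S A' r"
    unfolding is_epi_iff[OF r(1)]
  proof (intro allI impI)
    fix Y y assume y: "arr C A' Y y" "y \<cdot> r = zerom C S Y"
    have Y: "Y \<in> ob C" using y by (simp add: arr_def)
    have "y \<cdot> (r \<cdot> i\<^sub>1) = zerom C Q Y" using assoc[OF a(1) r(1) y(1)] y(2) zero_comp[OF a(1) Y] by simp
    then have "(y \<cdot> v) \<cdot> e = zerom C A Y \<cdot> e" using r(2) assoc[OF e v y(1)] zero_comp[OF e Y] by simp
    then have yv: "y \<cdot> v = zerom C A Y"
      using epi_cancel[OF ep comp_arr[OF v y(1)] zero_arr] v Y by (simp add: arr_def)
    have yt: "y \<cdot> t = zerom C P Y" using r(3) assoc[OF a(2) r(1) y(1)] y(2) zero_comp[OF a(2) Y] by simp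
    have "y \<cdot> (v \<cdot> u \<boxplus> t \<cdot> s) = zerom C A' Y \<boxplus> zerom C A' Y"
      using distrib_left[OF comp_arr[OF u v] comp_arr[OF s t] y(1)] assoc[OF u v y(1)] assoc[OF s t y(1)]
        yv yt zero_comp[OF u Y] zero_comp[OF s Y] by simp
    then show "y = zerom C A' Y" using id id_right[OF y(1)] add_zero[OF zero_arr[OF obs(3) Y]] by simp
  qed
  obtain L' k' where k': "is_kernel C S A' r L' k'" using ex_kernel'[OF r(1)] by blast
  have "arr C L' S k'" using kernel_arr[OF k'] r(1) by (simp add: arr_def)
  then have p': "presentation C \<P> L' k' S r A'" unfolding presentation_def short_exact_def using S rr er k' r(1) by blast
  have "pdim_le C \<P> n L'" using Suc(1)[OF stable_retract_syzygy[OF p' p Suc(2)] L] .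
  then show ?case using p' by auto
qed

lemma pdim_le_syzygy:
  assumes "additively_closed C \<P>" "pdim_le C \<P> (Suc n) A" "presentation C \<P> L k Q e A"
  shows "pdim_le C \<P> n L"
proof -
  obtain L' k' Q' e' where p: "presentation C \<P> L' k' Q' e' A" "pdim_le C \<P> n L'" using assms(2) by auto
  show ?thesis
    using pdim_le_stable_retract[OF assms(1) stable_retract_syzygy[OF assms(3) p(1) presentation_refl[OF p(1)]] p(2)] .
qed

lemma presentation_self:
  assumes "additively_closed C \<P>" "A \<in> \<P>"
  obtains Z where "Z \<in> \<P>" "presentation C \<P> Z (zerom C Z A) A (idm C A) A"
proof -
  obtain Z where Z: "is_zero_object C Z" using ex_zero_object by blast
  have A: "A \<in> ob C" and Zo: "Z \<in> ob C" using additively_closed_ob[OF assms(1)] assms(2) Z by (auto simp: is_zero_object_def)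
  have i: "arr C A A (idm C A)" using A by blast
  have im: "is_mono C A A (idm C A)" by (rule kernel_is_mono[OF kernel_of_zero[OF A Zo] zero_arr[OF A Zo]])
  have "rel_epi C \<P> A A (idm C A)" unfolding rel_epi_def using i id_left by blast
  then have "presentation C \<P> Z (zerom C Z A) A (idm C A) A"
    unfolding presentation_def short_exact_def using assms(2) i zero_kernel_of_mono[OF im i Z] id_epi[OF A] zero_arr[OF Zo A] by blast
  then show thesis using that additively_closed_zero[OF assms(1) Z] by blast
qed

lemma pdim_le_mono:
  assumes \<P>: "additively_closed C \<P>" and "m \<le> n" "pdim_le C \<P> m A"
  shows "pdim_le C \<P> n A"
proof -
  have step: "pdim_le C \<P> m A \<Longrightarrow> pdim_le C \<P> (Suc m) A" for m A
  proof (induction m arbitrary: A)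
    case 0
    then show ?case using presentation_self[OF \<P>, of A] by (metis pdim_le.simps)
  next
    case (Suc m)
    then show ?case by (metis pdim_le.simps(2))
  qed
  show ?thesis using assms(2,3)
  proof (induction n rule: dec_induct)
    case (step j)
    then show ?case using \<open>\<And>m A. pdim_le C \<P> m A \<Longrightarrow> pdim_le C \<P> (Suc m) A\<close> by blast
  qed
qed

end

section \<open>Projective presentations and Ext\<close>

definition Proj :: "('o, 'm) add_cat \<Rightarrow> 'o set" where
  "Proj C = {P. projective C P}"

context preadditive_category begin

lemma projective_lift:
  assumes "projective C P" "is_epi C A B e" "arr C A B e" "arr C P B f"
  obtains g where "arr C P A g" "e \<cdot> g = f"
  using assms unfolding projective_def arr_def by blast

lemma projectiveI:
  assumes "P \<in> ob C" "\<And>A B e f. \<lbrakk>arr C A B e; is_epi C A B e; arr C P B f\<rbrakk> \<Longrightarrow> \<exists>g. arr C P A g \<and> e \<cdot> g = f"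
  shows "projective C P"
  unfolding projective_def
proof (intro conjI ballI allI impI)
  fix A B e f assume "A \<in> ob C" "B \<in> ob C" "is_epi C A B e" "f \<in> mor C P B"
  then show "\<exists>g\<in>mor C P A. e \<cdot> g = f" using assms unfolding arr_def is_epi_def by metis
qed (rule assms)

lemma epi_rel_epi_Proj: "\<lbrakk>is_epi C A B e; arr C A B e\<rbrakk> \<Longrightarrow> rel_epi C (Proj C) A B e"
  unfolding rel_epi_def Proj_def using projective_lift by (metis mem_Collect_eq)

text \<open>
  Lift an epimorphism from a projective object onto \<open>B\<close>.
\<close>

lemma rel_epi_Proj_epi:
  assumes "enough_projectives C" "rel_epi C (Proj C) A B e"
  shows "is_epi C A B e"
proof -
  have e: "arr C A B e" using assms(2) by (simp add: rel_epi_def)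
  obtain P q where P: "projective C P" and q: "is_epi C P B q"
    using assms(1) e unfolding enough_projectives_def arr_def by blast
  have qa: "arr C P B q" using P q e by (auto simp: arr_def is_epi_def projective_def)
  obtain g where g: "arr C P A g" "e \<cdot> g = q" using rel_epi_lift[OF assms(2) _ qa] P by (auto simp: Proj_def)
  show ?thesis
    unfolding is_epi_iff[OF e]
  proof (intro allI impI)
    fix X x assume x: "arr C B X x" "x \<cdot> e = zerom C A X"
    have X: "X \<in> ob C" "B \<in> ob C" using x by (auto simp: arr_def)
    have "x \<cdot> q = zerom C B X \<cdot> q"
      using g(2) assoc[OF g(1) e x(1)] x(2) zero_comp[OF g(1) X(1)] zero_comp[OF qa X(1)] by simp
    then show "x = zerom C B X" using epi_cancel[OF q x(1) zero_arr] X by simp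
  qed
qed

lemma presentation_of_projective: "\<lbrakk>short_exact C L k Q e A; projective C Q\<rbrakk> \<Longrightarrow> presentation C (Proj C) L k Q e A"
  unfolding presentation_def using epi_rel_epi_Proj by (auto simp: short_exact_def Proj_def)

lemma projective_retract:
  assumes P: "projective C P" and "retract C X P"
  shows "projective C X"
proof -
  obtain s r where s: "arr C X P s" and r: "arr C P X r" and rs: "r \<cdot> s = idm C X" using assms(2) by (auto simp: retract_def)
  show ?thesis
  proof (rule projectiveI)
    show "X \<in> ob C" using s by (simp add: arr_def)
    fix A B e f assume e: "arr C A B e" and ee: "is_epi C A B e" and f: "arr C X B f"
    obtain g where g: "arr C P A g" "e \<cdot> g = f \<cdot> r" using projective_lift[OF P ee e comp_arr[OF r f]] .
    have "e \<cdot> (g \<cdot> s) = f" using assoc[OF s g(1) e] g(2) assoc[OF s r f] rs id_right[OF f] by simp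
    then show "\<exists>g. arr C X A g \<and> e \<cdot> g = f" using g(1) s by blast
  qed
qed

lemma projective_direct_sum:
  assumes ds: "is_direct_sum C I X S \<iota> \<pi>" and P: "\<And>i. i \<in> I \<Longrightarrow> projective C (X i)"
  shows "projective C S"
proof (rule projectiveI)
  show "S \<in> ob C" using ds by (simp add: is_direct_sum_def)
  fix A B e f assume e: "arr C A B e" and ee: "is_epi C A B e" and f: "arr C S B f"
  have A: "A \<in> ob C" using e by (simp add: arr_def)
  note \<iota> = direct_sum_arr(1)[OF ds]
  have "\<exists>g. arr C (X i) A g \<and> e \<cdot> g = f \<cdot> \<iota> i" if "i \<in> I" for i
    using projective_lift[OF P[OF that] ee e comp_arr[OF \<iota>[OF that] f]] by blast
  then obtain g where g: "\<And>i. i \<in> I \<Longrightarrow> arr C (X i) A (g i)" "\<And>i. i \<in> I \<Longrightarrow> e \<cdot> g i = f \<cdot> \<iota> i" by metis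
  obtain h where h: "arr C S A h" "\<And>i. i \<in> I \<Longrightarrow> h \<cdot> \<iota> i = g i" using direct_sum_cotuple[OF ds A g(1)] by blast
  have "e \<cdot> h = f"
    using direct_sum_joint_epi[OF ds comp_arr[OF h(1) e] f] assoc[OF \<iota> h(1) e] h(2) g(2) by simp
  then show "\<exists>g. arr C S A g \<and> e \<cdot> g = f" using h(1) by blast
qed

lemma additively_closed_Proj: "additively_closed C (Proj C)"
  unfolding additively_closed_def
proof (intro conjI allI impI ballI)
  show "Proj C \<subseteq> ob C" by (auto simp: Proj_def projective_def)
  show "X \<in> Proj C" if "S \<in> Proj C" "direct_summand C X S" for X S
    using projective_retract[OF _ direct_summand_retract] that by (auto simp: Proj_def)
  show "S \<in> Proj C" if "\<forall>k<m. G k \<in> Proj C" "is_direct_sum C {..<m} G S \<iota> \<pi>" for m :: nat and G S \<iota> \<pi>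
    using projective_direct_sum[OF that(2)] that(1) by (auto simp: Proj_def)
qed

end

context abelian_category begin

lemma ex_projective_presentation:
  assumes "enough_projectives C" "A \<in> ob C"
  shows "\<exists>L k Q e. presentation C (Proj C) L k Q e A"
proof -
  obtain P e where P: "projective C P" and e: "is_epi C P A e"
    using assms unfolding enough_projectives_def by blast
  have ea: "arr C P A e" using P e assms(2) by (auto simp: arr_def is_epi_def projective_def)
  obtain K k where k: "is_kernel C P A e K k" using ex_kernel'[OF ea] by blast
  have "arr C K P k" using kernel_arr[OF k] ea by (simp add: arr_def)
  then have "short_exact C K k P e A" unfolding short_exact_def using ea k e by blast
  then show ?thesis using presentation_of_projective P by blast
qed

text \<open>
  Exactness in the form of \<open>exact_atE\<close> provides the kernel of each differential together with the
  epimorphism onto it from the next term.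
\<close>

lemma syzygies_of_proj_resolution:
  assumes r: "proj_resolution C A P d \<epsilon>" and A: "A \<in> ob C"
  obtains K m e where "K 0 = A" "\<And>i. presentation C (Proj C) (K (Suc i)) (m i) (P i) (e i) (K i)"
    "\<And>i. d i = m i \<cdot> e (Suc i)"
proof -
  define \<delta> where "\<delta> i = (case i of 0 \<Rightarrow> \<epsilon> | Suc j \<Rightarrow> d j)" for i :: nat
  define T where "T i = (case i of 0 \<Rightarrow> A | Suc j \<Rightarrow> P j)" for i :: nat
  have Pp: "projective C (P i)" for i using r by (simp add: proj_resolution_def)
  then have Po: "P i \<in> ob C" for i by (simp add: projective_def)
  have To: "T i \<in> ob C" for i using A Po by (simp add: T_def split: nat.split)
  have ex: "exact_at C (P (Suc i)) (d i) (P i) (\<delta> i) (T i)" for i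
    using r by (cases i) (auto simp: proj_resolution_def \<delta>_def T_def)
  have "\<exists>K k f. is_kernel C (P i) (T i) (\<delta> i) K k \<and> arr C (P (Suc i)) K f \<and> is_epi C (P (Suc i)) K f \<and> k \<cdot> f = d i" for i
    using exact_atE[OF ex Po Po To] by metis
  then obtain K k f where K: "\<And>i. is_kernel C (P i) (T i) (\<delta> i) (K i) (k i)"
    and f: "\<And>i. arr C (P (Suc i)) (K i) (f i)" and fe: "\<And>i. is_epi C (P (Suc i)) (K i) (f i)"
    and kf: "\<And>i. k i \<cdot> f i = d i" by metis
  have ka: "arr C (K i) (P i) (k i)" for i using kernel_arr[OF K Po] .
  have \<delta>a: "arr C (P i) (T i) (\<delta> i)" for i using ex[of i] Po To by (auto simp: exact_at_def arr_def)
  define K' where "K' i = (case i of 0 \<Rightarrow> A | Suc j \<Rightarrow> K j)" for i :: nat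
  define e where "e i = (case i of 0 \<Rightarrow> \<epsilon> | Suc j \<Rightarrow> f j)" for i :: nat
  have "short_exact C (K' (Suc i)) (k i) (P i) (e i) (K' i)" for i
  proof (cases i)
    case 0
    have "is_epi C (P 0) A \<epsilon>" using r by (simp add: proj_resolution_def)
    then show ?thesis
      using 0 K[of 0] ka[of 0] \<delta>a[of 0] by (simp add: short_exact_def K'_def e_def \<delta>_def T_def)
  next
    case (Suc j)
    have "is_kernel C (P (Suc j)) (P j) (k j \<cdot> f j) (K (Suc j)) (k (Suc j))"
      using K[of "Suc j"] kf[of j] by (simp add: \<delta>_def T_def)
    then have "is_kernel C (P (Suc j)) (K j) (f j) (K (Suc j)) (k (Suc j))"
      by (rule kernel_of_mono_comp_cancel[OF _ kernel_is_mono[OF K \<delta>a] f ka])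
    then show ?thesis using Suc ka f fe by (simp add: short_exact_def K'_def e_def)
  qed
  then show thesis using that[of K' k e] presentation_of_projective Pp kf by (simp add: K'_def e_def)
qed

lemma ex_proj_resolution:
  assumes en: "enough_projectives C" and A: "A \<in> ob C"
  shows "\<exists>P d \<epsilon>. proj_resolution C A P d \<epsilon>"
proof -
  have "\<forall>A\<in>ob C. \<exists>L k Q e. presentation C (Proj C) L k Q e A" using ex_projective_presentation[OF en] by blast
  then obtain L k Q e where pr: "\<And>A. A \<in> ob C \<Longrightarrow> presentation C (Proj C) (L A) (k A) (Q A) (e A) A" by metis
  define K where "K i = (L ^^ i) A" for i
  have Ko: "K i \<in> ob C" for i
  proof (induction i)
    case 0
    then show ?case using A by (simp add: K_def)
  next
    case (Suc i)
    then show ?case using pr[of "K i"] by (simp add: K_def presentation_def short_exact_def arr_def)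
  qed
  have p: "presentation C (Proj C) (K (Suc i)) (k (K i)) (Q (K i)) (e (K i)) (K i)" for i
    using pr[OF Ko[of i]] by (simp add: K_def)
  have ea: "arr C (Q (K i)) (K i) (e (K i))" and ee: "is_epi C (Q (K i)) (K i) (e (K i))"
    and ka: "arr C (K (Suc i)) (Q (K i)) (k (K i))"
    and ke: "is_kernel C (Q (K i)) (K i) (e (K i)) (K (Suc i)) (k (K i))"
    and Qp: "projective C (Q (K i))" for i
    using p[of i] by (auto simp: presentation_def short_exact_def Proj_def)
  have 1: "exact_at C (Q (K (Suc 0))) (k (K 0) \<cdot> e (K (Suc 0))) (Q (K 0)) (e (K 0)) (K 0)"
    by (rule exact_atI[OF ea ke ea ee])
  have 2: "exact_at C (Q (K (Suc (Suc i)))) (k (K (Suc i)) \<cdot> e (K (Suc (Suc i)))) (Q (K (Suc i)))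
      (k (K i) \<cdot> e (K (Suc i))) (Q (K i))" for i
    by (rule exact_atI[OF comp_arr[OF ea ka] kernel_of_mono_comp[OF ke kernel_is_mono[OF ke ea] ea ka] ea ee])
  have "proj_resolution C A (\<lambda>i. Q (K i)) (\<lambda>i. k (K i) \<cdot> e (K (Suc i))) (e (K 0))"
    unfolding proj_resolution_def using Qp ee[of 0] 1 2 by (simp add: K_def)
  then show ?thesis by blast
qed

lemma ext_vanishes_chain:
  assumes en: "enough_projectives C" and p: "\<And>i. presentation C (Proj C) (K (Suc i)) (m i) (P i) (e i) (K i)"
  shows "ext_vanishes C (Proj C) n (K j) B \<longleftrightarrow> extends_along C (K (Suc (j + n))) (m (j + n)) (P (j + n)) B"
proof (induction n arbitrary: j)
  case 0
  then show ?case using ext_vanishes_0_iff[OF p] by (simp del: ext_vanishes.simps)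
next
  case (Suc n)
  then show ?case using ext_vanishes_Suc_iff[OF p ex_projective_presentation[OF en], of n j B] by (simp del: ext_vanishes.simps)
qed

lemma cocycle_comm_group:
  assumes d: "arr C P' P d" and B: "B \<in> ob C"
  shows "comm_group ((hom_group C P B)\<lparr>carrier := {f \<in> mor C P B. f \<cdot> d = zerom C P' B}\<rparr>)"
proof (rule comm_groupI)
  have obs: "P \<in> ob C" "P' \<in> ob C" using d by (auto simp: arr_def)
  let ?G = "(hom_group C P B)\<lparr>carrier := {f \<in> mor C P B. f \<cdot> d = zerom C P' B}\<rparr>"
  have car: "f \<in> carrier ?G \<longleftrightarrow> arr C P B f \<and> f \<cdot> d = zerom C P' B" for f
    using obs B by (auto simp: arr_def hom_group_def)
  have op: "f \<otimes>\<^bsub>?G\<^esub> g = f \<boxplus> g" "\<one>\<^bsub>?G\<^esub> = zerom C P B" for f g by (auto simp: hom_group_def)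
  have z: "arr C P B (zerom C P B)" using obs B by blast
  have z': "arr C P' B (zerom C P' B)" using obs B by blast
  show "f \<otimes>\<^bsub>?G\<^esub> g \<in> carrier ?G" if "f \<in> carrier ?G" "g \<in> carrier ?G" for f g
    using that unfolding car op using distrib_right[OF d, of B f g] add_zero[OF z'] by auto
  show "\<one>\<^bsub>?G\<^esub> \<in> carrier ?G" unfolding car op using z zero_comp[OF d B] by simp
  show "f \<otimes>\<^bsub>?G\<^esub> g \<otimes>\<^bsub>?G\<^esub> h = f \<otimes>\<^bsub>?G\<^esub> (g \<otimes>\<^bsub>?G\<^esub> h)"
    if "f \<in> carrier ?G" "g \<in> carrier ?G" "h \<in> carrier ?G" for f g h
    using that unfolding car op using add_assoc by blast
  show "f \<otimes>\<^bsub>?G\<^esub> g = g \<otimes>\<^bsub>?G\<^esub> f" if "f \<in> carrier ?G" "g \<in> carrier ?G" for f g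
    using that unfolding car op using add_comm by blast
  show "\<one>\<^bsub>?G\<^esub> \<otimes>\<^bsub>?G\<^esub> f = f" if "f \<in> carrier ?G" for f
    using that unfolding car op using add_zero by blast
  show "\<exists>g\<in>carrier ?G. g \<otimes>\<^bsub>?G\<^esub> f = \<one>\<^bsub>?G\<^esub>" if "f \<in> carrier ?G" for f
  proof -
    have f: "arr C P B f" "f \<cdot> d = zerom C P' B" using that unfolding car by auto
    obtain g where g: "arr C P B g" "zerom C P B = f \<boxplus> g" using ex_difference[OF z f(1)] .
    have gd: "arr C P' B (g \<cdot> d)" using g d by blast
    have "g \<cdot> d = (f \<boxplus> g) \<cdot> d" using distrib_right[OF d f(1) g(1)] f(2) add_zero(2)[OF gd] by simp
    also have "\<dots> = zerom C P' B" using g(2) zero_comp[OF d B] by simp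
    finally show ?thesis using g add_comm[OF f(1) g(1)] unfolding Bex_def car op by auto
  qed
qed

text \<open>
  If \<open>H\<close> is the only coset, then every \<open>x\<close> lies in \<open>H x = H\<close>. Conversely \<open>H\<close> is then the whole group, which is
  normal.
\<close>

lemma trivial_group_Mod_iff:
  assumes "comm_group G" and H: "H \<subseteq> carrier G" "\<one>\<^bsub>G\<^esub> \<in> H"
  shows "trivial_group (G Mod H) \<longleftrightarrow> carrier G \<subseteq> H"
proof
  interpret G: comm_group G by fact
  assume "trivial_group (G Mod H)"
  then have rc: "rcosets\<^bsub>G\<^esub> H = {H}" by (simp add: trivial_group_def FactGroup_def)
  show "carrier G \<subseteq> H"
  proof
    fix x assume x: "x \<in> carrier G"
    then have "H #>\<^bsub>G\<^esub> x = H" using G.rcosetsI[OF H(1) x] rc by auto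
    moreover have "x \<in> H #>\<^bsub>G\<^esub> x" using x H(2) unfolding r_coset_def by force
    ultimately show "x \<in> H" by simp
  qed
next
  interpret G: comm_group G by fact
  assume "carrier G \<subseteq> H"
  then have H': "H = carrier G" using H by blast
  have sub: "subgroup H G" unfolding H' by (rule G.subgroup_self)
  then have "H \<lhd> G" using G.normal_iff_subgroup by blast
  then have "group (G Mod H)" by (rule normal.factorgroup_is_group)
  moreover have "rcosets\<^bsub>G\<^esub> H = {H}"
    unfolding RCOSETS_def using G.coset_join2[OF _ sub] H' G.one_closed by auto
  ultimately show "trivial_group (G Mod H)" by (simp add: trivial_group_def FactGroup_def)
qed

text \<open>
  Cocycles in degree \<open>n + 1\<close> are the morphisms out of the syzygy with that number, precomposed with the
  epimorphism onto it, and such a cocycle is a coboundary if and only if the morphism extends.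
\<close>

lemma trivial_Ext_iff:
  assumes en: "enough_projectives C" and A: "A \<in> ob C" and B: "B \<in> ob C"
  shows "trivial_group (Ext C (Suc n) A B) \<longleftrightarrow> ext_vanishes C (Proj C) n A B"
proof -
  obtain P d \<epsilon> where r: "proj_resolution C A P d \<epsilon>"
    and Ext: "Ext C (Suc n) A B = cocycle_group C P d (Suc n) B Mod coboundaries C P d (Suc n) B"
  proof -
    define X where "X = (SOME (P, d, \<epsilon>). proj_resolution C A P d \<epsilon>)"
    obtain P d \<epsilon> where "proj_resolution C A P d \<epsilon>" using ex_proj_resolution[OF en A] by blast
    then have "case X of (P, d, \<epsilon>) \<Rightarrow> proj_resolution C A P d \<epsilon>"
      unfolding X_def using someI[of "\<lambda>(P, d, \<epsilon>). proj_resolution C A P d \<epsilon>" "(P, d, \<epsilon>)"] by simp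
    moreover obtain P' d' \<epsilon>' where "X = (P', d', \<epsilon>')" by (cases X)
    ultimately show thesis using that[of P' d' \<epsilon>'] by (simp add: Ext_def X_def[symmetric])
  qed
  from syzygies_of_proj_resolution[OF r A] obtain K m e where K0: "K 0 = A"
    and p: "\<And>i. presentation C (Proj C) (K (Suc i)) (m i) (P i) (e i) (K i)" and d: "\<And>i. d i = m i \<cdot> e (Suc i)"
    by blast
  have ma: "arr C (K (Suc i)) (P i) (m i)" and ea: "arr C (P i) (K i) (e i)"
    and ee: "is_epi C (P i) (K i) (e i)" and k: "is_kernel C (P i) (K i) (e i) (K (Suc i)) (m i)" for i
    using p[of i] by (auto simp: presentation_def short_exact_def)
  have da: "arr C (P (Suc i)) (P i) (d i)" for i unfolding d using ma ea by blast
  have Po: "P i \<in> ob C" and Ko: "K i \<in> ob C" for i using ea[of i] by (auto simp: arr_def)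
  let ?G = "cocycle_group C P d (Suc n) B" and ?H = "coboundaries C P d (Suc n) B"
  have G: "comm_group ?G" unfolding cocycle_group_def Suc_eq_plus1[symmetric] by (rule cocycle_comm_group[OF da B])
  have car: "f \<in> carrier ?G \<longleftrightarrow> arr C (P (Suc n)) B f \<and> f \<cdot> d (Suc n) = zerom C (P (Suc (Suc n))) B" for f
    using Po B by (auto simp: cocycle_group_def arr_def)
  have one: "\<one>\<^bsub>?G\<^esub> = zerom C (P (Suc n)) B" by (simp add: cocycle_group_def hom_group_def)
  have cob: "f \<in> ?H \<longleftrightarrow> (\<exists>g. arr C (P n) B g \<and> f = g \<cdot> d n)" for f
    using Po B by (auto simp: coboundaries_def arr_def image_iff)
  have em: "e (Suc i) \<cdot> m (Suc i) = zerom C (K (Suc (Suc i))) (K (Suc i))" for i by (rule kernel_zero[OF k])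
  have ed: "e (Suc i) \<cdot> d (Suc i) = zerom C (P (Suc (Suc i))) (K (Suc i))" for i
    using assoc[OF ea[of "Suc (Suc i)"] ma ea] em[of i] zero_comp[OF ea Ko] by (simp add: d)
  have dd: "d n \<cdot> d (Suc n) = zerom C (P (Suc (Suc n))) (P n)"
    using assoc[OF da ea[of "Suc n"] ma] ed[of n] comp_zero[OF ma Po] by (simp add: d[of n])
  have H1: "?H \<subseteq> carrier ?G"
  proof
    fix f assume "f \<in> ?H"
    then obtain g where g: "arr C (P n) B g" "f = g \<cdot> d n" unfolding cob by blast
    have "f \<cdot> d (Suc n) = zerom C (P (Suc (Suc n))) B"
      using g(2) assoc[OF da da g(1)] dd comp_zero[OF g(1) Po] by simp
    then show "f \<in> carrier ?G" unfolding car using g da by blast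
  qed
  have H2: "\<one>\<^bsub>?G\<^esub> \<in> ?H" unfolding cob one using zero_comp[OF da B] zero_arr[OF Po B] by metis
  have "trivial_group (Ext C (Suc n) A B) \<longleftrightarrow> carrier ?G \<subseteq> ?H"
    unfolding Ext by (rule trivial_group_Mod_iff[OF G H1 H2])
  also have "\<dots> \<longleftrightarrow> extends_along C (K (Suc n)) (m n) (P n) B"
  proof
    assume sub: "carrier ?G \<subseteq> ?H"
    show "extends_along C (K (Suc n)) (m n) (P n) B"
      unfolding extends_along_def
    proof (intro allI impI)
      fix h assume h: "arr C (K (Suc n)) B h"
      have he: "arr C (P (Suc n)) B (h \<cdot> e (Suc n))" using h ea by blast
      have "(h \<cdot> e (Suc n)) \<cdot> d (Suc n) = zerom C (P (Suc (Suc n))) B"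
        using assoc[OF da ea h] ed comp_zero[OF h Po] by simp
      then have "h \<cdot> e (Suc n) \<in> ?H" using sub he car by blast
      then obtain g where g: "arr C (P n) B g" "h \<cdot> e (Suc n) = g \<cdot> d n" unfolding cob by blast
      have "h \<cdot> e (Suc n) = (g \<cdot> m n) \<cdot> e (Suc n)" using g(2) assoc[OF ea ma g(1)] by (simp add: d)
      then have "h = g \<cdot> m n" using epi_cancel[OF ee h comp_arr[OF ma g(1)]] by blast
      then show "\<exists>w. arr C (P n) B w \<and> w \<cdot> m n = h" using g(1) by blast
    qed
  next
    assume ext: "extends_along C (K (Suc n)) (m n) (P n) B"
    show "carrier ?G \<subseteq> ?H"
    proof
      fix f assume "f \<in> carrier ?G"
      then have f: "arr C (P (Suc n)) B f" and fd: "f \<cdot> d (Suc n) = zerom C (P (Suc (Suc n))) B"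
        unfolding car by auto
      have "(f \<cdot> m (Suc n)) \<cdot> e (Suc (Suc n)) = zerom C (K (Suc (Suc n))) B \<cdot> e (Suc (Suc n))"
        using assoc[OF ea[of "Suc (Suc n)"] ma f] fd zero_comp[OF ea B] by (simp add: d)
      then have "f \<cdot> m (Suc n) = zerom C (K (Suc (Suc n))) B"
        using epi_cancel[OF ee comp_arr[OF ma f] zero_arr[OF Ko B]] by blast
      then obtain h where h: "arr C (K (Suc n)) B h" "h \<cdot> e (Suc n) = f"
        using cokernel_factor[OF epi_cokernel_of_kernel[OF ee ea k] f] by blast
      obtain g where g: "arr C (P n) B g" "g \<cdot> m n = h" using ext h(1) unfolding extends_along_def by blast
      have "f = g \<cdot> d n" using h(2) g(2) assoc[OF ea ma g(1)] by (simp add: d)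
      then show "f \<in> ?H" unfolding cob using g(1) by blast
    qed
  qed
  also have "\<dots> \<longleftrightarrow> ext_vanishes C (Proj C) n A B" using ext_vanishes_chain[of K m P e n 0 B, OF en p] K0 by simp
  finally show ?thesis .
qed

lemma has_proj_resolution_iff: "has_proj_resolution_of_length C n A \<longleftrightarrow> resolved C (Proj C) n A"
proof
  assume "has_proj_resolution_of_length C n A"
  then obtain X d where X: "exact_sequence C (n + 3) X d" "is_zero_object C (X 0)"
    "\<forall>k\<le>n. projective C (X (k + 1))" "X (n + 2) = A" "is_zero_object C (X (n + 3))"
    unfolding has_proj_resolution_of_length_def by blast
  then show "resolved C (Proj C) n A"
    using resolved_of_exact_sequence[OF additively_closed_Proj X(1,2,5)] by (auto simp: Proj_def)
next
  assume "resolved C (Proj C) n A"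
  from exact_sequence_of_resolved[OF _ this] show "has_proj_resolution_of_length C n A"
    unfolding has_proj_resolution_of_length_def by (auto simp: Proj_def projective_def)
qed

lemma proj_dim_le_iff: "proj_dim C A \<le> enat n \<longleftrightarrow> (\<exists>m\<le>n. resolved C (Proj C) m A)"
proof
  assume le: "proj_dim C A \<le> enat n"
  let ?S = "enat ` {m. resolved C (Proj C) m A}"
  have pd: "proj_dim C A = Inf ?S" by (simp add: proj_dim_def has_proj_resolution_iff)
  have ne: "?S \<noteq> {}"
  proof
    assume "?S = {}"
    then have "proj_dim C A = \<infinity>" using pd by (simp add: Inf_enat_def)
    then show False using le by simp
  qed
  then have "Inf ?S \<in> ?S" unfolding Inf_enat_def using LeastI[of "\<lambda>x. x \<in> ?S"] by auto
  then obtain m where "resolved C (Proj C) m A" "Inf ?S = enat m" by auto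
  then show "\<exists>m\<le>n. resolved C (Proj C) m A" using le pd by auto
next
  assume "\<exists>m\<le>n. resolved C (Proj C) m A"
  then obtain m where "m \<le> n" "resolved C (Proj C) m A" by blast
  then show "proj_dim C A \<le> enat n"
    unfolding proj_dim_def by (intro INF_lower2[of m]) (auto simp: has_proj_resolution_iff)
qed

lemma resolved_pdim_le: "resolved C (Proj C) n A \<Longrightarrow> pdim_le C (Proj C) n A"
proof (induction n arbitrary: A)
  case (Suc n)
  then obtain L k Q e where "Q \<in> Proj C" "short_exact C L k Q e A" "resolved C (Proj C) n L" by auto
  then have "presentation C (Proj C) L k Q e A" "pdim_le C (Proj C) n L" using presentation_of_projective Suc by (auto simp: Proj_def)
  then show ?case by auto
qed simp

end

section \<open>Ext and short exact sequences\<close>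

context abelian_category begin

lemma short_exactD:
  assumes "short_exact C A i B p D"
  shows "arr C A B i" "arr C B D p" "is_kernel C B D p A i" "is_epi C B D p" "is_mono C A B i"
    "p \<cdot> i = zerom C A D" "is_cokernel C A B i D p"
  using assms kernel_is_mono kernel_zero epi_cokernel_of_kernel unfolding short_exact_def by blast+

text \<open>
  The vanishing of \<open>Ext\<^sup>1(D, T)\<close> is defined by a projective presentation \<open>P\<close> of \<open>D\<close>. It implies the extension
  property for an arbitrary short exact sequence ending in \<open>D\<close>: \<open>B\<close> is a quotient of \<open>A \<oplus> P\<close>, and an extension
  to \<open>B\<close> is a morphism on \<open>A \<oplus> P\<close> that vanishes on the kernel of this quotient map.
\<close>

lemma short_exact_extends:
  assumes en: "enough_projectives C" and s: "short_exact C A i B p D" and ev: "ext_vanishes C (Proj C) 0 D T" and T: "T \<in> ob C"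
  shows "extends_along C A i B T"
  unfolding extends_along_def
proof (intro allI impI)
  fix f assume f: "arr C A T f"
  note s = short_exactD[OF s]
  have obs: "A \<in> ob C" "B \<in> ob C" "D \<in> ob C" using s(1,2) by (auto simp: arr_def)
  obtain L k P e where pr: "presentation C (Proj C) L k P e D" using ex_projective_presentation[OF en obs(3)] by blast
  have P: "projective C P" and k: "arr C L P k" and e: "arr C P D e" and ker: "is_kernel C P D e L k"
    using pr by (auto simp: presentation_def short_exact_def Proj_def)
  have obs': "L \<in> ob C" "P \<in> ob C" using k by (auto simp: arr_def)
  have ext: "extends_along C L k P T" using ev ext_vanishes_0_iff[OF pr] by blast
  obtain t where t: "arr C P B t" "p \<cdot> t = e" using projective_lift[OF P s(4,2) e] .
  have tk: "arr C L B (t \<cdot> k)" using t k by blast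
  have "p \<cdot> (t \<cdot> k) = zerom C L D" using assoc[OF k t(1) s(2)] t(2) kernel_zero[OF ker] by simp
  then obtain r where r: "arr C L A r" "i \<cdot> r = t \<cdot> k" using kernel_factor[OF s(3) tk] by blast
  obtain g where g: "arr C P T g" "g \<cdot> k = f \<cdot> r"
    using ext comp_arr[OF r(1) f] unfolding extends_along_def by blast
  obtain S i\<^sub>1 i\<^sub>2 p\<^sub>1 p\<^sub>2 where s2: "sum2 C A P S i\<^sub>1 i\<^sub>2 p\<^sub>1 p\<^sub>2" using ex_sum2[OF obs(1) obs'(2)] .
  note a = sum2_arr[OF s2]
  \<comment> \<open>\<open>B\<close> is the pushout of \<open>P\<close> and \<open>A\<close> over \<open>L\<close>, up to sign.\<close>
  obtain \<theta> where \<theta>: "arr C S B \<theta>" "\<theta> \<cdot> i\<^sub>1 = i" "\<theta> \<cdot> i\<^sub>2 = t" using sum2_cotuple[OF s2 s(1) t(1)] .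
  obtain \<psi> where \<psi>: "arr C S T \<psi>" "\<psi> \<cdot> i\<^sub>1 = f" "\<psi> \<cdot> i\<^sub>2 = g" using sum2_cotuple[OF s2 f g(1)] .
  have \<theta>e: "is_epi C S B \<theta>"
    unfolding is_epi_iff[OF \<theta>(1)]
  proof (intro allI impI)
    fix Y y assume y: "arr C B Y y" "y \<cdot> \<theta> = zerom C S Y"
    have Y: "Y \<in> ob C" using y by (simp add: arr_def)
    have "y \<cdot> i = zerom C A Y" using assoc[OF a(1) \<theta>(1) y(1)] \<theta>(2) y(2) zero_comp[OF a(1) Y] by simp
    then obtain y' where y': "arr C D Y y'" "y' \<cdot> p = y" using cokernel_factor[OF s(7) y(1)] by blast
    have "y \<cdot> t = zerom C P Y" using assoc[OF a(2) \<theta>(1) y(1)] \<theta>(3) y(2) zero_comp[OF a(2) Y] by simp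
    then have "y' \<cdot> e = zerom C D Y \<cdot> e" using assoc[OF t(1) s(2) y'(1)] t(2) y'(2) zero_comp[OF e Y] by simp
    moreover have "is_epi C P D e" using pr by (simp add: presentation_def short_exact_def)
    ultimately have "y' = zerom C D Y" using epi_cancel[OF _ y'(1) zero_arr[OF obs(3) Y]] by blast
    then show "y = zerom C B Y" using y'(2) zero_comp[OF s(2) Y] by simp
  qed
  obtain N \<nu> where \<nu>: "is_kernel C S B \<theta> N \<nu>" using ex_kernel'[OF \<theta>(1)] by blast
  have \<nu>a: "arr C N S \<nu>" using kernel_arr[OF \<nu>] \<theta>(1) by (simp add: arr_def)
  have N: "N \<in> ob C" using \<nu>a by (simp add: arr_def)
  let ?x = "p\<^sub>1 \<cdot> \<nu>" and ?y = "p\<^sub>2 \<cdot> \<nu>"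
  have x: "arr C N A ?x" and y: "arr C N P ?y" using a \<nu>a by blast+
  have sum0: "i \<cdot> ?x \<boxplus> t \<cdot> ?y = zerom C N B"
    using sum2_comp[OF s2 \<theta>(1) \<nu>a] \<theta> kernel_zero[OF \<nu>] by simp
  have ix: "arr C N B (i \<cdot> ?x)" and ty: "arr C N B (t \<cdot> ?y)" using x y s(1) t(1) by blast+
  have "p \<cdot> (t \<cdot> ?y) = e \<cdot> ?y" using assoc[OF y t(1) s(2)] t(2) by simp
  moreover have "p \<cdot> (i \<cdot> ?x) = zerom C N D" using assoc[OF x s(1,2)] s(6) zero_comp[OF x obs(3)] by simp
  moreover have "arr C N D (e \<cdot> ?y)" using y e by blast
  ultimately have "e \<cdot> ?y = zerom C N D"
    using distrib_left[OF ix ty s(2)] sum0 comp_zero[OF s(2) N] add_zero(2) by simp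
  then obtain w where w: "arr C N L w" "k \<cdot> w = ?y" using kernel_factor[OF ker y] by blast
  have rw: "arr C N A (r \<cdot> w)" using r w by blast
  have "t \<cdot> ?y = i \<cdot> (r \<cdot> w)" using w(2) assoc[OF w(1) k t(1)] r(2) assoc[OF w(1) r(1) s(1)] by simp
  then have "i \<cdot> (?x \<boxplus> r \<cdot> w) = i \<cdot> zerom C N A"
    using distrib_left[OF x rw s(1)] sum0 comp_zero[OF s(1) N] by simp
  then have xr: "?x \<boxplus> r \<cdot> w = zerom C N A"
    using mono_cancel[OF s(5) add_arr[OF x rw] zero_arr[OF N obs(1)]] by simp
  have "\<psi> \<cdot> \<nu> = f \<cdot> ?x \<boxplus> g \<cdot> ?y" using sum2_comp[OF s2 \<psi>(1) \<nu>a] \<psi> by simp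
  also have "g \<cdot> ?y = f \<cdot> (r \<cdot> w)" using w(2) assoc[OF w(1) k g(1)] g(2) assoc[OF w(1) r(1) f] by simp
  also have "f \<cdot> ?x \<boxplus> f \<cdot> (r \<cdot> w) = zerom C N T"
    using distrib_left[OF x rw f] xr comp_zero[OF f N] by simp
  finally obtain h where h: "arr C B T h" "h \<cdot> \<theta> = \<psi>"
    using cokernel_factor[OF epi_cokernel_of_kernel[OF \<theta>e \<theta>(1) \<nu>] \<psi>(1)] by blast
  have "h \<cdot> i = f" using assoc[OF a(1) \<theta>(1) h(1)] \<theta>(2) h(2) \<psi>(2) by simp
  then show "\<exists>w. arr C B T w \<and> w \<cdot> i = f" using h(1) by blast
qed

text \<open>
  Lift the presentation of \<open>D\<close> to \<open>t : PD \<rightarrow> B\<close>; then \<open>PA \<oplus> PD\<close> covers \<open>B\<close>. An element \<open>z\<close> of \<open>LD\<close> has \<open>t z\<close> in \<open>A\<close>, so it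
  is corrected by an element of \<open>PA\<close> to one of \<open>LB\<close>. With enough projectives it suffices to do this for
  elements defined on projective objects.
\<close>

lemma horseshoe:
  assumes en: "enough_projectives C" and s: "short_exact C A i B p D"
    and pA: "presentation C (Proj C) LA a PA eA A" and pD: "presentation C (Proj C) LD c PD eD D"
  obtains S i\<^sub>1 i\<^sub>2 p\<^sub>1 p\<^sub>2 LB b \<theta> x y where "sum2 C PA PD S i\<^sub>1 i\<^sub>2 p\<^sub>1 p\<^sub>2" "presentation C (Proj C) LB b S \<theta> B"
    "short_exact C LA x LB y LD" "b \<cdot> x = i\<^sub>1 \<cdot> a"
proof -
  note s = short_exactD[OF s]
  have PA: "projective C PA" and a: "arr C LA PA a" and eA: "arr C PA A eA"
    and kA: "is_kernel C PA A eA LA a" and eeA: "is_epi C PA A eA"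
    using pA by (auto simp: presentation_def short_exact_def Proj_def)
  have PD: "projective C PD" and c: "arr C LD PD c" and eD: "arr C PD D eD"
    and kD: "is_kernel C PD D eD LD c" and eeD: "is_epi C PD D eD"
    using pD by (auto simp: presentation_def short_exact_def Proj_def)
  have obs: "A \<in> ob C" "B \<in> ob C" "D \<in> ob C" "PA \<in> ob C" "PD \<in> ob C" "LA \<in> ob C" "LD \<in> ob C"
    using s a c eA eD by (auto simp: arr_def)
  obtain S i\<^sub>1 i\<^sub>2 p\<^sub>1 p\<^sub>2 where s2: "sum2 C PA PD S i\<^sub>1 i\<^sub>2 p\<^sub>1 p\<^sub>2" using ex_sum2[OF obs(4,5)] .
  note sa = sum2_arr[OF s2] and sd = sum2_delta[OF s2]
  have S: "S \<in> ob C" using sa by (simp add: arr_def)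
  have Sp: "projective C S"
    using additively_closed_sum2[OF additively_closed_Proj s2] PA PD by (simp add: Proj_def)
  obtain t where t: "arr C PD B t" "p \<cdot> t = eD" using projective_lift[OF PD s(4,2) eD] .
  have ieA: "arr C PA B (i \<cdot> eA)" using s(1) eA by blast
  obtain \<theta> where \<theta>: "arr C S B \<theta>" "\<theta> \<cdot> i\<^sub>1 = i \<cdot> eA" "\<theta> \<cdot> i\<^sub>2 = t" using sum2_cotuple[OF s2 ieA t(1)] .
  have \<theta>e: "is_epi C S B \<theta>"
    unfolding is_epi_iff[OF \<theta>(1)]
  proof (intro allI impI)
    fix Y y assume y: "arr C B Y y" "y \<cdot> \<theta> = zerom C S Y"
    have Y: "Y \<in> ob C" using y by (simp add: arr_def)
    have "(y \<cdot> i) \<cdot> eA = zerom C A Y \<cdot> eA"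
      using assoc[OF sa(1) \<theta>(1) y(1)] assoc[OF eA s(1) y(1)] \<theta>(2) y(2) zero_comp[OF sa(1) Y] zero_comp[OF eA Y] by simp
    then have "y \<cdot> i = zerom C A Y" using epi_cancel[OF eeA comp_arr[OF s(1) y(1)] zero_arr[OF obs(1) Y]] by blast
    then obtain y' where y': "arr C D Y y'" "y' \<cdot> p = y" using cokernel_factor[OF s(7) y(1)] by blast
    have "y \<cdot> t = zerom C PD Y" using assoc[OF sa(2) \<theta>(1) y(1)] \<theta>(3) y(2) zero_comp[OF sa(2) Y] by simp
    then have "y' \<cdot> eD = zerom C D Y \<cdot> eD" using assoc[OF t(1) s(2) y'(1)] t(2) y'(2) zero_comp[OF eD Y] by simp
    then have "y' = zerom C D Y" using epi_cancel[OF eeD y'(1) zero_arr[OF obs(3) Y]] by blast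
    then show "y = zerom C B Y" using y'(2) zero_comp[OF s(2) Y] by simp
  qed
  obtain LB b where b: "is_kernel C S B \<theta> LB b" using ex_kernel'[OF \<theta>(1)] by blast
  have ba: "arr C LB S b" using kernel_arr[OF b S] .
  have LB: "LB \<in> ob C" using ba by (simp add: arr_def)
  have pB: "presentation C (Proj C) LB b S \<theta> B" by (rule presentation_of_projective[OF _ Sp]) (use ba \<theta>(1) b \<theta>e in \<open>simp add: short_exact_def\<close>)
  have bm: "is_mono C LB S b" by (rule kernel_is_mono[OF b \<theta>(1)])
  have p\<theta>: "p \<cdot> (\<theta> \<cdot> z) = eD \<cdot> (p\<^sub>2 \<cdot> z)" if z: "arr C Y S z" for Y z
  proof -
    have z1: "arr C Y PA (p\<^sub>1 \<cdot> z)" and z2: "arr C Y PD (p\<^sub>2 \<cdot> z)" using z sa by blast+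
    have Y: "Y \<in> ob C" using z by (simp add: arr_def)
    have ez: "arr C Y A (eA \<cdot> (p\<^sub>1 \<cdot> z))" using z1 eA by blast
    have "\<theta> \<cdot> z = (i \<cdot> eA) \<cdot> (p\<^sub>1 \<cdot> z) \<boxplus> t \<cdot> (p\<^sub>2 \<cdot> z)" using sum2_comp[OF s2 \<theta>(1) z] \<theta> by simp
    then have "p \<cdot> (\<theta> \<cdot> z) = p \<cdot> ((i \<cdot> eA) \<cdot> (p\<^sub>1 \<cdot> z)) \<boxplus> p \<cdot> (t \<cdot> (p\<^sub>2 \<cdot> z))"
      using distrib_left[OF comp_arr[OF z1 ieA] comp_arr[OF z2 t(1)] s(2)] by simp
    also have "p \<cdot> ((i \<cdot> eA) \<cdot> (p\<^sub>1 \<cdot> z)) = zerom C Y D"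
      using assoc[OF z1 eA s(1)] assoc[OF ez s(1,2)] s(6) zero_comp[OF ez obs(3)] by simp
    also have "p \<cdot> (t \<cdot> (p\<^sub>2 \<cdot> z)) = eD \<cdot> (p\<^sub>2 \<cdot> z)" using assoc[OF z2 t(1) s(2)] t(2) by simp
    finally show ?thesis using add_zero(2)[OF comp_arr[OF z2 eD]] by simp
  qed
  have i1a: "arr C LA S (i\<^sub>1 \<cdot> a)" using a sa by blast
  have "\<theta> \<cdot> (i\<^sub>1 \<cdot> a) = zerom C LA B"
    using assoc[OF a sa(1) \<theta>(1)] \<theta>(2) assoc[OF a eA s(1)] kernel_zero[OF kA] comp_zero[OF s(1) obs(6)] by simp
  then obtain x where x: "arr C LA LB x" "b \<cdot> x = i\<^sub>1 \<cdot> a" using kernel_factor[OF b i1a] by blast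
  have p2b: "arr C LB PD (p\<^sub>2 \<cdot> b)" using ba sa by blast
  have "eD \<cdot> (p\<^sub>2 \<cdot> b) = zerom C LB D" using p\<theta>[OF ba] kernel_zero[OF b] comp_zero[OF s(2) LB] by simp
  then obtain y where y: "arr C LB LD y" "c \<cdot> y = p\<^sub>2 \<cdot> b" using kernel_factor[OF kD p2b] by blast
  have ky: "is_kernel C LB LD y LA x"
  proof (rule is_kernelI[OF x(1) y(1)])
    have "c \<cdot> (y \<cdot> x) = (p\<^sub>2 \<cdot> i\<^sub>1) \<cdot> a"
      using assoc[OF x(1) y(1) c] y(2) assoc[OF x(1) ba sa(4)] x(2) assoc[OF a sa(1,4)] by simp
    also have "\<dots> = c \<cdot> zerom C LA LD"
      using sd(4) zero_comp[OF a obs(5)] comp_zero[OF c obs(6)] by simp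
    finally show "y \<cdot> x = zerom C LA LD"
      by (rule kernel_cancel[OF kD eD comp_arr[OF x(1) y(1)] zero_arr[OF obs(6,7)]])
  next
    fix Y g assume g: "arr C Y LB g" "y \<cdot> g = zerom C Y LD"
    have Y: "Y \<in> ob C" using g by (simp add: arr_def)
    have bg: "arr C Y S (b \<cdot> g)" using g ba by blast
    have p1: "arr C Y PA (p\<^sub>1 \<cdot> (b \<cdot> g))" using bg sa by blast
    have p2: "p\<^sub>2 \<cdot> (b \<cdot> g) = zerom C Y PD"
      using assoc[OF g(1) ba sa(4)] y(2) assoc[OF g(1) y(1) c] g(2) comp_zero[OF c Y] by simp
    have "(i \<cdot> eA) \<cdot> (p\<^sub>1 \<cdot> (b \<cdot> g)) \<boxplus> t \<cdot> (p\<^sub>2 \<cdot> (b \<cdot> g)) = \<theta> \<cdot> (b \<cdot> g)"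
      using sum2_comp[OF s2 \<theta>(1) bg] \<theta> by simp
    also have "\<theta> \<cdot> (b \<cdot> g) = zerom C Y B" using assoc[OF g(1) ba \<theta>(1)] kernel_zero[OF b] zero_comp[OF g(1) obs(2)] by simp
    finally have "(i \<cdot> eA) \<cdot> (p\<^sub>1 \<cdot> (b \<cdot> g)) = zerom C Y B"
      using p2 comp_zero[OF t(1) Y] add_zero(1)[OF comp_arr[OF p1 ieA]] by simp
    then have "i \<cdot> (eA \<cdot> (p\<^sub>1 \<cdot> (b \<cdot> g))) = i \<cdot> zerom C Y A"
      using assoc[OF p1 eA s(1)] comp_zero[OF s(1) Y] by simp
    then have "eA \<cdot> (p\<^sub>1 \<cdot> (b \<cdot> g)) = zerom C Y A"
      using mono_cancel[OF s(5) comp_arr[OF p1 eA] zero_arr[OF Y obs(1)]] by blast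
    then obtain h where h: "arr C Y LA h" "a \<cdot> h = p\<^sub>1 \<cdot> (b \<cdot> g)" using kernel_factor[OF kA p1] by blast
    have xh: "arr C Y LB (x \<cdot> h)" using x h by blast
    have bxh: "b \<cdot> (x \<cdot> h) = i\<^sub>1 \<cdot> (a \<cdot> h)"
      using assoc[OF h(1) x(1) ba] x(2) assoc[OF h(1) a sa(1)] by simp
    have ah: "arr C Y PA (a \<cdot> h)" using a h by blast
    have "b \<cdot> (x \<cdot> h) = b \<cdot> g"
    proof (rule sum2_joint_mono[OF s2 comp_arr[OF xh ba] bg])
      show "p\<^sub>1 \<cdot> (b \<cdot> (x \<cdot> h)) = p\<^sub>1 \<cdot> (b \<cdot> g)"
        using bxh assoc[OF ah sa(1,3)] sd(1) id_left[OF ah] h(2) by simp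
      show "p\<^sub>2 \<cdot> (b \<cdot> (x \<cdot> h)) = p\<^sub>2 \<cdot> (b \<cdot> g)"
        using bxh assoc[OF ah sa(1,4)] sd(4) zero_comp[OF ah obs(5)] p2 by simp
    qed
    then have "x \<cdot> h = g" using mono_cancel[OF bm xh g(1)] by blast
    then show "\<exists>h. arr C Y LA h \<and> x \<cdot> h = g" using h(1) by blast
  next
    fix Y h h' assume h: "arr C Y LA h" and h': "arr C Y LA h'" and eq: "x \<cdot> h = x \<cdot> h'"
    have "i\<^sub>1 \<cdot> (a \<cdot> g) = b \<cdot> (x \<cdot> g)" if g: "arr C Y LA g" for g
      using assoc[OF g x(1) ba] x(2) assoc[OF g a sa(1)] by simp
    then have i1: "i\<^sub>1 \<cdot> (a \<cdot> h) = i\<^sub>1 \<cdot> (a \<cdot> h')" using eq h h' by simp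
    have "a \<cdot> g = p\<^sub>1 \<cdot> (i\<^sub>1 \<cdot> (a \<cdot> g))" if g: "arr C Y LA g" for g
      using assoc[OF comp_arr[OF g a] sa(1,3)] sd(1) id_left[OF comp_arr[OF g a]] by simp
    from this[OF h] this[OF h'] i1 have "a \<cdot> h = a \<cdot> h'" by simp
    then show "h = h'" using kernel_cancel[OF kA eA h h'] by blast
  qed
  have "rel_epi C (Proj C) LB LD y"
    unfolding rel_epi_def
  proof (intro conjI ballI allI impI)
    fix R z assume "R \<in> Proj C" and z: "arr C R LD z"
    then have R: "projective C R" by (simp add: Proj_def)
    then have Ro: "R \<in> ob C" by (simp add: projective_def)
    have cz: "arr C R PD (c \<cdot> z)" using c z by blast
    have tcz: "arr C R B (t \<cdot> (c \<cdot> z))" using cz t by blast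
    obtain n where n: "arr C R B n" "zerom C R B = t \<cdot> (c \<cdot> z) \<boxplus> n"
      using ex_difference[OF zero_arr[OF Ro obs(2)] tcz] .
    have "p \<cdot> (t \<cdot> (c \<cdot> z)) = zerom C R D"
      using assoc[OF cz t(1) s(2)] t(2) assoc[OF z c eD] kernel_zero[OF kD] zero_comp[OF z obs(3)] by simp
    then have "p \<cdot> n = zerom C R D"
      using distrib_left[OF tcz n(1) s(2)] n(2) comp_zero[OF s(2) Ro] add_zero(2)[OF comp_arr[OF n(1) s(2)]] by simp
    then obtain w where w: "arr C R A w" "i \<cdot> w = n" using kernel_factor[OF s(3) n(1)] by blast
    obtain w' where w': "arr C R PA w'" "eA \<cdot> w' = w" using projective_lift[OF R eeA eA w(1)] .
    obtain u where u: "arr C R S u" "p\<^sub>1 \<cdot> u = w'" "p\<^sub>2 \<cdot> u = c \<cdot> z" using sum2_tuple[OF s2 w'(1) cz] .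
    have "\<theta> \<cdot> u = (i \<cdot> eA) \<cdot> w' \<boxplus> t \<cdot> (c \<cdot> z)" using sum2_comp[OF s2 \<theta>(1) u(1)] \<theta> u by simp
    also have "\<dots> = zerom C R B"
      using assoc[OF w'(1) eA s(1)] w'(2) w(2) n add_comm[OF n(1) tcz] by simp
    finally obtain v where v: "arr C R LB v" "b \<cdot> v = u" using kernel_factor[OF b u(1)] by blast
    have "c \<cdot> (y \<cdot> v) = c \<cdot> z"
      using assoc[OF v(1) y(1) c] y(2) assoc[OF v(1) ba sa(4)] v(2) u(3) by simp
    then have "y \<cdot> v = z" using kernel_cancel[OF kD eD comp_arr[OF v(1) y(1)] z] by blast
    then show "\<exists>v. arr C R LB v \<and> y \<cdot> v = z" using v(1) by blast
  qed (rule y)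
  then have "short_exact C LA x LB y LD" unfolding short_exact_def using x(1) y(1) ky rel_epi_Proj_epi[OF en] by blast
  then show thesis using that s2 pB x(2) by blast
qed

text \<open>
  This is the piece \<open>Ext\<^sup>m\<^sup>+\<^sup>1(B, T) \<rightarrow> Ext\<^sup>m\<^sup>+\<^sup>1(A, T) \<rightarrow> Ext\<^sup>m\<^sup>+\<^sup>2(D, T)\<close> of the long exact sequence, by dimension
  shifting along the horseshoe.
\<close>

lemma ext_vanishes_kernel_of_epi:
  assumes en: "enough_projectives C" and T: "T \<in> ob C"
  shows "\<lbrakk>short_exact C A i B p D; ext_vanishes C (Proj C) m B T; ext_vanishes C (Proj C) (Suc m) D T\<rbrakk> \<Longrightarrow> ext_vanishes C (Proj C) m A T"
proof (induction m arbitrary: A i B p D)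
  case 0
  have obs: "A \<in> ob C" "D \<in> ob C" using 0(1) by (auto simp: short_exact_def arr_def)
  obtain LA a PA eA where pA: "presentation C (Proj C) LA a PA eA A" using ex_projective_presentation[OF en obs(1)] by blast
  obtain LD c PD eD where pD: "presentation C (Proj C) LD c PD eD D" using ex_projective_presentation[OF en obs(2)] by blast
  obtain S i\<^sub>1 i\<^sub>2 p\<^sub>1 p\<^sub>2 LB b \<theta> x y where s2: "sum2 C PA PD S i\<^sub>1 i\<^sub>2 p\<^sub>1 p\<^sub>2"
    and pB: "presentation C (Proj C) LB b S \<theta> B" and s': "short_exact C LA x LB y LD" and bx: "b \<cdot> x = i\<^sub>1 \<cdot> a"
    using horseshoe[OF en 0(1) pA pD] by metis
  have xa: "arr C LA LB x" and ba: "arr C LB S b" and aa: "arr C LA PA a"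
    using s' pB pA by (auto simp: short_exact_def presentation_def)
  have "ext_vanishes C (Proj C) 0 LD T" using 0(3) ext_vanishes_Suc_iff[OF pD ex_projective_presentation[OF en]] by blast
  then have e1: "extends_along C LA x LB T" by (rule short_exact_extends[OF en s' _ T])
  have e2: "extends_along C LB b S T" using 0(2) ext_vanishes_0_iff[OF pB] by blast
  have "extends_along C LA a PA T"
    unfolding extends_along_def
  proof (intro allI impI)
    fix h assume h: "arr C LA T h"
    obtain w where w: "arr C LB T w" "w \<cdot> x = h" using e1 h unfolding extends_along_def by blast
    obtain v where v: "arr C S T v" "v \<cdot> b = w" using e2 w(1) unfolding extends_along_def by blast
    have "(v \<cdot> i\<^sub>1) \<cdot> a = h"
      using assoc[OF aa sum2_arr(1)[OF s2] v(1)] bx assoc[OF xa ba v(1)] v(2) w(2) by simp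
    then show "\<exists>w. arr C PA T w \<and> w \<cdot> a = h" using v(1) sum2_arr(1)[OF s2] by blast
  qed
  then show ?case using ext_vanishes_0_iff[OF pA] by blast
next
  case (Suc m)
  have obs: "A \<in> ob C" "D \<in> ob C" using Suc(2) by (auto simp: short_exact_def arr_def)
  obtain LA a PA eA where pA: "presentation C (Proj C) LA a PA eA A" using ex_projective_presentation[OF en obs(1)] by blast
  obtain LD c PD eD where pD: "presentation C (Proj C) LD c PD eD D" using ex_projective_presentation[OF en obs(2)] by blast
  obtain S i\<^sub>1 i\<^sub>2 p\<^sub>1 p\<^sub>2 LB b \<theta> x y where pB: "presentation C (Proj C) LB b S \<theta> B" and s': "short_exact C LA x LB y LD"
    using horseshoe[OF en Suc(2) pA pD] by metis
  note shift = ext_vanishes_Suc_iff[OF _ ex_projective_presentation[OF en]]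
  have "ext_vanishes C (Proj C) m LA T" using Suc(1)[OF s'] Suc(3,4) shift[OF pB] shift[OF pD] by blast
  then show ?case using shift[OF pA] by blast
qed

text \<open>
  In a coresolution of \<open>X\<close> by objects without mutual extensions, the cosyzygies have no extensions by these
  objects either, by induction from the right end. Hence all the inclusions are left approximations.
\<close>

lemma resolved_op_pdim_le:
  assumes en: "enough_projectives C" and \<T>: "\<T> \<subseteq> ob C"
    and ev: "\<And>T\<^sub>1 T\<^sub>2 m. \<lbrakk>T\<^sub>1 \<in> \<T>; T\<^sub>2 \<in> \<T>\<rbrakk> \<Longrightarrow> ext_vanishes C (Proj C) m T\<^sub>1 T\<^sub>2"
  shows "resolved (op_cat C) \<T> n X \<Longrightarrow> (\<forall>T\<in>\<T>. \<forall>m. ext_vanishes C (Proj C) m X T) \<and> pdim_le (op_cat C) \<T> n X"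
proof (induction n arbitrary: X)
  case 0
  then show ?case using ev by auto
next
  case (Suc n)
  then obtain L k Q e where Q: "Q \<in> \<T>" and s: "short_exact (op_cat C) L k Q e X" and r: "resolved (op_cat C) \<T> n L"
    by auto
  have s': "short_exact C X e Q k L" using s short_exact_op by blast
  have L: "\<And>T m. T \<in> \<T> \<Longrightarrow> ext_vanishes C (Proj C) m L T" and pd: "pdim_le (op_cat C) \<T> n L" using Suc(1)[OF r] by auto
  have 1: "ext_vanishes C (Proj C) m X T" if "T \<in> \<T>" for T m
    using ext_vanishes_kernel_of_epi[OF en _ s' ev[OF Q that] L[OF that]] that \<T> by blast
  have "extends_along C X e Q T" if "T \<in> \<T>" for T
    using short_exact_extends[OF en s' L[OF that]] that \<T> by blast
  then have "rel_epi (op_cat C) \<T> Q X e" using s unfolding rel_epi_def extends_along_def short_exact_def by simp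
  then have "presentation (op_cat C) \<T> L k Q e X" unfolding presentation_def using Q s by blast
  then show ?case using 1 pd by auto
qed

end

section \<open>The category of representations\<close>

definition op_quiver :: "('v, 'e) pre_digraph \<Rightarrow> ('v, 'e) pre_digraph" where
  "op_quiver Q = \<lparr>verts = verts Q, arcs = arcs Q, tail = head Q, head = tail Q\<rparr>"

lemma op_quiver_simps [simp]:
  "verts (op_quiver Q) = verts Q" "arcs (op_quiver Q) = arcs Q" "tail (op_quiver Q) = head Q"
  "head (op_quiver Q) = tail Q" "op_quiver (op_quiver Q) = Q"
  by (simp_all add: op_quiver_def)

text \<open>
  A representation and its reversal are the same record, so duality of representations is an equality.
\<close>

lemma Rep_op: "Rep (op_quiver Q) (op_cat C) = op_cat (Rep Q C)"
proof -
  have "mor (Rep (op_quiver Q) (op_cat C)) X Y = mor (op_cat (Rep Q C)) X Y" for X Y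
    by (auto simp: Rep_def)
  moreover have "cmp (Rep (op_quiver Q) (op_cat C)) f g = cmp (op_cat (Rep Q C)) f g" for f g
    by (simp add: Rep_def)
  ultimately show ?thesis
    by (intro add_cat.equality ext) (auto simp: Rep_def)
qed

text \<open>Representations are extensional, so families have to be restricted to the quiver.\<close>

definition mk_rep :: "('v, 'e) pre_digraph \<Rightarrow> ('v \<Rightarrow> 'o) \<Rightarrow> ('e \<Rightarrow> 'm) \<Rightarrow> ('v, 'e, 'o, 'm) representation" where
  "mk_rep Q V f = \<lparr>at_vertex = restrict V (verts Q), at_arrow = restrict f (arcs Q)\<rparr>"

lemma mk_rep_simps [simp]:
  "j \<in> verts Q \<Longrightarrow> at_vertex (mk_rep Q V f) j = V j"
  "a \<in> arcs Q \<Longrightarrow> at_arrow (mk_rep Q V f) a = f a"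
  by (simp_all add: mk_rep_def)

locale quiver_rep = abelian_category C for C :: "('o, 'm) add_cat" (structure) +
  fixes Q :: "('v, 'e) pre_digraph"
  assumes wf: "wf_digraph Q"
begin

abbreviation \<R> :: "(('v, 'e, 'o, 'm) representation, 'v \<Rightarrow> 'm) add_cat" where "\<R> \<equiv> Rep Q C"

lemma arc_ends [simp]: "a \<in> arcs Q \<Longrightarrow> head Q a \<in> verts Q" "a \<in> arcs Q \<Longrightarrow> tail Q a \<in> verts Q"
  using wf by (auto simp: wf_digraph_def)

lemma rep_vertex: "\<lbrakk>X \<in> ob \<R>; j \<in> verts Q\<rbrakk> \<Longrightarrow> at_vertex X j \<in> ob C"
  by (auto simp: Rep_def)

lemma rep_arrow: "\<lbrakk>X \<in> ob \<R>; a \<in> arcs Q\<rbrakk> \<Longrightarrow> arr C (at_vertex X (tail Q a)) (at_vertex X (head Q a)) (at_arrow X a)"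
  using arc_ends by (auto simp: Rep_def arr_def Pi_def)

lemma mk_rep_ob:
  assumes "\<And>j. j \<in> verts Q \<Longrightarrow> V j \<in> ob C"
    and "\<And>a. a \<in> arcs Q \<Longrightarrow> arr C (V (tail Q a)) (V (head Q a)) (f a)"
  shows "mk_rep Q V f \<in> ob \<R>"
  using assms by (auto simp: Rep_def mk_rep_def arr_def)

lemma rep_arrD:
  assumes "arr \<R> X Y \<phi>"
  shows "j \<in> verts Q \<Longrightarrow> arr C (at_vertex X j) (at_vertex Y j) (\<phi> j)"
    and "a \<in> arcs Q \<Longrightarrow> \<phi> (head Q a) \<cdot> at_arrow X a = at_arrow Y a \<cdot> \<phi> (tail Q a)"
    and "X \<in> ob \<R>" "Y \<in> ob \<R>" "\<phi> \<in> extensional (verts Q)"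
proof -
  show X: "X \<in> ob \<R>" and Y: "Y \<in> ob \<R>" using assms by (auto simp: arr_def)
  have m: "\<phi> \<in> (\<Pi>\<^sub>E i\<in>verts Q. mor C (at_vertex X i) (at_vertex Y i))"
    "\<forall>a\<in>arcs Q. \<phi> (head Q a) \<cdot> at_arrow X a = at_arrow Y a \<cdot> \<phi> (tail Q a)"
    using assms by (auto simp: arr_def Rep_def)
  show "j \<in> verts Q \<Longrightarrow> arr C (at_vertex X j) (at_vertex Y j) (\<phi> j)"
    using m(1) rep_vertex[OF X] rep_vertex[OF Y] by (auto simp: arr_def)
  show "a \<in> arcs Q \<Longrightarrow> \<phi> (head Q a) \<cdot> at_arrow X a = at_arrow Y a \<cdot> \<phi> (tail Q a)" using m(2) by blast
  show "\<phi> \<in> extensional (verts Q)" using m(1) by (auto simp: PiE_def)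
qed

lemma rep_arrI:
  assumes "X \<in> ob \<R>" "Y \<in> ob \<R>"
    and "\<And>j. j \<in> verts Q \<Longrightarrow> arr C (at_vertex X j) (at_vertex Y j) (\<phi> j)"
    and "\<And>a. a \<in> arcs Q \<Longrightarrow> \<phi> (head Q a) \<cdot> at_arrow X a = at_arrow Y a \<cdot> \<phi> (tail Q a)"
  shows "arr \<R> X Y (restrict \<phi> (verts Q))"
proof -
  have "mor \<R> X Y = {\<phi> \<in> (\<Pi>\<^sub>E i\<in>verts Q. mor C (at_vertex X i) (at_vertex Y i)).
            \<forall>a\<in>arcs Q. \<phi> (head Q a) \<cdot> at_arrow X a = at_arrow Y a \<cdot> \<phi> (tail Q a)}" by (simp add: Rep_def)
  then show ?thesis using assms by (auto simp: arr_def)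
qed

lemma rep_arr_eqI:
  assumes "arr \<R> X Y \<phi>" "arr \<R> X' Y' \<psi>" "\<And>j. j \<in> verts Q \<Longrightarrow> \<phi> j = \<psi> j"
  shows "\<phi> = \<psi>"
  using rep_arrD(5)[OF assms(1)] rep_arrD(5)[OF assms(2)] assms(3) by (rule extensionalityI)

lemma rep_cmp [simp]: "j \<in> verts Q \<Longrightarrow> cmp \<R> \<psi> \<phi> j = \<psi> j \<cdot> \<phi> j"
  and rep_idm [simp]: "j \<in> verts Q \<Longrightarrow> idm \<R> X j = idm C (at_vertex X j)"
  and rep_addm [simp]: "j \<in> verts Q \<Longrightarrow> addm \<R> \<phi> \<psi> j = addm C (\<phi> j) (\<psi> j)"
  and rep_zerom [simp]: "j \<in> verts Q \<Longrightarrow> zerom \<R> X Y j = zerom C (at_vertex X j) (at_vertex Y j)"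
  by (simp_all add: Rep_def)

lemma rep_zero_arr: "\<lbrakk>X \<in> ob \<R>; Y \<in> ob \<R>\<rbrakk> \<Longrightarrow> arr \<R> X Y (zerom \<R> X Y)"
proof -
  assume X: "X \<in> ob \<R>" and Y: "Y \<in> ob \<R>"
  have "arr \<R> X Y (restrict (\<lambda>j. zerom C (at_vertex X j) (at_vertex Y j)) (verts Q))"
  proof (rule rep_arrI[OF X Y])
    fix a assume a: "a \<in> arcs Q"
    show "zerom C (at_vertex X (head Q a)) (at_vertex Y (head Q a)) \<cdot> at_arrow X a =
        at_arrow Y a \<cdot> zerom C (at_vertex X (tail Q a)) (at_vertex Y (tail Q a))"
      using zero_comp[OF rep_arrow[OF X a], of "at_vertex Y (head Q a)"]
        comp_zero[OF rep_arrow[OF Y a], of "at_vertex X (tail Q a)"] a X Y rep_vertex by simp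
  qed (use X Y rep_vertex in auto)
  then show ?thesis by (simp add: Rep_def)
qed

lemma rep_comp_arr:
  assumes f: "arr \<R> X Y f" and g: "arr \<R> Y Z g"
  shows "arr \<R> X Z (cmp \<R> g f)"
proof -
  have "arr \<R> X Z (restrict (\<lambda>j. g j \<cdot> f j) (verts Q))"
  proof (rule rep_arrI[OF rep_arrD(3)[OF f] rep_arrD(4)[OF g]])
    fix a assume a: "a \<in> arcs Q"
    note X = rep_arrow[OF rep_arrD(3)[OF f] a] and Y = rep_arrow[OF rep_arrD(3)[OF g] a]
      and Z = rep_arrow[OF rep_arrD(4)[OF g] a]
    note fh = rep_arrD(1)[OF f arc_ends(1)[OF a]] and ft = rep_arrD(1)[OF f arc_ends(2)[OF a]]
    note gh = rep_arrD(1)[OF g arc_ends(1)[OF a]] and gt = rep_arrD(1)[OF g arc_ends(2)[OF a]]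
    show "(g (head Q a) \<cdot> f (head Q a)) \<cdot> at_arrow X a = at_arrow Z a \<cdot> (g (tail Q a) \<cdot> f (tail Q a))"
      using assoc[OF X fh gh] rep_arrD(2)[OF f a] assoc[OF ft Y gh] rep_arrD(2)[OF g a] assoc[OF ft gt Z] by simp
  qed (use rep_arrD(1)[OF f] rep_arrD(1)[OF g] in auto)
  then show ?thesis by (simp add: Rep_def)
qed

lemma rep_add_arr:
  assumes f: "arr \<R> X Y f" and g: "arr \<R> X Y g"
  shows "arr \<R> X Y (addm \<R> f g)"
proof -
  have "arr \<R> X Y (restrict (\<lambda>j. addm C (f j) (g j)) (verts Q))"
  proof (rule rep_arrI[OF rep_arrD(3,4)[OF f]])
    fix a assume a: "a \<in> arcs Q"
    note X = rep_arrow[OF rep_arrD(3)[OF f] a] and Y = rep_arrow[OF rep_arrD(4)[OF f] a]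
    note fh = rep_arrD(1)[OF f arc_ends(1)[OF a]] and ft = rep_arrD(1)[OF f arc_ends(2)[OF a]]
    note gh = rep_arrD(1)[OF g arc_ends(1)[OF a]] and gt = rep_arrD(1)[OF g arc_ends(2)[OF a]]
    show "addm C (f (head Q a)) (g (head Q a)) \<cdot> at_arrow X a = at_arrow Y a \<cdot> addm C (f (tail Q a)) (g (tail Q a))"
      using distrib_right[OF X fh gh] distrib_left[OF ft gt Y] rep_arrD(2)[OF f a] rep_arrD(2)[OF g a] by simp
  qed (use rep_arrD(1)[OF f] rep_arrD(1)[OF g] in auto)
  then show ?thesis by (simp add: Rep_def)
qed

lemma rep_id_arr: "X \<in> ob \<R> \<Longrightarrow> arr \<R> X X (idm \<R> X)"
proof -
  assume X: "X \<in> ob \<R>"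
  have "arr \<R> X X (restrict (\<lambda>j. idm C (at_vertex X j)) (verts Q))"
  proof (rule rep_arrI[OF X X])
    fix a assume a: "a \<in> arcs Q"
    show "idm C (at_vertex X (head Q a)) \<cdot> at_arrow X a = at_arrow X a \<cdot> idm C (at_vertex X (tail Q a))"
      using id_left[OF rep_arrow[OF X a]] id_right[OF rep_arrow[OF X a]] by simp
  qed (use rep_vertex[OF X] in auto)
  then show ?thesis by (simp add: Rep_def)
qed

lemma rep_negative:
  assumes f: "arr \<R> X Y f"
  obtains g where "arr \<R> X Y g" "addm \<R> g f = zerom \<R> X Y"
proof -
  have X: "X \<in> ob \<R>" and Y: "Y \<in> ob \<R>" using rep_arrD[OF f] by auto
  have "\<exists>g. arr C (at_vertex X j) (at_vertex Y j) g \<and> zerom C (at_vertex X j) (at_vertex Y j) = addm C (f j) g"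
    if "j \<in> verts Q" for j
    using ex_difference[OF zero_arr[OF rep_vertex[OF X that] rep_vertex[OF Y that]] rep_arrD(1)[OF f that]] by metis
  then obtain g where g: "\<And>j. j \<in> verts Q \<Longrightarrow> arr C (at_vertex X j) (at_vertex Y j) (g j)"
    and 0: "\<And>j. j \<in> verts Q \<Longrightarrow> zerom C (at_vertex X j) (at_vertex Y j) = addm C (f j) (g j)" by metis
  have ga: "arr \<R> X Y (restrict g (verts Q))"
  proof (rule rep_arrI[OF X Y g])
    fix a assume a: "a \<in> arcs Q"
    note Xa = rep_arrow[OF X a] and Ya = rep_arrow[OF Y a]
    note fh = rep_arrD(1)[OF f arc_ends(1)[OF a]] and ft = rep_arrD(1)[OF f arc_ends(2)[OF a]]
    note gh = g[OF arc_ends(1)[OF a]] and gt = g[OF arc_ends(2)[OF a]]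
    have ob: "at_vertex Y (head Q a) \<in> ob C" "at_vertex X (tail Q a) \<in> ob C" using X Y a rep_vertex by auto
    have "addm C (f (head Q a) \<cdot> at_arrow X a) (g (head Q a) \<cdot> at_arrow X a)
        = zerom C (at_vertex X (tail Q a)) (at_vertex Y (head Q a))"
      using distrib_right[OF Xa fh gh] 0[OF arc_ends(1)[OF a]] zero_comp[OF Xa ob(1)] by simp
    also have "\<dots> = addm C (at_arrow Y a \<cdot> f (tail Q a)) (at_arrow Y a \<cdot> g (tail Q a))"
      using distrib_left[OF ft gt Ya] 0[OF arc_ends(2)[OF a]] comp_zero[OF Ya ob(2)] by simp
    finally show "g (head Q a) \<cdot> at_arrow X a = at_arrow Y a \<cdot> g (tail Q a)"
      using add_cancel[OF comp_arr[OF Xa fh] comp_arr[OF Xa gh] comp_arr[OF gt Ya]] rep_arrD(2)[OF f a] by simp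
  qed
  have "addm \<R> (restrict g (verts Q)) f = zerom \<R> X Y"
    using 0 add_comm[OF rep_arrD(1)[OF f] g] by (auto simp: Rep_def restrict_def fun_eq_iff)
  then show thesis using that ga by blast
qed

lemma preadditive_Rep: "preadditive_category \<R>"
proof (rule preadditive_category.intro)
  note D = rep_arrD
  show "idm \<R> A \<in> mor \<R> A A" if "A \<in> ob \<R>" for A
    using rep_id_arr[OF that] by (simp add: arr_def)
  show "cmp \<R> g f \<in> mor \<R> A D"
    if "A \<in> ob \<R>" "B \<in> ob \<R>" "D \<in> ob \<R>" "f \<in> mor \<R> A B" "g \<in> mor \<R> B D" for A B D f g
    using rep_comp_arr[of A B f D g] that by (simp add: arr_def)
  show "cmp \<R> f (idm \<R> A) = f" "cmp \<R> (idm \<R> B) f = f"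
    if "A \<in> ob \<R>" "B \<in> ob \<R>" "f \<in> mor \<R> A B" for A B f
  proof -
    have f: "arr \<R> A B f" using that by (simp add: arr_def)
    show "cmp \<R> f (idm \<R> A) = f"
      using id_right[OF D(1)[OF f]] by (intro rep_arr_eqI[OF rep_comp_arr[OF rep_id_arr[OF that(1)] f] f]) simp
    show "cmp \<R> (idm \<R> B) f = f"
      using id_left[OF D(1)[OF f]] by (intro rep_arr_eqI[OF rep_comp_arr[OF f rep_id_arr[OF that(2)]] f]) simp
  qed
  show "cmp \<R> h (cmp \<R> g f) = cmp \<R> (cmp \<R> h g) f"
    if "A \<in> ob \<R>" "B \<in> ob \<R>" "D \<in> ob \<R>" "E \<in> ob \<R>"
      "f \<in> mor \<R> A B" "g \<in> mor \<R> B D" "h \<in> mor \<R> D E" for A B D E f g h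
  proof -
    have f: "arr \<R> A B f" and g: "arr \<R> B D g" and h: "arr \<R> D E h"
      using that by (auto simp: arr_def)
    show ?thesis
      using assoc[OF D(1)[OF f] D(1)[OF g] D(1)[OF h]]
      by (intro rep_arr_eqI[OF rep_comp_arr[OF rep_comp_arr[OF f g] h] rep_comp_arr[OF f rep_comp_arr[OF g h]]]) simp
  qed
  show "cmp \<R> g (addm \<R> f f') = addm \<R> (cmp \<R> g f) (cmp \<R> g f')"
    if "A \<in> ob \<R>" "B \<in> ob \<R>" "D \<in> ob \<R>" "f \<in> mor \<R> A B" "f' \<in> mor \<R> A B"
      "g \<in> mor \<R> B D" for A B D f f' g
  proof -
    have f: "arr \<R> A B f" and f': "arr \<R> A B f'" and g: "arr \<R> B D g"
      using that by (auto simp: arr_def)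
    show ?thesis
      using distrib_left[OF D(1)[OF f] D(1)[OF f'] D(1)[OF g]]
      by (intro rep_arr_eqI[OF rep_comp_arr[OF rep_add_arr[OF f f'] g] rep_add_arr[OF rep_comp_arr[OF f g] rep_comp_arr[OF f' g]]]) simp
  qed
  show "cmp \<R> (addm \<R> g g') f = addm \<R> (cmp \<R> g f) (cmp \<R> g' f)"
    if "A \<in> ob \<R>" "B \<in> ob \<R>" "D \<in> ob \<R>" "f \<in> mor \<R> A B"
      "g \<in> mor \<R> B D" "g' \<in> mor \<R> B D" for A B D f g g'
  proof -
    have f: "arr \<R> A B f" and g: "arr \<R> B D g" and g': "arr \<R> B D g'"
      using that by (auto simp: arr_def)
    show ?thesis
      using distrib_right[OF D(1)[OF f] D(1)[OF g] D(1)[OF g']]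
      by (intro rep_arr_eqI[OF rep_comp_arr[OF f rep_add_arr[OF g g']] rep_add_arr[OF rep_comp_arr[OF f g] rep_comp_arr[OF f g']]]) simp
  qed
  show "comm_group (hom_group \<R> A B)" if A: "A \<in> ob \<R>" and B: "B \<in> ob \<R>" for A B
  proof (rule comm_groupI)
    let ?G = "hom_group \<R> A B"
    have car: "f \<in> carrier ?G \<longleftrightarrow> arr \<R> A B f" for f using that by (simp add: hom_group_def arr_def)
    have op: "f \<otimes>\<^bsub>?G\<^esub> g = addm \<R> f g" "\<one>\<^bsub>?G\<^esub> = zerom \<R> A B" for f g by (auto simp: hom_group_def)
    show "f \<otimes>\<^bsub>?G\<^esub> g \<in> carrier ?G" if "f \<in> carrier ?G" "g \<in> carrier ?G" for f g
      using that unfolding car op by (rule rep_add_arr)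
    show "\<one>\<^bsub>?G\<^esub> \<in> carrier ?G" unfolding car op using A B by (rule rep_zero_arr)
    show "f \<otimes>\<^bsub>?G\<^esub> g \<otimes>\<^bsub>?G\<^esub> h = f \<otimes>\<^bsub>?G\<^esub> (g \<otimes>\<^bsub>?G\<^esub> h)"
      if "f \<in> carrier ?G" "g \<in> carrier ?G" "h \<in> carrier ?G" for f g h
    proof -
      have f: "arr \<R> A B f" and g: "arr \<R> A B g" and h: "arr \<R> A B h"
        using that unfolding car by auto
      show ?thesis unfolding op
        using add_assoc[OF D(1)[OF f] D(1)[OF g] D(1)[OF h]]
        by (intro rep_arr_eqI[OF rep_add_arr[OF rep_add_arr[OF f g] h] rep_add_arr[OF f rep_add_arr[OF g h]]]) simp
    qed
    show "f \<otimes>\<^bsub>?G\<^esub> g = g \<otimes>\<^bsub>?G\<^esub> f" if "f \<in> carrier ?G" "g \<in> carrier ?G" for f g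
    proof -
      have f: "arr \<R> A B f" and g: "arr \<R> A B g" using that unfolding car by auto
      show ?thesis unfolding op
        using add_comm[OF D(1)[OF f] D(1)[OF g]]
        by (intro rep_arr_eqI[OF rep_add_arr[OF f g] rep_add_arr[OF g f]]) simp
    qed
    show "\<one>\<^bsub>?G\<^esub> \<otimes>\<^bsub>?G\<^esub> f = f" if "f \<in> carrier ?G" for f
    proof -
      have f: "arr \<R> A B f" using that unfolding car .
      show ?thesis unfolding op
        using add_zero(2)[OF D(1)[OF f]]
        by (intro rep_arr_eqI[OF rep_add_arr[OF rep_zero_arr[OF A B] f] f]) simp
    qed
    show "\<exists>g\<in>carrier ?G. g \<otimes>\<^bsub>?G\<^esub> f = \<one>\<^bsub>?G\<^esub>" if "f \<in> carrier ?G" for f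
      using rep_negative that unfolding Bex_def car op by metis
  qed
qed

lemma is_kernel_RepI:
  assumes k: "arr \<R> K X k" and f: "arr \<R> X Y f"
    and ker: "\<And>j. j \<in> verts Q \<Longrightarrow> is_kernel C (at_vertex X j) (at_vertex Y j) (f j) (at_vertex K j) (k j)"
  shows "is_kernel \<R> X Y f K k"
proof -
  interpret R: preadditive_category "\<R>" by (rule preadditive_Rep)
  note D = rep_arrD
  have K: "K \<in> ob \<R>" using D[OF k] by simp
  have Y: "Y \<in> ob \<R>" using D[OF f] by simp
  show ?thesis
  proof (rule R.is_kernelI[OF k f])
    show "cmp \<R> f k = zerom \<R> K Y"
      using kernel_zero[OF ker] by (intro rep_arr_eqI[OF rep_comp_arr[OF k f] rep_zero_arr[OF K Y]]) simp
  next
    fix W g assume g: "arr \<R> W X g" and 0: "cmp \<R> f g = zerom \<R> W Y"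
    have W: "W \<in> ob \<R>" using D[OF g] by simp
    have fg: "f j \<cdot> g j = zerom C (at_vertex W j) (at_vertex Y j)" if "j \<in> verts Q" for j
      using fun_cong[OF 0, of j] that by simp
    have "\<exists>h. arr C (at_vertex W j) (at_vertex K j) h \<and> k j \<cdot> h = g j" if "j \<in> verts Q" for j
      using kernel_factor[OF ker[OF that] D(1)[OF g that] fg[OF that]] by metis
    then obtain h where h: "\<And>j. j \<in> verts Q \<Longrightarrow> arr C (at_vertex W j) (at_vertex K j) (h j)"
      and kh: "\<And>j. j \<in> verts Q \<Longrightarrow> k j \<cdot> h j = g j" by metis
    have ha: "arr \<R> W K (restrict h (verts Q))"
    proof (rule rep_arrI[OF W K h])
      fix a assume a: "a \<in> arcs Q"
      note Wa = rep_arrow[OF W a] and Ka = rep_arrow[OF K a] and Xa = rep_arrow[OF D(4)[OF k] a]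
      note e = arc_ends[OF a]
      note kh' = D(1)[OF k e(1)] and kt = D(1)[OF k e(2)]
      have "k (head Q a) \<cdot> (h (head Q a) \<cdot> at_arrow W a) = at_arrow X a \<cdot> g (tail Q a)"
        using assoc[OF Wa h[OF e(1)] kh'] kh[OF e(1)] D(2)[OF g a] by simp
      also have "\<dots> = (at_arrow X a \<cdot> k (tail Q a)) \<cdot> h (tail Q a)"
        using assoc[OF h[OF e(2)] kt Xa] kh[OF e(2)] by simp
      also have "\<dots> = k (head Q a) \<cdot> (at_arrow K a \<cdot> h (tail Q a))"
        using assoc[OF h[OF e(2)] Ka kh'] D(2)[OF k a] by simp
      finally show "h (head Q a) \<cdot> at_arrow W a = at_arrow K a \<cdot> h (tail Q a)"
        by (rule kernel_cancel[OF ker[OF e(1)] D(1)[OF f e(1)] comp_arr[OF Wa h[OF e(1)]] comp_arr[OF h[OF e(2)] Ka]])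
    qed
    moreover have "cmp \<R> k (restrict h (verts Q)) = g"
      using kh by (intro rep_arr_eqI[OF rep_comp_arr[OF ha k] g]) simp
    ultimately show "\<exists>h. arr \<R> W K h \<and> cmp \<R> k h = g" by blast
  next
    fix W h h' assume h: "arr \<R> W K h" and h': "arr \<R> W K h'"
      and eq: "cmp \<R> k h = cmp \<R> k h'"
    show "h = h'"
    proof (rule rep_arr_eqI[OF h h'])
      fix j assume j: "j \<in> verts Q"
      show "h j = h' j"
        using kernel_cancel[OF ker[OF j] D(1)[OF f j] D(1)[OF h j] D(1)[OF h' j]] fun_cong[OF eq, of j] j by simp
    qed
  qed
qed

lemma ex_vertexwise_kernel:
  assumes f: "arr \<R> X Y f"
  obtains K k where "arr \<R> K X k"
    "\<And>j. j \<in> verts Q \<Longrightarrow> is_kernel C (at_vertex X j) (at_vertex Y j) (f j) (at_vertex K j) (k j)"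
proof -
  note D = rep_arrD
  have X: "X \<in> ob \<R>" and Y: "Y \<in> ob \<R>" using D[OF f] by auto
  have "\<exists>K k. is_kernel C (at_vertex X j) (at_vertex Y j) (f j) K k" if "j \<in> verts Q" for j
    using ex_kernel'[OF D(1)[OF f that]] .
  then obtain K k where ker: "\<And>j. j \<in> verts Q \<Longrightarrow> is_kernel C (at_vertex X j) (at_vertex Y j) (f j) (K j) (k j)"
    by metis
  have ka: "arr C (K j) (at_vertex X j) (k j)" if "j \<in> verts Q" for j
    using kernel_arr[OF ker[OF that] rep_vertex[OF X that]] .
  have "\<exists>h. arr C (K (tail Q a)) (K (head Q a)) h \<and> k (head Q a) \<cdot> h = at_arrow X a \<cdot> k (tail Q a)"
    if a: "a \<in> arcs Q" for a
  proof -
    note e = arc_ends[OF a] and Xa = rep_arrow[OF X a] and Ya = rep_arrow[OF Y a]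
    have Kt: "K (tail Q a) \<in> ob C" using ka[OF e(2)] by (simp add: arr_def)
    have "f (head Q a) \<cdot> (at_arrow X a \<cdot> k (tail Q a)) = at_arrow Y a \<cdot> (f (tail Q a) \<cdot> k (tail Q a))"
      using assoc[OF ka[OF e(2)] Xa D(1)[OF f e(1)]] D(2)[OF f a] assoc[OF ka[OF e(2)] D(1)[OF f e(2)] Ya] by simp
    also have "\<dots> = zerom C (K (tail Q a)) (at_vertex Y (head Q a))"
      using kernel_zero[OF ker[OF e(2)]] comp_zero[OF Ya Kt] by simp
    finally show ?thesis using kernel_factor[OF ker[OF e(1)] comp_arr[OF ka[OF e(2)] Xa]] by metis
  qed
  then obtain h where h: "\<And>a. a \<in> arcs Q \<Longrightarrow> arr C (K (tail Q a)) (K (head Q a)) (h a)"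
    and kh: "\<And>a. a \<in> arcs Q \<Longrightarrow> k (head Q a) \<cdot> h a = at_arrow X a \<cdot> k (tail Q a)" by metis
  have Ko: "mk_rep Q K h \<in> ob \<R>"
    using ka h by (intro mk_rep_ob) (auto simp: arr_def)
  have "arr \<R> (mk_rep Q K h) X (restrict k (verts Q))"
    using ka kh by (intro rep_arrI[OF Ko X]) auto
  then show thesis using that ker by simp
qed

text \<open>
  Kernels are unique up to isomorphism, so it is enough that some kernel is a kernel at every vertex.
\<close>

lemma is_kernel_RepD:
  assumes ker: "is_kernel \<R> X Y f K k" and f: "arr \<R> X Y f" and j: "j \<in> verts Q"
  shows "is_kernel C (at_vertex X j) (at_vertex Y j) (f j) (at_vertex K j) (k j)"
proof -
  interpret R: preadditive_category "\<R>" by (rule preadditive_Rep)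
  note D = rep_arrD
  obtain K' k' where k': "arr \<R> K' X k'"
    and ker': "\<And>j. j \<in> verts Q \<Longrightarrow> is_kernel C (at_vertex X j) (at_vertex Y j) (f j) (at_vertex K' j) (k' j)"
    using ex_vertexwise_kernel[OF f] by blast
  have K': "is_kernel \<R> X Y f K' k'" by (rule is_kernel_RepI[OF k' f ker'])
  have k: "arr \<R> K X k" using R.kernel_arr[OF ker] D[OF f] by blast
  obtain g where g: "arr \<R> K K' g" "cmp \<R> k' g = k"
    using R.kernel_factor[OF K' k R.kernel_zero[OF ker]] .
  obtain h where h: "arr \<R> K' K h" "cmp \<R> k h = k'"
    using R.kernel_factor[OF ker k' R.kernel_zero[OF K']] .
  have "cmp \<R> k (cmp \<R> h g) = cmp \<R> k (idm \<R> K)"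
    using R.assoc[OF g(1) h(1) k] g(2) h(2) R.id_right[OF k] by simp
  then have "cmp \<R> h g = idm \<R> K"
    using R.kernel_cancel[OF ker f R.comp_arr[OF g(1) h(1)] R.id_arr] D(3)[OF k] by blast
  from fun_cong[OF this, of j] have hg: "h j \<cdot> g j = idm C (at_vertex K j)" using j by simp
  note a = D(1)[OF k j] D(1)[OF g(1) j] D(1)[OF h(1) j] D(1)[OF k' j] D(1)[OF f j]
  show ?thesis
  proof (rule is_kernelI[OF a(1,5)])
    show "f j \<cdot> k j = zerom C (at_vertex K j) (at_vertex Y j)"
      using fun_cong[OF R.kernel_zero[OF ker], of j] j by simp
  next
    fix W x assume x: "arr C W (at_vertex X j) x" "f j \<cdot> x = zerom C W (at_vertex Y j)"
    obtain y where y: "arr C W (at_vertex K' j) y" "k' j \<cdot> y = x" using kernel_factor[OF ker'[OF j] x] .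
    have "k j \<cdot> (h j \<cdot> y) = x"
      using assoc[OF y(1) a(3,1)] fun_cong[OF h(2), of j] j y(2) by simp
    then show "\<exists>z. arr C W (at_vertex K j) z \<and> k j \<cdot> z = x" using y(1) a(3) by blast
  next
    fix W x y assume x: "arr C W (at_vertex K j) x" and y: "arr C W (at_vertex K j) y" and eq: "k j \<cdot> x = k j \<cdot> y"
    have kg: "k' j \<cdot> g j = k j" using fun_cong[OF g(2), of j] j by simp
    have "k' j \<cdot> (g j \<cdot> x) = k' j \<cdot> (g j \<cdot> y)"
      using assoc[OF x a(2,4)] assoc[OF y a(2,4)] kg eq by simp
    then have "g j \<cdot> x = g j \<cdot> y"
      using kernel_cancel[OF ker'[OF j] a(5) comp_arr[OF x a(2)] comp_arr[OF y a(2)]] by blast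
    then show "x = y"
      using assoc[OF x a(2,3)] assoc[OF y a(2,3)] hg id_left[OF x] id_left[OF y] by metis
  qed
qed

text \<open>
  A monomorphism has kernel zero, and the vertexwise kernel is a kernel.
\<close>

lemma is_mono_Rep_iff:
  assumes f: "arr \<R> X Y f"
  shows "is_mono \<R> X Y f \<longleftrightarrow> (\<forall>j\<in>verts Q. is_mono C (at_vertex X j) (at_vertex Y j) (f j))"
proof
  interpret R: preadditive_category "\<R>" by (rule preadditive_Rep)
  note D = rep_arrD
  assume m: "is_mono \<R> X Y f"
  obtain K k where k: "arr \<R> K X k"
    and ker: "\<And>j. j \<in> verts Q \<Longrightarrow> is_kernel C (at_vertex X j) (at_vertex Y j) (f j) (at_vertex K j) (k j)"
    using ex_vertexwise_kernel[OF f] by blast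
  have "is_kernel \<R> X Y f K k" by (rule is_kernel_RepI[OF k f ker])
  then have k0: "k = zerom \<R> K X"
    using m[unfolded R.is_mono_iff[OF f]] R.kernel_zero k by blast
  show "\<forall>j\<in>verts Q. is_mono C (at_vertex X j) (at_vertex Y j) (f j)"
  proof
    fix j assume j: "j \<in> verts Q"
    have kj: "k j = zerom C (at_vertex K j) (at_vertex X j)" using k0 j by simp
    show "is_mono C (at_vertex X j) (at_vertex Y j) (f j)"
      unfolding is_mono_iff[OF D(1)[OF f j]]
    proof (intro allI impI)
      fix W x assume x: "arr C W (at_vertex X j) x" "f j \<cdot> x = zerom C W (at_vertex Y j)"
      obtain y where "arr C W (at_vertex K j) y" "k j \<cdot> y = x" using kernel_factor[OF ker[OF j] x] .
      then show "x = zerom C W (at_vertex X j)" using kj zero_comp rep_vertex[OF D(3)[OF f] j] by metis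
    qed
  qed
next
  assume m: "\<forall>j\<in>verts Q. is_mono C (at_vertex X j) (at_vertex Y j) (f j)"
  show "is_mono \<R> X Y f"
    unfolding is_mono_def
  proof (intro conjI ballI impI)
    show "f \<in> mor \<R> X Y" using f by (simp add: arr_def)
    fix W g h assume W: "W \<in> ob \<R>" "g \<in> mor \<R> W X" "h \<in> mor \<R> W X"
      and eq: "cmp \<R> f g = cmp \<R> f h"
    then have g: "arr \<R> W X g" and h: "arr \<R> W X h" using f by (auto simp: arr_def)
    show "g = h"
    proof (rule rep_arr_eqI[OF g h])
      fix j assume j: "j \<in> verts Q"
      then have "is_mono C (at_vertex X j) (at_vertex Y j) (f j)" using m by blast
      then show "g j = h j"
        using mono_cancel rep_arrD(1)[OF g j] rep_arrD(1)[OF h j] fun_cong[OF eq, of j] j by simp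
    qed
  qed
qed

end

lemma (in quiver_rep) quiver_rep_op: "quiver_rep (op_cat C) (op_quiver Q)"
proof -
  interpret op: abelian_category "op_cat C" by (rule abelian_op) unfold_locales
  show ?thesis
    by unfold_locales (use wf in \<open>auto simp: wf_digraph_def\<close>)
qed

context quiver_rep begin

lemma is_epi_Rep_iff:
  assumes f: "arr \<R> X Y f"
  shows "is_epi \<R> X Y f \<longleftrightarrow> (\<forall>j\<in>verts Q. is_epi C (at_vertex X j) (at_vertex Y j) (f j))"
proof -
  interpret op: quiver_rep "op_cat C" "op_quiver Q" by (rule quiver_rep_op)
  show ?thesis using op.is_mono_Rep_iff[of Y X f] f by (simp add: Rep_op)
qed

lemma is_cokernel_RepI:
  assumes "arr \<R> Y K k" "arr \<R> X Y f"
    and "\<And>j. j \<in> verts Q \<Longrightarrow> is_cokernel C (at_vertex X j) (at_vertex Y j) (f j) (at_vertex K j) (k j)"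
  shows "is_cokernel \<R> X Y f K k"
proof -
  interpret op: quiver_rep "op_cat C" "op_quiver Q" by (rule quiver_rep_op)
  show ?thesis using op.is_kernel_RepI[of K Y k X f] assms by (simp add: Rep_op)
qed

lemma ex_vertexwise_cokernel:
  assumes f: "arr \<R> X Y f"
  obtains K k where "arr \<R> Y K k"
    "\<And>j. j \<in> verts Q \<Longrightarrow> is_cokernel C (at_vertex X j) (at_vertex Y j) (f j) (at_vertex K j) (k j)"
proof -
  interpret op: quiver_rep "op_cat C" "op_quiver Q" by (rule quiver_rep_op)
  note t = that
  show thesis
  proof (rule op.ex_vertexwise_kernel[of Y X f])
    show "arr (Rep (op_quiver Q) (op_cat C)) Y X f" using f by (simp add: Rep_op)
    show thesis if "arr (Rep (op_quiver Q) (op_cat C)) K Y k"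
      "\<And>j. j \<in> verts (op_quiver Q) \<Longrightarrow>
        is_kernel (op_cat C) (at_vertex Y j) (at_vertex X j) (f j) (at_vertex K j) (k j)" for K k
      using t[of K k] that by (simp add: Rep_op)
  qed
qed

lemma short_exact_RepD:
  assumes s: "short_exact \<R> L k P e X" and j: "j \<in> verts Q"
  shows "short_exact C (at_vertex L j) (k j) (at_vertex P j) (e j) (at_vertex X j)"
  using s is_kernel_RepD[of P X e L k j] is_epi_Rep_iff[of P X e] rep_arrD(1) j unfolding short_exact_def by blast

lemma short_exact_RepI:
  assumes "arr \<R> L P k" "arr \<R> P X e"
    and "\<And>j. j \<in> verts Q \<Longrightarrow> short_exact C (at_vertex L j) (k j) (at_vertex P j) (e j) (at_vertex X j)"
  shows "short_exact \<R> L k P e X"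
  using assms is_kernel_RepI[of L P k X e] is_epi_Rep_iff[of P X e] unfolding short_exact_def by blast

lemma zero_object_Rep:
  assumes Z: "\<And>j. j \<in> verts Q \<Longrightarrow> is_zero_object C (at_vertex X j)" and X: "X \<in> ob \<R>"
  shows "is_zero_object \<R> X"
  unfolding is_zero_object_def
proof (intro conjI ballI)
  show "X \<in> ob \<R>" by (rule X)
  fix Y assume Y: "Y \<in> ob \<R>"
  show "\<exists>!f. f \<in> mor \<R> Y X"
  proof (rule ex_ex1I)
    show "\<exists>f. f \<in> mor \<R> Y X" using rep_zero_arr[OF Y X] by (auto simp: arr_def)
    fix f g assume "f \<in> mor \<R> Y X" "g \<in> mor \<R> Y X"
    then have f: "arr \<R> Y X f" and g: "arr \<R> Y X g" using X Y by (auto simp: arr_def)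
    show "f = g"
      using zero_object_arr(2)[OF Z] rep_arrD(1)[OF f] rep_arrD(1)[OF g] rep_vertex[OF Y]
      by (intro rep_arr_eqI[OF f g]) metis
  qed
  show "\<exists>!f. f \<in> mor \<R> X Y"
  proof (rule ex_ex1I)
    show "\<exists>f. f \<in> mor \<R> X Y" using rep_zero_arr[OF X Y] by (auto simp: arr_def)
    fix f g assume "f \<in> mor \<R> X Y" "g \<in> mor \<R> X Y"
    then have f: "arr \<R> X Y f" and g: "arr \<R> X Y g" using X Y by (auto simp: arr_def)
    show "f = g"
      using zero_object_arr(1)[OF Z] rep_arrD(1)[OF f] rep_arrD(1)[OF g] rep_vertex[OF Y]
      by (intro rep_arr_eqI[OF f g]) metis
  qed
qed

lemma ex_sum2_Rep:
  assumes X: "X \<in> ob \<R>" and Y: "Y \<in> ob \<R>"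
  shows "\<exists>S i\<^sub>1 i\<^sub>2 p\<^sub>1 p\<^sub>2. sum2 \<R> X Y S i\<^sub>1 i\<^sub>2 p\<^sub>1 p\<^sub>2"
proof -
  interpret R: preadditive_category "\<R>" by (rule preadditive_Rep)
  have "\<exists>S i\<^sub>1 i\<^sub>2 p\<^sub>1 p\<^sub>2. sum2 C (at_vertex X j) (at_vertex Y j) S i\<^sub>1 i\<^sub>2 p\<^sub>1 p\<^sub>2" if "j \<in> verts Q" for j
    using ex_sum2[OF rep_vertex[OF X that] rep_vertex[OF Y that]] by metis
  then obtain S i\<^sub>1 i\<^sub>2 p\<^sub>1 p\<^sub>2
    where s: "\<And>j. j \<in> verts Q \<Longrightarrow> sum2 C (at_vertex X j) (at_vertex Y j) (S j) (i\<^sub>1 j) (i\<^sub>2 j) (p\<^sub>1 j) (p\<^sub>2 j)" by metis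
  note a = sum2_arr[OF s] and d = sum2_delta[OF s]
  have "\<exists>h. arr C (S (tail Q a)) (S (head Q a)) h \<and> p\<^sub>1 (head Q a) \<cdot> h = at_arrow X a \<cdot> p\<^sub>1 (tail Q a) \<and>
      p\<^sub>2 (head Q a) \<cdot> h = at_arrow Y a \<cdot> p\<^sub>2 (tail Q a)" if "a \<in> arcs Q" for a
    using sum2_tuple[OF s[OF arc_ends(1)[OF that]] comp_arr[OF a(3)[OF arc_ends(2)[OF that]] rep_arrow[OF X that]]
        comp_arr[OF a(4)[OF arc_ends(2)[OF that]] rep_arrow[OF Y that]]] by metis
  then obtain h where h: "\<And>a. a \<in> arcs Q \<Longrightarrow> arr C (S (tail Q a)) (S (head Q a)) (h a)"
    and h1: "\<And>a. a \<in> arcs Q \<Longrightarrow> p\<^sub>1 (head Q a) \<cdot> h a = at_arrow X a \<cdot> p\<^sub>1 (tail Q a)"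
    and h2: "\<And>a. a \<in> arcs Q \<Longrightarrow> p\<^sub>2 (head Q a) \<cdot> h a = at_arrow Y a \<cdot> p\<^sub>2 (tail Q a)" by metis
  let ?S = "mk_rep Q S h"
  have S: "?S \<in> ob \<R>" using sum2_ob[OF s] h by (intro mk_rep_ob) auto
  have P1: "arr \<R> ?S X (restrict p\<^sub>1 (verts Q))" using a(3) h1 by (intro rep_arrI[OF S X]) auto
  have P2: "arr \<R> ?S Y (restrict p\<^sub>2 (verts Q))" using a(4) h2 by (intro rep_arrI[OF S Y]) auto
  have I1: "arr \<R> X ?S (restrict i\<^sub>1 (verts Q))"
  proof (rule rep_arrI[OF X S])
    fix b assume b: "b \<in> arcs Q"
    note e = arc_ends[OF b] and Xb = rep_arrow[OF X b] and Yb = rep_arrow[OF Y b]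
    have ob: "at_vertex Y (head Q b) \<in> ob C" "at_vertex X (tail Q b) \<in> ob C" using X Y e rep_vertex by auto
    have "i\<^sub>1 (head Q b) \<cdot> at_arrow X b = h b \<cdot> i\<^sub>1 (tail Q b)"
    proof (rule sum2_joint_mono[OF s[OF e(1)] comp_arr[OF Xb a(1)[OF e(1)]] comp_arr[OF a(1)[OF e(2)] h[OF b]]])
      show "p\<^sub>1 (head Q b) \<cdot> (i\<^sub>1 (head Q b) \<cdot> at_arrow X b) = p\<^sub>1 (head Q b) \<cdot> (h b \<cdot> i\<^sub>1 (tail Q b))"
        using assoc[OF Xb a(1)[OF e(1)] a(3)[OF e(1)]] d(1)[OF e(1)] id_left[OF Xb]
          assoc[OF a(1)[OF e(2)] h[OF b] a(3)[OF e(1)]] h1[OF b] assoc[OF a(1)[OF e(2)] a(3)[OF e(2)] Xb]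
          d(1)[OF e(2)] id_right[OF Xb] by simp
      show "p\<^sub>2 (head Q b) \<cdot> (i\<^sub>1 (head Q b) \<cdot> at_arrow X b) = p\<^sub>2 (head Q b) \<cdot> (h b \<cdot> i\<^sub>1 (tail Q b))"
        using assoc[OF Xb a(1)[OF e(1)] a(4)[OF e(1)]] d(4)[OF e(1)] zero_comp[OF Xb ob(1)]
          assoc[OF a(1)[OF e(2)] h[OF b] a(4)[OF e(1)]] h2[OF b] assoc[OF a(1)[OF e(2)] a(4)[OF e(2)] Yb]
          d(4)[OF e(2)] comp_zero[OF Yb ob(2)] by simp
    qed
    then show "i\<^sub>1 (head Q b) \<cdot> at_arrow X b = at_arrow ?S b \<cdot> i\<^sub>1 (tail Q b)" using b by simp
  qed (use a(1) in auto)
  have I2: "arr \<R> Y ?S (restrict i\<^sub>2 (verts Q))"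
  proof (rule rep_arrI[OF Y S])
    fix b assume b: "b \<in> arcs Q"
    note e = arc_ends[OF b] and Xb = rep_arrow[OF X b] and Yb = rep_arrow[OF Y b]
    have ob: "at_vertex X (head Q b) \<in> ob C" "at_vertex Y (tail Q b) \<in> ob C" using X Y e rep_vertex by auto
    have "i\<^sub>2 (head Q b) \<cdot> at_arrow Y b = h b \<cdot> i\<^sub>2 (tail Q b)"
    proof (rule sum2_joint_mono[OF s[OF e(1)] comp_arr[OF Yb a(2)[OF e(1)]] comp_arr[OF a(2)[OF e(2)] h[OF b]]])
      show "p\<^sub>2 (head Q b) \<cdot> (i\<^sub>2 (head Q b) \<cdot> at_arrow Y b) = p\<^sub>2 (head Q b) \<cdot> (h b \<cdot> i\<^sub>2 (tail Q b))"
        using assoc[OF Yb a(2)[OF e(1)] a(4)[OF e(1)]] d(2)[OF e(1)] id_left[OF Yb]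
          assoc[OF a(2)[OF e(2)] h[OF b] a(4)[OF e(1)]] h2[OF b] assoc[OF a(2)[OF e(2)] a(4)[OF e(2)] Yb]
          d(2)[OF e(2)] id_right[OF Yb] by simp
      show "p\<^sub>1 (head Q b) \<cdot> (i\<^sub>2 (head Q b) \<cdot> at_arrow Y b) = p\<^sub>1 (head Q b) \<cdot> (h b \<cdot> i\<^sub>2 (tail Q b))"
        using assoc[OF Yb a(2)[OF e(1)] a(3)[OF e(1)]] d(3)[OF e(1)] zero_comp[OF Yb ob(1)]
          assoc[OF a(2)[OF e(2)] h[OF b] a(3)[OF e(1)]] h1[OF b] assoc[OF a(2)[OF e(2)] a(3)[OF e(2)] Xb]
          d(3)[OF e(2)] comp_zero[OF Xb ob(2)] by simp
    qed
    then show "i\<^sub>2 (head Q b) \<cdot> at_arrow Y b = at_arrow ?S b \<cdot> i\<^sub>2 (tail Q b)" using b by simp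
  qed (use a(2) in auto)
  have "sum2 \<R> X Y ?S (restrict i\<^sub>1 (verts Q)) (restrict i\<^sub>2 (verts Q)) (restrict p\<^sub>1 (verts Q)) (restrict p\<^sub>2 (verts Q))"
    unfolding sum2_def
  proof (rule R.direct_sumI)
    show "?S \<in> ob \<R>" by (rule S)
    let ?i = "\<lambda>b::bool. if b then restrict i\<^sub>1 (verts Q) else restrict i\<^sub>2 (verts Q)"
    let ?p = "\<lambda>b::bool. if b then restrict p\<^sub>1 (verts Q) else restrict p\<^sub>2 (verts Q)"
    let ?X = "\<lambda>b::bool. if b then X else Y"
    show "arr \<R> (?X b) ?S (?i b)" "arr \<R> ?S (?X b) (?p b)" for b using I1 I2 P1 P2 by auto
    fix b c :: bool
    have "arr \<R> (?X b) (?X c) (cmp \<R> (?p c) (?i b))"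
      using rep_comp_arr[OF I1 P1] rep_comp_arr[OF I1 P2] rep_comp_arr[OF I2 P1] rep_comp_arr[OF I2 P2] by auto
    moreover have "arr \<R> (?X b) (?X c) (if b = c then idm \<R> (?X b) else zerom \<R> (?X b) (?X c))"
      using rep_id_arr[OF X] rep_id_arr[OF Y] rep_zero_arr[OF X Y] rep_zero_arr[OF Y X] by auto
    ultimately show "cmp \<R> (?p c) (?i b) = (if b = c then idm \<R> (?X b) else zerom \<R> (?X b) (?X c))"
      by (rule rep_arr_eqI) (use d in auto)
  next
    let ?p = "\<lambda>b::bool. if b then restrict p\<^sub>1 (verts Q) else restrict p\<^sub>2 (verts Q)"
    fix f g assume f: "arr \<R> ?S ?S f" and g: "arr \<R> ?S ?S g"
      and eq: "\<And>b. b \<in> UNIV \<Longrightarrow> cmp \<R> (?p b) f = cmp \<R> (?p b) g"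
    show "f = g"
    proof (rule rep_arr_eqI[OF f g])
      fix j assume j: "j \<in> verts Q"
      have fj: "arr C (S j) (S j) (f j)" and gj: "arr C (S j) (S j) (g j)"
        using rep_arrD(1)[OF f j] rep_arrD(1)[OF g j] j by auto
      show "f j = g j"
        using sum2_joint_mono[OF s[OF j] fj gj] fun_cong[OF eq[of True], of j] fun_cong[OF eq[of False], of j] j by simp
    qed
  qed simp
  then show ?thesis by blast
qed

lemma abelian_Rep: "abelian_category \<R>"
proof -
  interpret op: quiver_rep "op_cat C" "op_quiver Q" by (rule quiver_rep_op)
  interpret R: preadditive_category "\<R>" by (rule preadditive_Rep)
  show ?thesis
  proof unfold_locales
    obtain Z where Z: "is_zero_object C Z" using ex_zero_object by blast
    then have Zo: "Z \<in> ob C" by (simp add: is_zero_object_def)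
    have "mk_rep Q (\<lambda>_. Z) (\<lambda>_. zerom C Z Z) \<in> ob \<R>" using Zo by (intro mk_rep_ob) auto
    then show "\<exists>Z. is_zero_object \<R> Z" using zero_object_Rep Z by (metis mk_rep_simps(1))
  next
    fix A B assume "A \<in> ob \<R>" "B \<in> ob \<R>"
    then show "\<exists>S \<iota> \<pi>. is_direct_sum \<R> (UNIV :: bool set) (\<lambda>b. if b then A else B) S \<iota> \<pi>"
      using ex_sum2_Rep unfolding sum2_def by metis
  next
    fix A B f assume AB: "A \<in> ob \<R>" "B \<in> ob \<R>" "f \<in> mor \<R> A B"
    then have f: "arr \<R> A B f" by (simp add: arr_def)
    show "\<exists>K k. is_kernel \<R> A B f K k"
      using ex_vertexwise_kernel[OF f] is_kernel_RepI[OF _ f] by metis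
    show "\<exists>K k. is_cokernel \<R> A B f K k"
      using ex_vertexwise_cokernel[OF f] is_cokernel_RepI[OF _ f] by metis
  next
    fix A B f assume AB: "A \<in> ob \<R>" "B \<in> ob \<R>" and m: "is_mono \<R> A B f"
    then have f: "arr \<R> A B f" by (simp add: arr_def is_mono_def)
    obtain K k where k: "arr \<R> B K k"
      and co: "\<And>j. j \<in> verts Q \<Longrightarrow> is_cokernel C (at_vertex A j) (at_vertex B j) (f j) (at_vertex K j) (k j)"
      using ex_vertexwise_cokernel[OF f] by blast
    have "is_kernel C (at_vertex B j) (at_vertex K j) (k j) (at_vertex A j) (f j)" if "j \<in> verts Q" for j
      using mono_kernel_of_cokernel[OF _ rep_arrD(1)[OF f that] co[OF that]] m[unfolded is_mono_Rep_iff[OF f]] that by blast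
    then have "is_kernel \<R> B K k A f" by (rule is_kernel_RepI[OF f k])
    then show "\<exists>D\<in>ob \<R>. \<exists>g\<in>mor \<R> B D. is_kernel \<R> B D g A f" using k by (auto simp: arr_def)
  next
    fix A B f assume AB: "A \<in> ob \<R>" "B \<in> ob \<R>" and m: "is_epi \<R> A B f"
    then have f: "arr \<R> A B f" by (simp add: arr_def is_epi_def)
    obtain K k where k: "arr \<R> K A k"
      and co: "\<And>j. j \<in> verts Q \<Longrightarrow> is_kernel C (at_vertex A j) (at_vertex B j) (f j) (at_vertex K j) (k j)"
      using ex_vertexwise_kernel[OF f] by blast
    have "is_cokernel C (at_vertex K j) (at_vertex A j) (k j) (at_vertex B j) (f j)" if "j \<in> verts Q" for j
      using epi_cokernel_of_kernel[OF _ rep_arrD(1)[OF f that] co[OF that]] m[unfolded is_epi_Rep_iff[OF f]] that by blast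
    then have "is_cokernel \<R> K A k B f" by (rule is_cokernel_RepI[OF f k])
    then show "\<exists>D\<in>ob \<R>. \<exists>g\<in>mor \<R> D A. is_cokernel \<R> D A g B f" using k by (auto simp: arr_def)
  qed
qed

lemma direct_sum_vertex:
  assumes ds: "is_direct_sum \<R> I X S \<iota> \<pi>" and j: "j \<in> verts Q"
  shows "is_direct_sum C I (\<lambda>i. at_vertex (X i) j) (at_vertex S j) (\<lambda>i. \<iota> i j) (\<lambda>i. \<pi> i j)"
proof -
  interpret R: preadditive_category "\<R>" by (rule preadditive_Rep)
  note a = R.direct_sum_arr[OF ds] and d = R.direct_sum_delta[OF ds]
  have fin: "finite I" and S: "S \<in> ob \<R>" using ds by (auto simp: is_direct_sum_def)
  have ev: "finprod (hom_group \<R> S S) f F j = finprod (hom_group C (at_vertex S j) (at_vertex S j)) (\<lambda>i. f i j) F"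
    if "finite F" "\<And>i. i \<in> F \<Longrightarrow> arr \<R> S S (f i)" for F f
    using that
  proof (induction F rule: finite_induct)
    case empty
    then show ?case
      using finprod_empty_arr[OF rep_vertex[OF S j] rep_vertex[OF S j], of "\<lambda>i. f i j"]
        R.finprod_empty_arr[OF S S, of f] j by simp
  next
    case (insert i F)
    have "arr C (at_vertex S j) (at_vertex S j) (f i' j)" if "i' \<in> insert i F" for i'
      using rep_arrD(1)[OF insert(4)[OF that] j] .
    then show ?case
      using finprod_insert_arr[OF rep_vertex[OF S j] rep_vertex[OF S j] insert(1,2), of "\<lambda>i. f i j"]
        R.finprod_insert_arr[OF S S insert(1,2,4)] insert.IH insert(4) j by simp
  qed
  have "finprod (hom_group \<R> S S) (\<lambda>i. cmp \<R> (\<iota> i) (\<pi> i)) I = idm \<R> S"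
    using ds by (simp add: is_direct_sum_def)
  from fun_cong[OF this, of j]
  have id: "finprod (hom_group C (at_vertex S j) (at_vertex S j)) (\<lambda>i. cmp \<R> (\<iota> i) (\<pi> i) j) I = idm C (at_vertex S j)"
    using ev[OF fin, of "\<lambda>i. cmp \<R> (\<iota> i) (\<pi> i)"] rep_comp_arr[OF a(2) a(1)] j by simp
  have aj: "arr C (at_vertex (X i) j) (at_vertex S j) (\<iota> i j)" "arr C (at_vertex S j) (at_vertex (X i) j) (\<pi> i j)"
    if "i \<in> I" for i using rep_arrD(1)[OF a(1)[OF that] j] rep_arrD(1)[OF a(2)[OF that] j] by auto
  have dj: "\<pi> i' j \<cdot> \<iota> i j = (if i = i' then idm C (at_vertex (X i) j) else zerom C (at_vertex (X i) j) (at_vertex (X i') j))"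
    if "i \<in> I" "i' \<in> I" for i i'
    using fun_cong[OF d(1)[OF that(1)], of j] fun_cong[OF d(2)[OF that(1) that(2)], of j] j by (cases "i = i'") auto
  show ?thesis
    unfolding is_direct_sum_def using fin rep_vertex[OF S j] aj dj id j by (auto simp: arr_def)
qed

lemma retract_vertex:
  assumes "retract \<R> X Y" and j: "j \<in> verts Q"
  shows "retract C (at_vertex X j) (at_vertex Y j)"
proof -
  obtain s r where s: "arr \<R> X Y s" and r: "arr \<R> Y X r"
    and rs: "cmp \<R> r s = idm \<R> X" using assms(1) by (auto simp: retract_def)
  show ?thesis
    unfolding retract_def using rep_arrD(1)[OF s j] rep_arrD(1)[OF r j] fun_cong[OF rs, of j] j by auto
qed

end

section \<open>Coinduced representations\<close>

lemma Nil_in_paths: "wf_digraph Q \<Longrightarrow> [] \<in> paths Q j i \<longleftrightarrow> j = i \<and> i \<in> verts Q"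
  by (auto simp: paths_def wf_digraph.awalk_Nil_iff)

lemma Cons_in_paths:
  "wf_digraph Q \<Longrightarrow> a # p \<in> paths Q j i \<longleftrightarrow> a \<in> arcs Q \<and> j = tail Q a \<and> p \<in> paths Q (head Q a) i"
  by (simp add: paths_def wf_digraph.awalk_Cons_iff)

lemma paths_verts:
  assumes "wf_digraph Q" "p \<in> paths Q j i" shows "j \<in> verts Q" "i \<in> verts Q"
  using wf_digraph.awalk_hd_in_verts[OF assms(1), of j p i] wf_digraph.awalk_last_in_verts[OF assms(1), of j p i] assms(2)
  by (simp_all add: paths_def)

text \<open>
  A walk that repeats a vertex contains a closed walk, so in an acyclic quiver every walk is a path
  without repetitions.
\<close>

lemma acyclic_finite_paths:
  assumes fin: "fin_digraph Q" and ac: "acyclic_quiver Q"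
  shows "finite (paths Q j i)"
proof -
  interpret fin_digraph Q by (rule fin)
  have "apath j p i" if p: "awalk j p i" for p
  proof (rule ccontr)
    assume "\<not> apath j p i"
    then have "\<not> distinct (awalk_verts j p)" using p by (simp add: apath_def)
    from awalk_not_distinct_decomp[OF p this] obtain r w where r: "0 < length r" "awalk w r w" by metis
    have "w \<in> verts Q" by (rule awalk_hd_in_verts[OF r(2)])
    then have "paths Q w w = {[]}" using ac by (simp add: acyclic_quiver_def)
    moreover have "r \<in> paths Q w w" using r(2) by (simp add: paths_def)
    ultimately show False using r(1) by simp
  qed
  then have "paths Q j i \<subseteq> {p. apath j p i}" by (auto simp: paths_def)
  then show ?thesis by (rule finite_subset[OF _ apaths_finite])
qed

lemma rev_paths_op_quiver:
  assumes wf: "wf_digraph Q" and p: "p \<in> paths (op_quiver Q) j i"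
  shows "rev p \<in> paths Q i j"
proof -
  interpret wf_digraph Q by (rule wf)
  have wf': "wf_digraph (op_quiver Q)" using wf by (auto simp: wf_digraph_def)
  show ?thesis
    using p
  proof (induction p arbitrary: j)
    case Nil
    then show ?case using Nil_in_paths[OF wf'] Nil_in_paths[OF wf] by auto
  next
    case (Cons a p)
    then have a: "a \<in> arcs Q" "j = head Q a" "p \<in> paths (op_quiver Q) (tail Q a) i"
      using Cons_in_paths[OF wf'] by auto
    then have "rev p \<in> paths Q i (tail Q a)" using Cons.IH by blast
    then have "awalk i (rev p) (tail Q a)" by (simp add: paths_def)
    then have "awalk i (rev p @ [a]) (head Q a)" using arc_implies_awalk[OF a(1)] by (rule awalk_appendI)
    then show ?case using a(2) by (simp add: paths_def)
  qed
qed

lemma acyclic_op_quiver: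
  assumes "wf_digraph Q" "acyclic_quiver Q"
  shows "acyclic_quiver (op_quiver Q)"
  unfolding acyclic_quiver_def
proof
  fix i assume "i \<in> verts (op_quiver Q)"
  then have i: "i \<in> verts Q" by simp
  have wf': "wf_digraph (op_quiver Q)" using assms(1) by (auto simp: wf_digraph_def)
  have "paths Q i i = {[]}" using assms(2) i by (simp add: acyclic_quiver_def)
  then have "p = []" if "p \<in> paths (op_quiver Q) i i" for p
    using rev_paths_op_quiver[OF assms(1) that] by simp
  then show "paths (op_quiver Q) i i = {[]}" using Nil_in_paths[OF wf'] i by auto
qed

lemma (in preadditive_category) ex_direct_sum_tuple:
  assumes "is_direct_sum C I X S \<iota> \<pi>" "Y \<in> ob C" "\<And>i. i \<in> I \<Longrightarrow> arr C Y (X i) (f i)"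
  shows "\<exists>g. arr C Y S g \<and> (\<forall>i\<in>I. \<pi> i \<cdot> g = f i)"
  by (rule direct_sum_tuple[OF assms]) auto

definition dsum_inj :: "('o, 'm) add_cat \<Rightarrow> 'i set \<Rightarrow> ('i \<Rightarrow> 'o) \<Rightarrow> 'i \<Rightarrow> 'm" where
  "dsum_inj C I X = fst (snd (dsum C I X))"

lemma (in abelian_category) dsum_is_direct_sum:
  assumes "finite I" "\<And>i. i \<in> I \<Longrightarrow> X i \<in> ob C"
  shows "is_direct_sum C I X (dsum_ob C I X) (dsum_inj C I X) (dsum_proj C I X)"
proof -
  obtain S \<iota> \<pi> where "is_direct_sum C I X S \<iota> \<pi>" using ex_finite_direct_sum[of I X, OF assms] by blast
  then have "case dsum C I X of (S, \<iota>, \<pi>) \<Rightarrow> is_direct_sum C I X S \<iota> \<pi>"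
    unfolding dsum_def using someI[of "\<lambda>(S, \<iota>, \<pi>). is_direct_sum C I X S \<iota> \<pi>" "(S, \<iota>, \<pi>)"] by simp
  then show ?thesis unfolding dsum_ob_def dsum_inj_def dsum_proj_def by (simp add: case_prod_beta)
qed

locale acyclic_quiver_rep = quiver_rep C Q for C :: "('o, 'm) add_cat" (structure) and Q :: "('v, 'e) pre_digraph" +
  assumes fin: "fin_digraph Q" and acyclic: "acyclic_quiver Q"
begin

abbreviation E :: "'v \<Rightarrow> 'o \<Rightarrow> ('v, 'e, 'o, 'm) representation" where "E i A \<equiv> e_rho Q C i A"

abbreviation pr :: "'v \<Rightarrow> 'o \<Rightarrow> 'v \<Rightarrow> 'e list \<Rightarrow> 'm" where "pr i A j \<equiv> dsum_proj C (paths Q j i) (\<lambda>_. A)"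

abbreviation inj :: "'v \<Rightarrow> 'o \<Rightarrow> 'v \<Rightarrow> 'e list \<Rightarrow> 'm" where "inj i A j \<equiv> dsum_inj C (paths Q j i) (\<lambda>_. A)"

lemmas path_Nil = Nil_in_paths[OF wf] and path_Cons = Cons_in_paths[OF wf]

lemma finite_verts: "finite (verts Q)" and finite_arcs: "finite (arcs Q)"
  using fin by (auto simp: fin_digraph_def fin_digraph_axioms_def)

lemma E_sum:
  assumes "A \<in> ob C" "j \<in> verts Q"
  shows "is_direct_sum C (paths Q j i) (\<lambda>_. A) (at_vertex (E i A) j) (inj i A j) (pr i A j)"
  using dsum_is_direct_sum[OF acyclic_finite_paths[OF fin acyclic], of j i "\<lambda>_. A"] assms by (simp add: e_rho_def)

lemmas pr_arr = direct_sum_arr(2)[OF E_sum] and inj_arr = direct_sum_arr(1)[OF E_sum]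

lemma E_arrow:
  assumes A: "A \<in> ob C" and a: "a \<in> arcs Q"
  shows "arr C (at_vertex (E i A) (tail Q a)) (at_vertex (E i A) (head Q a)) (at_arrow (E i A) a)"
    and "p \<in> paths Q (head Q a) i \<Longrightarrow> pr i A (head Q a) p \<cdot> at_arrow (E i A) a = pr i A (tail Q a) (a # p)"
proof -
  note e = arc_ends[OF a]
  let ?T = "at_vertex (E i A) (tail Q a)" and ?H = "at_vertex (E i A) (head Q a)"
  have T: "?T = dsum_ob C (paths Q (tail Q a) i) (\<lambda>_. A)" and H: "?H = dsum_ob C (paths Q (head Q a) i) (\<lambda>_. A)"
    using e by (simp_all add: e_rho_def)
  have To: "?T \<in> ob C" and Ho: "?H \<in> ob C" using E_sum[OF A e(1), of i] E_sum[OF A e(2), of i] by (auto simp: is_direct_sum_def)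
  let ?P = "\<lambda>f. f \<in> mor C ?T ?H \<and> (\<forall>p\<in>paths Q (head Q a) i. pr i A (head Q a) p \<cdot> f = pr i A (tail Q a) (a # p))"
  have pa: "arr C ?T A (pr i A (tail Q a) (a # p))" if "p \<in> paths Q (head Q a) i" for p
    using pr_arr[OF A e(2)] that a path_Cons by blast
  obtain f where "arr C ?T ?H f" "\<And>p. p \<in> paths Q (head Q a) i \<Longrightarrow> pr i A (head Q a) p \<cdot> f = pr i A (tail Q a) (a # p)"
    using direct_sum_tuple[of "paths Q (head Q a) i" "\<lambda>_. A" ?H _ _ ?T "\<lambda>p. pr i A (tail Q a) (a # p)",
        OF E_sum[OF A e(1)] To pa] by blast
  then have f: "?P f" by (simp add: arr_def)
  have u: "g = f" if g: "?P g" for g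
  proof (rule direct_sum_joint_mono[OF E_sum[OF A e(1), of i]])
    show "arr C ?T ?H g" "arr C ?T ?H f" using f g To Ho by (auto simp: arr_def)
    show "pr i A (head Q a) p \<cdot> g = pr i A (head Q a) p \<cdot> f" if "p \<in> paths Q (head Q a) i" for p
      using f g that by simp
  qed
  have "?P (THE f. ?P f)" by (rule theI[of ?P, OF f u])
  moreover have "at_arrow (E i A) a = (THE f. ?P f)" unfolding T H using a by (simp add: e_rho_def)
  ultimately have P: "?P (at_arrow (E i A) a)" by simp
  show "arr C ?T ?H (at_arrow (E i A) a)" using P To Ho by (simp add: arr_def)
  show "p \<in> paths Q (head Q a) i \<Longrightarrow> pr i A (head Q a) p \<cdot> at_arrow (E i A) a = pr i A (tail Q a) (a # p)" using P by blast
qed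

lemma E_ob: assumes A: "A \<in> ob C" shows "E i A \<in> ob \<R>"
proof -
  have "at_vertex (E i A) j \<in> ob C" if "j \<in> verts Q" for j
    using E_sum[OF A that, of i] by (simp add: is_direct_sum_def)
  moreover have "at_vertex (E i A) \<in> extensional (verts Q)" "at_arrow (E i A) \<in> extensional (arcs Q)"
    by (simp_all add: e_rho_def)
  ultimately show ?thesis using E_arrow(1)[OF A, of _ i] by (auto simp: Rep_def arr_def PiE_def)
qed

text \<open>
  Both equations are tested against the projections: the component of the left-hand side at \<open>p\<close> is the
  projection at \<open>a # p\<close> after the injection at \<open>q\<close>.
\<close>

lemma E_arrow_inj:
  assumes A: "A \<in> ob C" and a: "a \<in> arcs Q" and q: "q \<in> paths Q (tail Q a) i"
  shows "p \<in> paths Q (head Q a) i \<Longrightarrow> q = a # p \<Longrightarrow> at_arrow (E i A) a \<cdot> inj i A (tail Q a) q = inj i A (head Q a) p"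
    and "(\<And>p. p \<in> paths Q (head Q a) i \<Longrightarrow> q \<noteq> a # p) \<Longrightarrow>
      at_arrow (E i A) a \<cdot> inj i A (tail Q a) q = zerom C A (at_vertex (E i A) (head Q a))"
proof -
  note e = arc_ends[OF a] and Ea = E_arrow(1)[OF A a, of i]
  have qa: "arr C A (at_vertex (E i A) (tail Q a)) (inj i A (tail Q a) q)" by (rule inj_arr[OF A e(2) q])
  have l: "arr C A (at_vertex (E i A) (head Q a)) (at_arrow (E i A) a \<cdot> inj i A (tail Q a) q)" using qa Ea by blast
  have Ho: "at_vertex (E i A) (head Q a) \<in> ob C" using Ea by (simp add: arr_def)
  note ds = E_sum[OF A e(1), of i] and dt = E_sum[OF A e(2), of i]
  have comp: "pr i A (head Q a) p' \<cdot> (at_arrow (E i A) a \<cdot> inj i A (tail Q a) q) = (if q = a # p' then idm C A else zerom C A A)"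
    if p': "p' \<in> paths Q (head Q a) i" for p'
  proof -
    have ap: "a # p' \<in> paths Q (tail Q a) i" using p' a path_Cons by blast
    show ?thesis
      using assoc[OF qa Ea pr_arr[OF A e(1) p']] E_arrow(2)[OF A a p'] direct_sum_delta[OF dt q] ap by auto
  qed
  show "at_arrow (E i A) a \<cdot> inj i A (tail Q a) q = inj i A (head Q a) p" if p: "p \<in> paths Q (head Q a) i" "q = a # p"
  proof (rule direct_sum_joint_mono[OF ds l inj_arr[OF A e(1) p(1)]])
    fix p' assume p': "p' \<in> paths Q (head Q a) i"
    show "pr i A (head Q a) p' \<cdot> (at_arrow (E i A) a \<cdot> inj i A (tail Q a) q) = pr i A (head Q a) p' \<cdot> inj i A (head Q a) p"
      using comp[OF p'] direct_sum_delta[OF ds p(1)] p' p(2) by auto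
  qed
  show "at_arrow (E i A) a \<cdot> inj i A (tail Q a) q = zerom C A (at_vertex (E i A) (head Q a))"
    if n: "\<And>p. p \<in> paths Q (head Q a) i \<Longrightarrow> q \<noteq> a # p"
  proof (rule direct_sum_joint_mono[OF ds l zero_arr[OF A Ho]])
    fix p' assume p': "p' \<in> paths Q (head Q a) i"
    show "pr i A (head Q a) p' \<cdot> (at_arrow (E i A) a \<cdot> inj i A (tail Q a) q) = pr i A (head Q a) p' \<cdot> zerom C A (at_vertex (E i A) (head Q a))"
      using comp[OF p'] n[OF p'] comp_zero[OF pr_arr[OF A e(1) p'] A] by simp
  qed
qed

text \<open>
  The component of \<open>\<phi>\<^sub>j\<close> at a path \<open>p : j \<rightarrow> i\<close> has to be \<open>f\<close> after the action of \<open>p\<close> on \<open>X\<close>. Together with the next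
  lemma this is the adjunction between the evaluation at \<open>i\<close> and \<open>e\<^sub>i\<^sup>\<rho>\<close>.
\<close>

lemma coinduced_exists:
  assumes X: "X \<in> ob \<R>" and i: "i \<in> verts Q" and f: "arr C (at_vertex X i) A f"
  obtains \<phi> where "arr \<R> X (E i A) \<phi>" "pr i A i [] \<cdot> \<phi> i = f"
proof -
  have A: "A \<in> ob C" using f by (simp add: arr_def)
  define g where "g = rec_list f (\<lambda>a p h. h \<cdot> at_arrow X a)"
  have g0: "g [] = f" and gC: "g (a # p) = g p \<cdot> at_arrow X a" for a p by (simp_all add: g_def)
  have ga: "arr C (at_vertex X j) A (g p)" if "p \<in> paths Q j i" for j p
    using that
  proof (induction p arbitrary: j)
    case Nil
    then show ?case using f g0 path_Nil by simp
  next
    case (Cons a p)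
    then have "a \<in> arcs Q" "j = tail Q a" "p \<in> paths Q (head Q a) i" using path_Cons by auto
    then show ?case using Cons.IH rep_arrow[OF X] gC by (metis comp_arr)
  qed
  have "\<exists>h. arr C (at_vertex X j) (at_vertex (E i A) j) h \<and> (\<forall>p\<in>paths Q j i. pr i A j p \<cdot> h = g p)"
    if j: "j \<in> verts Q" for j
    by (rule ex_direct_sum_tuple[OF E_sum[OF A j, of i] rep_vertex[OF X j] ga])
  then obtain \<phi> where \<phi>: "\<And>j. j \<in> verts Q \<Longrightarrow> arr C (at_vertex X j) (at_vertex (E i A) j) (\<phi> j)"
    and pr\<phi>: "\<And>j p. \<lbrakk>j \<in> verts Q; p \<in> paths Q j i\<rbrakk> \<Longrightarrow> pr i A j p \<cdot> \<phi> j = g p" by metis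
  have "arr \<R> X (E i A) (restrict \<phi> (verts Q))"
  proof (rule rep_arrI[OF X E_ob[OF A] \<phi>])
    fix a assume a: "a \<in> arcs Q"
    note e = arc_ends[OF a] and Xa = rep_arrow[OF X a] and Ea = E_arrow(1)[OF A a, of i]
    show "\<phi> (head Q a) \<cdot> at_arrow X a = at_arrow (E i A) a \<cdot> \<phi> (tail Q a)"
    proof (rule direct_sum_joint_mono[OF E_sum[OF A e(1), of i] comp_arr[OF Xa \<phi>[OF e(1)]] comp_arr[OF \<phi>[OF e(2)] Ea]])
      fix p assume p: "p \<in> paths Q (head Q a) i"
      have ap: "a # p \<in> paths Q (tail Q a) i" using p a path_Cons by blast
      note P = pr_arr[OF A e(1) p]
      show "pr i A (head Q a) p \<cdot> (\<phi> (head Q a) \<cdot> at_arrow X a) = pr i A (head Q a) p \<cdot> (at_arrow (E i A) a \<cdot> \<phi> (tail Q a))"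
        using assoc[OF Xa \<phi>[OF e(1)] P] pr\<phi>[OF e(1) p] assoc[OF \<phi>[OF e(2)] Ea P] E_arrow(2)[OF A a p]
          pr\<phi>[OF e(2) ap] gC by simp
    qed
  qed
  moreover have "pr i A i [] \<cdot> restrict \<phi> (verts Q) i = f" using pr\<phi>[OF i] path_Nil i g0 by simp
  ultimately show thesis using that by blast
qed

lemma coinduced_unique:
  assumes \<phi>: "arr \<R> X (E i A) \<phi>" and \<psi>: "arr \<R> X (E i A) \<psi>" and A: "A \<in> ob C"
    and eq: "pr i A i [] \<cdot> \<phi> i = pr i A i [] \<cdot> \<psi> i"
  shows "\<phi> = \<psi>"
proof -
  have X: "X \<in> ob \<R>" using rep_arrD[OF \<phi>] by simp
  have *: "pr i A j p \<cdot> \<phi> j = pr i A j p \<cdot> \<psi> j" if "p \<in> paths Q j i" for j p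
    using that
  proof (induction p arbitrary: j)
    case Nil
    then show ?case using eq path_Nil by simp
  next
    case (Cons a p)
    then have a: "a \<in> arcs Q" and j: "j = tail Q a" and p: "p \<in> paths Q (head Q a) i" using path_Cons by auto
    note e = arc_ends[OF a] and Ea = E_arrow(1)[OF A a, of i] and P = pr_arr[OF A e(1) p] and Xa = rep_arrow[OF X a]
    have "pr i A (tail Q a) (a # p) \<cdot> \<chi> (tail Q a) = (pr i A (head Q a) p \<cdot> \<chi> (head Q a)) \<cdot> at_arrow X a"
      if \<chi>: "arr \<R> X (E i A) \<chi>" for \<chi>
      using assoc[OF rep_arrD(1)[OF \<chi> e(2)] Ea P] E_arrow(2)[OF A a p] rep_arrD(2)[OF \<chi> a]
        assoc[OF Xa rep_arrD(1)[OF \<chi> e(1)] P] by simp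
    from this[OF \<phi>] this[OF \<psi>] Cons.IH[OF p] show ?case using j by simp
  qed
  show ?thesis
  proof (rule rep_arr_eqI[OF \<phi> \<psi>])
    fix j assume j: "j \<in> verts Q"
    show "\<phi> j = \<psi> j" by (rule direct_sum_joint_mono[OF E_sum[OF A j, of i] rep_arrD(1)[OF \<phi> j] rep_arrD(1)[OF \<psi> j] *])
  qed
qed

lemma coinduced_map:
  assumes w: "arr C A B w"
  obtains \<chi> where "arr \<R> (E i A) (E i B) \<chi>"
    "\<And>j p. \<lbrakk>j \<in> verts Q; p \<in> paths Q j i\<rbrakk> \<Longrightarrow> pr i B j p \<cdot> \<chi> j = w \<cdot> pr i A j p"
    "\<And>j p. \<lbrakk>j \<in> verts Q; p \<in> paths Q j i\<rbrakk> \<Longrightarrow> \<chi> j \<cdot> inj i A j p = inj i B j p \<cdot> w"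
proof -
  have A: "A \<in> ob C" and B: "B \<in> ob C" using w by (auto simp: arr_def)
  have Eo: "at_vertex (E i A) j \<in> ob C" if "j \<in> verts Q" for j using rep_vertex[OF E_ob[OF A] that] .
  have "\<exists>h. arr C (at_vertex (E i A) j) (at_vertex (E i B) j) h \<and> (\<forall>p\<in>paths Q j i. pr i B j p \<cdot> h = w \<cdot> pr i A j p)"
    if j: "j \<in> verts Q" for j
    by (rule ex_direct_sum_tuple[OF E_sum[OF B j, of i] Eo[OF j] comp_arr[OF pr_arr[OF A j] w]])
  then obtain \<chi> where \<chi>: "\<And>j. j \<in> verts Q \<Longrightarrow> arr C (at_vertex (E i A) j) (at_vertex (E i B) j) (\<chi> j)"
    and pr\<chi>: "\<And>j p. \<lbrakk>j \<in> verts Q; p \<in> paths Q j i\<rbrakk> \<Longrightarrow> pr i B j p \<cdot> \<chi> j = w \<cdot> pr i A j p" by metis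
  have \<chi>a: "arr \<R> (E i A) (E i B) (restrict \<chi> (verts Q))"
  proof (rule rep_arrI[OF E_ob[OF A] E_ob[OF B] \<chi>])
    fix a assume a: "a \<in> arcs Q"
    note e = arc_ends[OF a] and EA = E_arrow(1)[OF A a, of i] and EB = E_arrow(1)[OF B a, of i]
    show "\<chi> (head Q a) \<cdot> at_arrow (E i A) a = at_arrow (E i B) a \<cdot> \<chi> (tail Q a)"
    proof (rule direct_sum_joint_mono[OF E_sum[OF B e(1), of i] comp_arr[OF EA \<chi>[OF e(1)]] comp_arr[OF \<chi>[OF e(2)] EB]])
      fix p assume p: "p \<in> paths Q (head Q a) i"
      have ap: "a # p \<in> paths Q (tail Q a) i" using p a path_Cons by blast
      note PA = pr_arr[OF A e(1) p] and PB = pr_arr[OF B e(1) p]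
      show "pr i B (head Q a) p \<cdot> (\<chi> (head Q a) \<cdot> at_arrow (E i A) a) = pr i B (head Q a) p \<cdot> (at_arrow (E i B) a \<cdot> \<chi> (tail Q a))"
        using assoc[OF EA \<chi>[OF e(1)] PB] pr\<chi>[OF e(1) p] assoc[OF EA PA w] E_arrow(2)[OF A a p]
          assoc[OF \<chi>[OF e(2)] EB PB] E_arrow(2)[OF B a p] pr\<chi>[OF e(2) ap] by simp
    qed
  qed
  have \<chi>i: "\<chi> j \<cdot> inj i A j p = inj i B j p \<cdot> w" if j: "j \<in> verts Q" and p: "p \<in> paths Q j i" for j p
  proof (rule direct_sum_joint_mono[OF E_sum[OF B j, of i] comp_arr[OF inj_arr[OF A j p] \<chi>[OF j]] comp_arr[OF w inj_arr[OF B j p]]])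
    fix q assume q: "q \<in> paths Q j i"
    have "pr i B j q \<cdot> (\<chi> j \<cdot> inj i A j p) = w \<cdot> (pr i A j q \<cdot> inj i A j p)"
      using assoc[OF inj_arr[OF A j p] \<chi>[OF j] pr_arr[OF B j q]] pr\<chi>[OF j q] assoc[OF inj_arr[OF A j p] pr_arr[OF A j q] w] by simp
    moreover have "pr i B j q \<cdot> (inj i B j p \<cdot> w) = (pr i B j q \<cdot> inj i B j p) \<cdot> w"
      using assoc[OF w inj_arr[OF B j p] pr_arr[OF B j q]] by simp
    ultimately show "pr i B j q \<cdot> (\<chi> j \<cdot> inj i A j p) = pr i B j q \<cdot> (inj i B j p \<cdot> w)"
      using direct_sum_delta[OF E_sum[OF A j, of i] p] direct_sum_delta[OF E_sum[OF B j, of i] p] q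
        id_left[OF w] id_right[OF w] comp_zero[OF w A] zero_comp[OF w B] by (cases "q = p") auto
  qed
  show thesis using that[OF \<chi>a] pr\<chi> \<chi>i by simp
qed

lemma acyclic_quiver_rep_op: "acyclic_quiver_rep (op_cat C) (op_quiver Q)"
proof -
  interpret op: quiver_rep "op_cat C" "op_quiver Q" by (rule quiver_rep_op)
  have "fin_digraph (op_quiver Q)"
    using op.wf finite_verts finite_arcs by (auto simp: fin_digraph_def fin_digraph_axioms_def)
  then show ?thesis
    by (intro acyclic_quiver_rep.intro acyclic_quiver_rep_axioms.intro op.quiver_rep_axioms
        acyclic_op_quiver[OF wf acyclic])
qed

text \<open>
  For a tilting subcategory \<open>\<T>\<close> this is the subcategory that is to be shown tilting.
\<close>

definition coind_add :: "'o set \<Rightarrow> ('v, 'e, 'o, 'm) representation set" where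
  "coind_add \<T> = add_hull \<R> {e_rho Q C i T | i T. i \<in> verts Q \<and> T \<in> \<T>}"

lemma coind_add_additively_closed: "additively_closed \<R> (coind_add \<T>)"
proof -
  interpret R: abelian_category "\<R>" by (rule abelian_Rep)
  show ?thesis unfolding coind_add_def by (rule R.add_hull_additively_closed)
qed

text \<open>
  By adjunction a morphism \<open>X \<rightarrow> e\<^sub>i\<^sup>\<rho>(T)\<close> extends to \<open>Y\<close> as soon as the corresponding morphism \<open>X\<^sub>i \<rightarrow> T\<close> extends to
  \<open>Y\<^sub>i\<close>, and the extension property is inherited by direct sums and direct summands.
\<close>

lemma coind_add_relative_injective:
  assumes \<T>: "\<T> \<subseteq> ob C" and \<phi>: "arr \<R> X Y \<phi>"
    and v: "\<And>j. j \<in> verts Q \<Longrightarrow> rel_epi (op_cat C) \<T> (at_vertex Y j) (at_vertex X j) (\<phi> j)"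
  shows "rel_epi (op_cat \<R>) (coind_add \<T>) Y X \<phi>"
proof -
  interpret R: abelian_category "\<R>" by (rule abelian_Rep)
  interpret Rop: preadditive_category "op_cat \<R>" by (rule preadditive_op[OF preadditive_Rep])
  have "rel_epi (op_cat \<R>) {e_rho Q C i T | i T. i \<in> verts Q \<and> T \<in> \<T>} Y X \<phi>"
    unfolding rel_epi_def
  proof (intro conjI ballI allI impI)
    show "arr (op_cat \<R>) Y X \<phi>" using \<phi> by simp
    fix P f assume "P \<in> {e_rho Q C i T | i T. i \<in> verts Q \<and> T \<in> \<T>}" and "arr (op_cat \<R>) P X f"
    then obtain i T where i: "i \<in> verts Q" and T: "T \<in> \<T>" and P: "P = E i T" and f: "arr \<R> X (E i T) f" by auto
    have To: "T \<in> ob C" using T \<T> by blast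
    have pn: "arr C (at_vertex (E i T) i) T (pr i T i [])" using pr_arr[OF To i] path_Nil i by blast
    note fi = rep_arrD(1)[OF f i] and \<phi>i = rep_arrD(1)[OF \<phi> i]
    obtain g where g: "arr C (at_vertex Y i) T g" "g \<cdot> \<phi> i = pr i T i [] \<cdot> f i"
      using v[OF i] T comp_arr[OF fi pn] unfolding rel_epi_def by auto
    obtain \<gamma> where \<gamma>: "arr \<R> Y (E i T) \<gamma>" "pr i T i [] \<cdot> \<gamma> i = g"
      using coinduced_exists[OF rep_arrD(4)[OF \<phi>] i g(1)] .
    have "cmp \<R> \<gamma> \<phi> = f"
    proof (rule coinduced_unique[OF rep_comp_arr[OF \<phi> \<gamma>(1)] f To])
      show "pr i T i [] \<cdot> cmp \<R> \<gamma> \<phi> i = pr i T i [] \<cdot> f i"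
        using assoc[OF \<phi>i rep_arrD(1)[OF \<gamma>(1) i] pn] \<gamma>(2) g(2) i by simp
    qed
    then show "\<exists>g. arr (op_cat \<R>) P Y g \<and> cmp (op_cat \<R>) \<phi> g = f" using \<gamma>(1) P by auto
  qed
  then show ?thesis using Rop.rel_epi_add_hull unfolding coind_add_def by fastforce
qed

text \<open>
  Monomorphisms \<open>m\<^sub>j : X\<^sub>j \<rightarrow> T\<^sub>j\<close> give \<open>X \<rightarrow> \<Oplus>\<^sub>j e\<^sub>j\<^sup>\<rho>(T\<^sub>j)\<close>. At the vertex \<open>j\<close> it can be followed by a morphism to \<open>T\<^sub>j\<close> so that
  the composite is \<open>m\<^sub>j\<close>, hence it inherits the properties of \<open>m\<^sub>j\<close>.
\<close>

lemma coind_add_enough: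
  assumes \<T>: "\<T> \<subseteq> ob C" and X: "X \<in> ob \<R>"
    and v: "\<And>j. j \<in> verts Q \<Longrightarrow>
      \<exists>T m. T \<in> \<T> \<and> is_mono C (at_vertex X j) T m \<and> rel_epi (op_cat C) \<T> T (at_vertex X j) m"
  obtains Z \<phi> where "Z \<in> coind_add \<T>" "arr \<R> X Z \<phi>"
    "\<And>j. j \<in> verts Q \<Longrightarrow> is_mono C (at_vertex X j) (at_vertex Z j) (\<phi> j)"
    "\<And>j. j \<in> verts Q \<Longrightarrow> rel_epi (op_cat C) \<T> (at_vertex Z j) (at_vertex X j) (\<phi> j)"
proof -
  interpret R: abelian_category "\<R>" by (rule abelian_Rep)
  from v obtain T m where T: "\<And>j. j \<in> verts Q \<Longrightarrow> T j \<in> \<T>"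
    and mono: "\<And>j. j \<in> verts Q \<Longrightarrow> is_mono C (at_vertex X j) (T j) (m j)"
    and re: "\<And>j. j \<in> verts Q \<Longrightarrow> rel_epi (op_cat C) \<T> (T j) (at_vertex X j) (m j)" by metis
  have To: "T j \<in> ob C" if "j \<in> verts Q" for j using T[OF that] \<T> by blast
  have ma: "arr C (at_vertex X j) (T j) (m j)" if "j \<in> verts Q" for j using re[OF that] by (simp add: rel_epi_def)
  have "\<exists>\<psi>. arr \<R> X (E j (T j)) \<psi> \<and> pr j (T j) j [] \<cdot> \<psi> j = m j" if j: "j \<in> verts Q" for j
    using coinduced_exists[OF X j ma[OF j]] by metis
  then obtain \<psi> where \<psi>: "\<And>j. j \<in> verts Q \<Longrightarrow> arr \<R> X (E j (T j)) (\<psi> j)"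
    and pr\<psi>: "\<And>j. j \<in> verts Q \<Longrightarrow> pr j (T j) j [] \<cdot> \<psi> j j = m j" by metis
  obtain Z \<iota> \<pi> where ds: "is_direct_sum \<R> (verts Q) (\<lambda>j. E j (T j)) Z \<iota> \<pi>"
    using R.ex_finite_direct_sum[OF finite_verts, of "\<lambda>j. E j (T j)"] E_ob[OF To] by blast
  obtain \<phi> where \<phi>: "arr \<R> X Z \<phi>" "\<And>j. j \<in> verts Q \<Longrightarrow> cmp \<R> (\<pi> j) \<phi> = \<psi> j"
    using R.direct_sum_tuple[OF ds X \<psi>] by blast
  have Zo: "Z \<in> ob \<R>" using ds by (simp add: is_direct_sum_def)
  have Z: "Z \<in> coind_add \<T>"
    unfolding coind_add_def by (rule R.add_hullI[OF ds _ R.retract_refl[OF Zo]]) (use T in blast)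
  have factor: "\<exists>r. arr C (at_vertex Z j) (T j) r \<and> r \<cdot> \<phi> j = m j" if j: "j \<in> verts Q" for j
  proof -
    have pn: "arr C (at_vertex (E j (T j)) j) (T j) (pr j (T j) j [])" using pr_arr[OF To[OF j] j] path_Nil j by blast
    have \<pi>j: "arr C (at_vertex Z j) (at_vertex (E j (T j)) j) (\<pi> j j)" using rep_arrD(1)[OF R.direct_sum_arr(2)[OF ds j] j] .
    have "\<pi> j j \<cdot> \<phi> j = \<psi> j j" using fun_cong[OF \<phi>(2)[OF j], of j] j by simp
    then have "(pr j (T j) j [] \<cdot> \<pi> j j) \<cdot> \<phi> j = m j"
      using assoc[OF rep_arrD(1)[OF \<phi>(1) j] \<pi>j pn] pr\<psi>[OF j] by simp
    then show ?thesis using comp_arr[OF \<pi>j pn] by blast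
  qed
  have 1: "is_mono C (at_vertex X j) (at_vertex Z j) (\<phi> j)" if j: "j \<in> verts Q" for j
  proof -
    obtain r where r: "arr C (at_vertex Z j) (T j) r" "r \<cdot> \<phi> j = m j" using factor[OF j] by blast
    note \<phi>j = rep_arrD(1)[OF \<phi>(1) j]
    show ?thesis
      unfolding is_mono_iff[OF \<phi>j]
    proof (intro allI impI)
      fix W x assume x: "arr C W (at_vertex X j) x" "\<phi> j \<cdot> x = zerom C W (at_vertex Z j)"
      have "m j \<cdot> x = zerom C W (T j)"
        using assoc[OF x(1) \<phi>j r(1)] r(2) x(2) comp_zero[OF r(1)] x(1) by (simp add: arr_def)
      then show "x = zerom C W (at_vertex X j)" using mono[OF j, unfolded is_mono_iff[OF ma[OF j]]] x(1) by blast
    qed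
  qed
  have 2: "rel_epi (op_cat C) \<T> (at_vertex Z j) (at_vertex X j) (\<phi> j)" if j: "j \<in> verts Q" for j
  proof -
    obtain r where r: "arr C (at_vertex Z j) (T j) r" "r \<cdot> \<phi> j = m j" using factor[OF j] by blast
    note \<phi>j = rep_arrD(1)[OF \<phi>(1) j]
    show ?thesis
      unfolding rel_epi_def
    proof (intro conjI ballI allI impI)
      show "arr (op_cat C) (at_vertex Z j) (at_vertex X j) (\<phi> j)" using \<phi>j by simp
      fix P f assume P: "P \<in> \<T>" "arr (op_cat C) P (at_vertex X j) f"
      then obtain g where g: "arr C (T j) P g" "g \<cdot> m j = f" using re[OF j] unfolding rel_epi_def by auto
      have "(g \<cdot> r) \<cdot> \<phi> j = f" using assoc[OF \<phi>j r(1) g(1)] r(2) g(2) by simp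
      then show "\<exists>g. arr (op_cat C) P (at_vertex Z j) g \<and> cmp (op_cat C) (\<phi> j) g = f"
        using comp_arr[OF r(1) g(1)] by auto
    qed
  qed
  show thesis using that[OF Z \<phi>(1) 1 2] by blast
qed

lemma coind_add_vertex:
  assumes \<T>: "additively_closed C \<T>" and X: "X \<in> coind_add \<T>" and j: "j \<in> verts Q"
  shows "at_vertex X j \<in> \<T>"
proof -
  interpret R: abelian_category "\<R>" by (rule abelian_Rep)
  have \<T>o: "\<T> \<subseteq> ob C" by (rule additively_closed_ob[OF \<T>])
  from X show ?thesis
    unfolding coind_add_def
  proof (rule R.add_hullE)
    fix m :: nat and G S \<iota> \<pi>
    assume G: "\<And>k. k < m \<Longrightarrow> G k \<in> {e_rho Q C i T | i T. i \<in> verts Q \<and> T \<in> \<T>}"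
      and ds: "is_direct_sum \<R> {..<m} G S \<iota> \<pi>" and r: "retract \<R> X S"
    have "at_vertex (G k) j \<in> \<T>" if k: "k \<in> {..<m}" for k
    proof -
      obtain i T where i: "i \<in> verts Q" and T: "T \<in> \<T>" and Gk: "G k = E i T" using G k by blast
      have "T \<in> ob C" using T \<T>o by blast
      then show ?thesis unfolding Gk by (rule additively_closed_direct_sum[OF \<T> E_sum[OF _ j]]) (rule T)
    qed
    then have "at_vertex S j \<in> \<T>" by (rule additively_closed_direct_sum[OF \<T> direct_sum_vertex[OF ds j]])
    then show ?thesis by (rule additively_closed_retract[OF \<T> _ retract_vertex[OF r j]])
  qed
qed

end

section \<open>Dimension shift from the vertices to representations\<close>

context quiver_rep begin

text \<open>
  Here \<open>0 \<rightarrow> K \<rightarrow> P \<rightarrow> Y \<rightarrow> 0\<close> splits at every vertex, so \<open>P\<close> is \<open>K \<oplus> Y\<close> with structure morphisms twisted by a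
  family \<open>c\<^sub>a : Y\<^bsub>t(a)\<^esub> \<rightarrow> K\<^bsub>h(a)\<^esub>\<close>. Such families are subject to no condition, so the lift of \<open>c\<close> along \<open>e : Z \<rightarrow> K\<close>
  to a family \<open>d\<close> defines an extension of \<open>Y\<close> by \<open>Z\<close>, with a morphism \<open>\<theta>\<close> to \<open>P\<close> that is a vertexwise
  \<open>\<S>\<close>-epimorphism. The object \<open>P\<close> is projective relative to these, so \<open>\<theta>\<close> has a section, and the section
  restricts to a section \<open>K \<rightarrow> Z\<close> of \<open>e\<close>. Behind this is the fact that \<open>Ext\<^sup>1(Y, -)\<close>, formed with the vertexwise
  split extensions, is the cokernel of \<open>\<Prod>\<^sub>j Hom(Y\<^sub>j, -\<^sub>j) \<rightarrow> \<Prod>\<^sub>a Hom(Y\<^bsub>t(a)\<^esub>, -\<^bsub>h(a)\<^esub>)\<close> and therefore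
  takes vertexwise \<open>\<S>\<close>-epimorphisms to surjections.
\<close>

lemma syzygy_retract:
  assumes lift: "\<And>X Y \<phi>. \<lbrakk>arr \<R> X Y \<phi>;
        \<And>j. j \<in> verts Q \<Longrightarrow> rel_epi C \<S> (at_vertex X j) (at_vertex Y j) (\<phi> j)\<rbrakk> \<Longrightarrow> rel_epi \<R> \<S>' X Y \<phi>"
    and P: "P \<in> \<S>'" and s: "short_exact \<R> K k P p Y"
    and Y\<S>: "\<And>j. j \<in> verts Q \<Longrightarrow> at_vertex Y j \<in> \<S>"
    and rp: "\<And>j. j \<in> verts Q \<Longrightarrow> rel_epi C \<S> (at_vertex P j) (at_vertex Y j) (p j)"
    and e: "arr \<R> Z K e"
    and re: "\<And>j. j \<in> verts Q \<Longrightarrow> rel_epi C \<S> (at_vertex Z j) (at_vertex K j) (e j)"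
  shows "retract \<R> K Z"
proof -
  have k: "arr \<R> K P k" and p: "arr \<R> P Y p" using s by (auto simp: short_exact_def)
  have K: "K \<in> ob \<R>" and Po: "P \<in> ob \<R>" and Y: "Y \<in> ob \<R>" and Z: "Z \<in> ob \<R>"
    using rep_arrD[OF k] rep_arrD[OF p] rep_arrD[OF e] by auto
  note ker = short_exactD(3)[OF short_exact_RepD[OF s]] and pk = short_exactD(6)[OF short_exact_RepD[OF s]]
  note kj = rep_arrD(1)[OF k] and pj = rep_arrD(1)[OF p] and ej = rep_arrD(1)[OF e]
  note Ka = rep_arrow[OF K] and Pa = rep_arrow[OF Po] and Ya = rep_arrow[OF Y] and Za = rep_arrow[OF Z]
  note Kv = rep_vertex[OF K] and Pv = rep_vertex[OF Po] and Yv = rep_vertex[OF Y] and Zv = rep_vertex[OF Z]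
  have "\<exists>s. arr C (at_vertex Y j) (at_vertex P j) s \<and> p j \<cdot> s = idm C (at_vertex Y j)" if j: "j \<in> verts Q" for j
    using rel_epi_lift[OF rp[OF j] Y\<S>[OF j] id_arr[OF Yv[OF j]]] by metis
  then obtain s where sj: "\<And>j. j \<in> verts Q \<Longrightarrow> arr C (at_vertex Y j) (at_vertex P j) (s j)"
    and ps: "\<And>j. j \<in> verts Q \<Longrightarrow> p j \<cdot> s j = idm C (at_vertex Y j)" by metis
  \<comment> \<open>The sections \<open>s\<close> fail to be a morphism of representations by a family \<open>c\<close>.\<close>
  have "\<exists>c. arr C (at_vertex Y (tail Q a)) (at_vertex K (head Q a)) c \<and>
      at_arrow P a \<cdot> s (tail Q a) = addm C (s (head Q a) \<cdot> at_arrow Y a) (k (head Q a) \<cdot> c)" if a: "a \<in> arcs Q" for a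
  proof -
    note h = arc_ends(1)[OF a] and t = arc_ends(2)[OF a]
    have x: "arr C (at_vertex Y (tail Q a)) (at_vertex P (head Q a)) (s (head Q a) \<cdot> at_arrow Y a)"
      using Ya[OF a] sj[OF h] by blast
    have y: "arr C (at_vertex Y (tail Q a)) (at_vertex P (head Q a)) (at_arrow P a \<cdot> s (tail Q a))"
      using Pa[OF a] sj[OF t] by blast
    have "p (head Q a) \<cdot> (s (head Q a) \<cdot> at_arrow Y a) = at_arrow Y a"
      using assoc[OF Ya[OF a] sj[OF h] pj[OF h]] ps[OF h] id_left[OF Ya[OF a]] by simp
    moreover have "p (head Q a) \<cdot> (at_arrow P a \<cdot> s (tail Q a)) = at_arrow Y a"
      using assoc[OF sj[OF t] Pa[OF a] pj[OF h]] rep_arrD(2)[OF p a] assoc[OF sj[OF t] pj[OF t] Ya[OF a]]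
        ps[OF t] id_right[OF Ya[OF a]] by simp
    ultimately show ?thesis using kernel_difference[OF ker[OF h] pj[OF h] x y] by metis
  qed
  then obtain c where ca: "\<And>a. a \<in> arcs Q \<Longrightarrow> arr C (at_vertex Y (tail Q a)) (at_vertex K (head Q a)) (c a)"
    and c: "\<And>a. a \<in> arcs Q \<Longrightarrow> at_arrow P a \<cdot> s (tail Q a) = addm C (s (head Q a) \<cdot> at_arrow Y a) (k (head Q a) \<cdot> c a)"
    by metis
  have "\<exists>d. arr C (at_vertex Y (tail Q a)) (at_vertex Z (head Q a)) d \<and> e (head Q a) \<cdot> d = c a" if a: "a \<in> arcs Q" for a
    using rel_epi_lift[OF re[OF arc_ends(1)[OF a]] Y\<S>[OF arc_ends(2)[OF a]] ca[OF a]] by metis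
  then obtain d where da: "\<And>a. a \<in> arcs Q \<Longrightarrow> arr C (at_vertex Y (tail Q a)) (at_vertex Z (head Q a)) (d a)"
    and ed: "\<And>a. a \<in> arcs Q \<Longrightarrow> e (head Q a) \<cdot> d a = c a" by metis
  have "\<exists>S i\<^sub>1 i\<^sub>2 q\<^sub>1 q\<^sub>2. sum2 C (at_vertex Z j) (at_vertex Y j) S i\<^sub>1 i\<^sub>2 q\<^sub>1 q\<^sub>2" if "j \<in> verts Q" for j
    using ex_sum2[OF Zv[OF that] Yv[OF that]] by metis
  then obtain S i\<^sub>1 i\<^sub>2 q\<^sub>1 q\<^sub>2
    where s2: "\<And>j. j \<in> verts Q \<Longrightarrow> sum2 C (at_vertex Z j) (at_vertex Y j) (S j) (i\<^sub>1 j) (i\<^sub>2 j) (q\<^sub>1 j) (q\<^sub>2 j)" by metis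
  note q1 = sum2_arr(3)[OF s2] and q2 = sum2_arr(4)[OF s2]
  have Sv: "S j \<in> ob C" if "j \<in> verts Q" for j using sum2_ob[OF s2[OF that]] by simp
  \<comment> \<open>The extension of \<open>Y\<close> by \<open>Z\<close> with the lifted cocycle \<open>d\<close>.\<close>
  have m1: "arr C (S (tail Q a)) (at_vertex Z (head Q a)) (addm C (at_arrow Z a \<cdot> q\<^sub>1 (tail Q a)) (d a \<cdot> q\<^sub>2 (tail Q a)))"
    and m2: "arr C (S (tail Q a)) (at_vertex Y (head Q a)) (at_arrow Y a \<cdot> q\<^sub>2 (tail Q a))" if a: "a \<in> arcs Q" for a
    using q1[OF arc_ends(2)[OF a]] q2[OF arc_ends(2)[OF a]] Za[OF a] da[OF a] Ya[OF a] by blast+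
  have "\<exists>E. arr C (S (tail Q a)) (S (head Q a)) E \<and>
      q\<^sub>1 (head Q a) \<cdot> E = addm C (at_arrow Z a \<cdot> q\<^sub>1 (tail Q a)) (d a \<cdot> q\<^sub>2 (tail Q a)) \<and>
      q\<^sub>2 (head Q a) \<cdot> E = at_arrow Y a \<cdot> q\<^sub>2 (tail Q a)" if a: "a \<in> arcs Q" for a
    using sum2_tuple[OF s2[OF arc_ends(1)[OF a]] m1[OF a] m2[OF a]] by metis
  then obtain E where Ea: "\<And>a. a \<in> arcs Q \<Longrightarrow> arr C (S (tail Q a)) (S (head Q a)) (E a)"
    and E1: "\<And>a. a \<in> arcs Q \<Longrightarrow> q\<^sub>1 (head Q a) \<cdot> E a = addm C (at_arrow Z a \<cdot> q\<^sub>1 (tail Q a)) (d a \<cdot> q\<^sub>2 (tail Q a))"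
    and E2: "\<And>a. a \<in> arcs Q \<Longrightarrow> q\<^sub>2 (head Q a) \<cdot> E a = at_arrow Y a \<cdot> q\<^sub>2 (tail Q a)" by metis
  let ?E = "mk_rep Q S E"
  have Eo: "?E \<in> ob \<R>" using Sv Ea by (rule mk_rep_ob)
  define \<theta> where "\<theta> j = addm C (k j \<cdot> (e j \<cdot> q\<^sub>1 j)) (s j \<cdot> q\<^sub>2 j)" for j
  have eq1: "arr C (S j) (at_vertex K j) (e j \<cdot> q\<^sub>1 j)" and keq: "arr C (S j) (at_vertex P j) (k j \<cdot> (e j \<cdot> q\<^sub>1 j))"
    and sq: "arr C (S j) (at_vertex P j) (s j \<cdot> q\<^sub>2 j)" if j: "j \<in> verts Q" for j
    using q1[OF j] q2[OF j] ej[OF j] kj[OF j] sj[OF j] by blast+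
  have \<theta>j: "arr C (S j) (at_vertex P j) (\<theta> j)" if j: "j \<in> verts Q" for j
    unfolding \<theta>_def using keq[OF j] sq[OF j] by blast
  have \<theta>_comp: "\<theta> j \<cdot> x = addm C (k j \<cdot> (e j \<cdot> (q\<^sub>1 j \<cdot> x))) (s j \<cdot> (q\<^sub>2 j \<cdot> x))" if j: "j \<in> verts Q" and x: "arr C W (S j) x" for j W x
    unfolding \<theta>_def using distrib_right[OF x keq[OF j] sq[OF j]] assoc[OF x eq1[OF j] kj[OF j]]
      assoc[OF x q1[OF j] ej[OF j]] assoc[OF x q2[OF j] sj[OF j]] by simp
  have \<theta>: "arr \<R> ?E P (restrict \<theta> (verts Q))"
  proof (rule rep_arrI[OF Eo Po])
    show "arr C (at_vertex ?E j) (at_vertex P j) (\<theta> j)" if "j \<in> verts Q" for j using \<theta>j[OF that] that by simp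
    fix a assume a: "a \<in> arcs Q"
    note h = arc_ends(1)[OF a] and t = arc_ends(2)[OF a]
    have zq: "arr C (S (tail Q a)) (at_vertex Z (head Q a)) (at_arrow Z a \<cdot> q\<^sub>1 (tail Q a))"
      and dq: "arr C (S (tail Q a)) (at_vertex Z (head Q a)) (d a \<cdot> q\<^sub>2 (tail Q a))"
      and yq: "arr C (S (tail Q a)) (at_vertex Y (head Q a)) (at_arrow Y a \<cdot> q\<^sub>2 (tail Q a))"
      and cq: "arr C (S (tail Q a)) (at_vertex K (head Q a)) (c a \<cdot> q\<^sub>2 (tail Q a))"
      using q1[OF t] q2[OF t] Za[OF a] da[OF a] Ya[OF a] ca[OF a] by blast+
    let ?u = "k (head Q a) \<cdot> (e (head Q a) \<cdot> (at_arrow Z a \<cdot> q\<^sub>1 (tail Q a)))"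
    let ?v = "k (head Q a) \<cdot> (c a \<cdot> q\<^sub>2 (tail Q a))"
    let ?w = "s (head Q a) \<cdot> (at_arrow Y a \<cdot> q\<^sub>2 (tail Q a))"
    have u: "arr C (S (tail Q a)) (at_vertex P (head Q a)) ?u" using zq ej[OF h] kj[OF h] by blast
    have v: "arr C (S (tail Q a)) (at_vertex P (head Q a)) ?v" using cq kj[OF h] by blast
    have w: "arr C (S (tail Q a)) (at_vertex P (head Q a)) ?w" using yq sj[OF h] by blast
    have ez: "arr C (S (tail Q a)) (at_vertex K (head Q a)) (e (head Q a) \<cdot> (at_arrow Z a \<cdot> q\<^sub>1 (tail Q a)))"
      using zq ej[OF h] by blast
    have "e (head Q a) \<cdot> (q\<^sub>1 (head Q a) \<cdot> E a) =
        addm C (e (head Q a) \<cdot> (at_arrow Z a \<cdot> q\<^sub>1 (tail Q a))) (c a \<cdot> q\<^sub>2 (tail Q a))"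
      using E1[OF a] distrib_left[OF zq dq ej[OF h]] assoc[OF q2[OF t] da[OF a] ej[OF h]] ed[OF a] by simp
    then have "\<theta> (head Q a) \<cdot> E a = addm C (addm C ?u ?v) ?w"
      using \<theta>_comp[OF h Ea[OF a]] E2[OF a] distrib_left[OF ez cq kj[OF h]] by simp
    also have "\<dots> = addm C ?u (addm C ?w ?v)" using add_assoc[OF u v w] add_comm[OF v w] by simp
    also have "?u = at_arrow P a \<cdot> (k (tail Q a) \<cdot> (e (tail Q a) \<cdot> q\<^sub>1 (tail Q a)))"
      using assoc[OF q1[OF t] Za[OF a] ej[OF h]] rep_arrD(2)[OF e a] assoc[OF q1[OF t] ej[OF t] Ka[OF a]]
        assoc[OF eq1[OF t] Ka[OF a] kj[OF h]] rep_arrD(2)[OF k a] assoc[OF eq1[OF t] kj[OF t] Pa[OF a]] by simp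
    also have "addm C ?w ?v = at_arrow P a \<cdot> (s (tail Q a) \<cdot> q\<^sub>2 (tail Q a))"
      using assoc[OF q2[OF t] sj[OF t] Pa[OF a]] c[OF a]
        distrib_right[OF q2[OF t] comp_arr[OF Ya[OF a] sj[OF h]] comp_arr[OF ca[OF a] kj[OF h]]]
        assoc[OF q2[OF t] Ya[OF a] sj[OF h]] assoc[OF q2[OF t] ca[OF a] kj[OF h]] by simp
    also have "addm C (at_arrow P a \<cdot> (k (tail Q a) \<cdot> (e (tail Q a) \<cdot> q\<^sub>1 (tail Q a)))) (at_arrow P a \<cdot> (s (tail Q a) \<cdot> q\<^sub>2 (tail Q a)))
        = at_arrow P a \<cdot> \<theta> (tail Q a)"
      unfolding \<theta>_def using distrib_left[OF keq[OF t] sq[OF t] Pa[OF a]] by simp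
    finally show "\<theta> (head Q a) \<cdot> at_arrow ?E a = at_arrow P a \<cdot> \<theta> (tail Q a)" using a by simp
  qed
  have "rel_epi C \<S> (S j) (at_vertex P j) (\<theta> j)" if j: "j \<in> verts Q" for j
    unfolding rel_epi_def
  proof (intro conjI ballI allI impI)
    fix R x assume R: "R \<in> \<S>" and x: "arr C R (at_vertex P j) x"
    have px: "arr C R (at_vertex Y j) (p j \<cdot> x)" using x pj[OF j] by blast
    have spx: "arr C R (at_vertex P j) (s j \<cdot> (p j \<cdot> x))" using px sj[OF j] by blast
    have "p j \<cdot> (s j \<cdot> (p j \<cdot> x)) = p j \<cdot> x"
      using assoc[OF px sj[OF j] pj[OF j]] ps[OF j] id_left[OF px] by simp
    then obtain y where y: "arr C R (at_vertex K j) y" "x = addm C (s j \<cdot> (p j \<cdot> x)) (k j \<cdot> y)"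
      using kernel_difference[OF ker[OF j] pj[OF j] spx x] by metis
    obtain z where z: "arr C R (at_vertex Z j) z" "e j \<cdot> z = y" using rel_epi_lift[OF re[OF j] R y(1)] .
    obtain t where t: "arr C R (S j) t" "q\<^sub>1 j \<cdot> t = z" "q\<^sub>2 j \<cdot> t = p j \<cdot> x"
      using sum2_tuple[OF s2[OF j] z(1) px] .
    have "\<theta> j \<cdot> t = x"
      using \<theta>_comp[OF j t(1)] t z(2) y(2) add_comm[OF comp_arr[OF y(1) kj[OF j]] spx] by simp
    then show "\<exists>g. arr C R (S j) g \<and> \<theta> j \<cdot> g = x" using t(1) by blast
  qed (rule \<theta>j[OF j])
  then have "rel_epi \<R> \<S>' ?E P (restrict \<theta> (verts Q))" using lift[OF \<theta>] by simp
  then obtain g where g: "arr \<R> P ?E g" "cmp \<R> (restrict \<theta> (verts Q)) g = idm \<R> P"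
    using P rep_id_arr[OF Po] unfolding rel_epi_def by blast
  have gj: "arr C (at_vertex P j) (S j) (g j)" if "j \<in> verts Q" for j using rep_arrD(1)[OF g(1) that] that by simp
  have \<theta>g: "\<theta> j \<cdot> g j = idm C (at_vertex P j)" if "j \<in> verts Q" for j using fun_cong[OF g(2), of j] that by simp
  have gk: "arr C (at_vertex K j) (S j) (g j \<cdot> k j)" if "j \<in> verts Q" for j using gj[OF that] kj[OF that] by blast
  have p\<theta>: "p j \<cdot> (\<theta> j \<cdot> x) = q\<^sub>2 j \<cdot> x" if j: "j \<in> verts Q" and x: "arr C W (S j) x" for j W x
  proof -
    have a1: "arr C W (at_vertex K j) (e j \<cdot> (q\<^sub>1 j \<cdot> x))" and a2: "arr C W (at_vertex Y j) (q\<^sub>2 j \<cdot> x)"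
      using x q1[OF j] q2[OF j] ej[OF j] by blast+
    have "p j \<cdot> (k j \<cdot> (e j \<cdot> (q\<^sub>1 j \<cdot> x))) = zerom C W (at_vertex Y j)"
      using assoc[OF a1 kj[OF j] pj[OF j]] pk[OF j] zero_comp[OF a1 Yv[OF j]] by simp
    moreover have "p j \<cdot> (s j \<cdot> (q\<^sub>2 j \<cdot> x)) = q\<^sub>2 j \<cdot> x"
      using assoc[OF a2 sj[OF j] pj[OF j]] ps[OF j] id_left[OF a2] by simp
    ultimately show ?thesis
      using \<theta>_comp[OF j x] distrib_left[OF comp_arr[OF a1 kj[OF j]] comp_arr[OF a2 sj[OF j]] pj[OF j]] add_zero(2)[OF a2] by simp
  qed
  have q2gk: "q\<^sub>2 j \<cdot> (g j \<cdot> k j) = zerom C (at_vertex K j) (at_vertex Y j)" if j: "j \<in> verts Q" for j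
    using p\<theta>[OF j gk[OF j]] assoc[OF kj[OF j] gj[OF j] \<theta>j[OF j]] \<theta>g[OF j] id_left[OF kj[OF j]] pk[OF j] by simp
  let ?u = "\<lambda>j. q\<^sub>1 j \<cdot> (g j \<cdot> k j)"
  have uj: "arr C (at_vertex K j) (at_vertex Z j) (?u j)" if "j \<in> verts Q" for j using gk[OF that] q1[OF that] by blast
  have u: "arr \<R> K Z (restrict ?u (verts Q))"
  proof (rule rep_arrI[OF K Z uj])
    fix a assume a: "a \<in> arcs Q"
    note h = arc_ends(1)[OF a] and t = arc_ends(2)[OF a]
    have gPa: "g (head Q a) \<cdot> at_arrow P a = E a \<cdot> g (tail Q a)" using rep_arrD(2)[OF g(1) a] a by simp
    have "(q\<^sub>1 (head Q a) \<cdot> (g (head Q a) \<cdot> k (head Q a))) \<cdot> at_arrow K a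
        = q\<^sub>1 (head Q a) \<cdot> (g (head Q a) \<cdot> (at_arrow P a \<cdot> k (tail Q a)))"
      using assoc[OF Ka[OF a] gk[OF h] q1[OF h]] assoc[OF Ka[OF a] kj[OF h] gj[OF h]] rep_arrD(2)[OF k a] by simp
    also have "\<dots> = (q\<^sub>1 (head Q a) \<cdot> E a) \<cdot> (g (tail Q a) \<cdot> k (tail Q a))"
      using assoc[OF kj[OF t] Pa[OF a] gj[OF h]] gPa assoc[OF kj[OF t] gj[OF t] Ea[OF a]] assoc[OF gk[OF t] Ea[OF a] q1[OF h]] by simp
    also have "\<dots> = addm C ((at_arrow Z a \<cdot> q\<^sub>1 (tail Q a)) \<cdot> (g (tail Q a) \<cdot> k (tail Q a))) ((d a \<cdot> q\<^sub>2 (tail Q a)) \<cdot> (g (tail Q a) \<cdot> k (tail Q a)))"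
      unfolding E1[OF a] by (rule distrib_right[OF gk[OF t] comp_arr[OF q1[OF t] Za[OF a]] comp_arr[OF q2[OF t] da[OF a]]])
    also have "(d a \<cdot> q\<^sub>2 (tail Q a)) \<cdot> (g (tail Q a) \<cdot> k (tail Q a)) = zerom C (at_vertex K (tail Q a)) (at_vertex Z (head Q a))"
      using assoc[OF gk[OF t] q2[OF t] da[OF a]] q2gk[OF t] comp_zero[OF da[OF a] Kv[OF t]] by simp
    also have "(at_arrow Z a \<cdot> q\<^sub>1 (tail Q a)) \<cdot> (g (tail Q a) \<cdot> k (tail Q a)) = at_arrow Z a \<cdot> (q\<^sub>1 (tail Q a) \<cdot> (g (tail Q a) \<cdot> k (tail Q a)))"
      by (rule assoc[OF gk[OF t] q1[OF t] Za[OF a]])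
    finally show "(q\<^sub>1 (head Q a) \<cdot> (g (head Q a) \<cdot> k (head Q a))) \<cdot> at_arrow K a = at_arrow Z a \<cdot> (q\<^sub>1 (tail Q a) \<cdot> (g (tail Q a) \<cdot> k (tail Q a)))"
      using add_zero(1)[OF comp_arr[OF uj[OF t] Za[OF a]]] by simp
  qed
  have "cmp \<R> e (restrict ?u (verts Q)) = idm \<R> K"
  proof (rule rep_arr_eqI[OF rep_comp_arr[OF u e] rep_id_arr[OF K]])
    fix j assume j: "j \<in> verts Q"
    have eu: "arr C (at_vertex K j) (at_vertex K j) (e j \<cdot> ?u j)" using uj[OF j] ej[OF j] by blast
    have "k j \<cdot> idm C (at_vertex K j) = \<theta> j \<cdot> (g j \<cdot> k j)"
      using assoc[OF kj[OF j] gj[OF j] \<theta>j[OF j]] \<theta>g[OF j] id_left[OF kj[OF j]] id_right[OF kj[OF j]] by simp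
    also have "\<dots> = k j \<cdot> (e j \<cdot> ?u j)"
      using \<theta>_comp[OF j gk[OF j]] q2gk[OF j] comp_zero[OF sj[OF j] Kv[OF j]] add_zero(1)[OF comp_arr[OF eu kj[OF j]]] by simp
    finally have "e j \<cdot> ?u j = idm C (at_vertex K j)"
      using kernel_cancel[OF ker[OF j] pj[OF j] id_arr[OF Kv[OF j]] eu] by simp
    then show "cmp \<R> e (restrict ?u (verts Q)) j = idm \<R> K j" using j by simp
  qed
  then show ?thesis unfolding retract_def using u e by blast
qed

text \<open>
  After \<open>n\<close> steps with approximations from \<open>\<S>'\<close> the syzygy lies in \<open>\<S>\<close> at every vertex, since vertexwise
  dimensions drop in each step. One more step then leads into \<open>\<S>'\<close>, by \<open>syzygy_retract\<close>.
\<close>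

lemma resolved_of_vertexwise_pdim_le:
  assumes \<S>: "additively_closed C \<S>" and \<S>': "additively_closed \<R> \<S>'"
    and lift: "\<And>X Y \<phi>. \<lbrakk>arr \<R> X Y \<phi>;
        \<And>j. j \<in> verts Q \<Longrightarrow> rel_epi C \<S> (at_vertex X j) (at_vertex Y j) (\<phi> j)\<rbrakk> \<Longrightarrow> rel_epi \<R> \<S>' X Y \<phi>"
    and enough: "\<And>X. \<lbrakk>X \<in> ob \<R>; \<And>j. j \<in> verts Q \<Longrightarrow> \<exists>L k P e. presentation C \<S> L k P e (at_vertex X j)\<rbrakk> \<Longrightarrow>
        \<exists>P \<phi>. P \<in> \<S>' \<and> arr \<R> P X \<phi> \<and> (\<forall>j\<in>verts Q. at_vertex P j \<in> \<S> \<and>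
          is_epi C (at_vertex P j) (at_vertex X j) (\<phi> j) \<and> rel_epi C \<S> (at_vertex P j) (at_vertex X j) (\<phi> j))"
  shows "\<lbrakk>Y \<in> ob \<R>; \<And>j. j \<in> verts Q \<Longrightarrow> pdim_le C \<S> n (at_vertex Y j)\<rbrakk> \<Longrightarrow> resolved \<R> \<S>' (Suc n) Y"
proof -
  interpret R: abelian_category "\<R>" by (rule abelian_Rep)
  have cover: "\<exists>K k P \<phi>. P \<in> \<S>' \<and> short_exact \<R> K k P \<phi> X \<and>
      (\<forall>j\<in>verts Q. presentation C \<S> (at_vertex K j) (k j) (at_vertex P j) (\<phi> j) (at_vertex X j))"
    if X: "X \<in> ob \<R>" "\<And>j. j \<in> verts Q \<Longrightarrow> \<exists>L k P e. presentation C \<S> L k P e (at_vertex X j)" for X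
  proof -
    obtain P \<phi> where P: "P \<in> \<S>'" and \<phi>: "arr \<R> P X \<phi>"
      and v: "\<And>j. j \<in> verts Q \<Longrightarrow> at_vertex P j \<in> \<S> \<and>
          is_epi C (at_vertex P j) (at_vertex X j) (\<phi> j) \<and> rel_epi C \<S> (at_vertex P j) (at_vertex X j) (\<phi> j)"
      using enough[OF X] by blast
    obtain K k where k: "arr \<R> K P k"
      and ker: "\<And>j. j \<in> verts Q \<Longrightarrow> is_kernel C (at_vertex P j) (at_vertex X j) (\<phi> j) (at_vertex K j) (k j)"
      using ex_vertexwise_kernel[OF \<phi>] by blast
    have s: "short_exact C (at_vertex K j) (k j) (at_vertex P j) (\<phi> j) (at_vertex X j)" if "j \<in> verts Q" for j
      unfolding short_exact_def using rep_arrD(1)[OF k that] rep_arrD(1)[OF \<phi> that] ker[OF that] v[OF that] by blast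
    have "short_exact \<R> K k P \<phi> X" by (rule short_exact_RepI[OF k \<phi> s])
    moreover have "\<forall>j\<in>verts Q. presentation C \<S> (at_vertex K j) (k j) (at_vertex P j) (\<phi> j) (at_vertex X j)"
      unfolding presentation_def using s v by blast
    ultimately show ?thesis using P by blast
  qed
  have self: "\<exists>L k P e. presentation C \<S> L k P e A" if "A \<in> \<S>" for A using presentation_self[OF \<S> that] by metis
  show "\<lbrakk>Y \<in> ob \<R>; \<And>j. j \<in> verts Q \<Longrightarrow> pdim_le C \<S> n (at_vertex Y j)\<rbrakk> \<Longrightarrow> resolved \<R> \<S>' (Suc n) Y"
  proof (induction n arbitrary: Y)
    case 0
    have Y\<S>: "at_vertex Y j \<in> \<S>" if "j \<in> verts Q" for j using 0(2)[OF that] by simp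
    obtain K k P \<phi> where P: "P \<in> \<S>'" and s: "short_exact \<R> K k P \<phi> Y"
      and pv: "\<And>j. j \<in> verts Q \<Longrightarrow> presentation C \<S> (at_vertex K j) (k j) (at_vertex P j) (\<phi> j) (at_vertex Y j)"
      using cover[OF 0(1) self[OF Y\<S>]] by blast
    have K: "K \<in> ob \<R>" using s by (auto simp: short_exact_def arr_def)
    have K\<S>: "at_vertex K j \<in> \<S>" if j: "j \<in> verts Q" for j
    proof -
      have "pdim_le C \<S> (Suc 0) (at_vertex Y j)" by (rule pdim_le_mono[OF \<S> _ 0(2)[OF j]]) simp
      then show ?thesis using pdim_le_syzygy[OF \<S> _ pv[OF j], of 0] by simp
    qed
    obtain K2 k2 Z e where Z: "Z \<in> \<S>'" and s2: "short_exact \<R> K2 k2 Z e K"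
      and zv: "\<And>j. j \<in> verts Q \<Longrightarrow> presentation C \<S> (at_vertex K2 j) (k2 j) (at_vertex Z j) (e j) (at_vertex K j)"
      using cover[OF K self[OF K\<S>]] by blast
    have e: "arr \<R> Z K e" using s2 by (simp add: short_exact_def)
    have "retract \<R> K Z"
    proof (rule syzygy_retract[OF lift P s Y\<S> _ e])
      show "rel_epi C \<S> (at_vertex P j) (at_vertex Y j) (\<phi> j)" if "j \<in> verts Q" for j
        using pv[OF that] by (simp add: presentation_def)
      show "rel_epi C \<S> (at_vertex Z j) (at_vertex K j) (e j)" if "j \<in> verts Q" for j
        using zv[OF that] by (simp add: presentation_def)
    qed
    then have "K \<in> \<S>'" by (rule R.additively_closed_retract[OF \<S>' Z])
    then show ?case using P s by auto
  next
    case (Suc n)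
    have ex: "\<exists>L k P e. presentation C \<S> L k P e (at_vertex Y j)" if "j \<in> verts Q" for j
      using Suc(3)[OF that] by auto
    obtain K k P \<phi> where P: "P \<in> \<S>'" and s: "short_exact \<R> K k P \<phi> Y"
      and pv: "\<And>j. j \<in> verts Q \<Longrightarrow> presentation C \<S> (at_vertex K j) (k j) (at_vertex P j) (\<phi> j) (at_vertex Y j)"
      using cover[OF Suc(2) ex] by blast
    have K: "K \<in> ob \<R>" using s by (auto simp: short_exact_def arr_def)
    have "resolved \<R> \<S>' (Suc n) K"
      using pdim_le_syzygy[OF \<S> Suc(3) pv] by (intro Suc(1)[OF K])
    then show ?case using P s by (subst resolved.simps) blast
  qed
qed

end

context acyclic_quiver_rep begin

section \<open>Projective representations\<close>

text \<open>
  The evaluation at \<open>i\<close> has the right adjoint \<open>e\<^sub>i\<^sup>\<rho>\<close>, which preserves epimorphisms.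
\<close>

lemma projective_vertex:
  assumes P: "projective \<R> P" and i: "i \<in> verts Q"
  shows "projective C (at_vertex P i)"
proof (rule projectiveI)
  interpret R: preadditive_category "\<R>" by (rule preadditive_Rep)
  have Po: "P \<in> ob \<R>" using P by (simp add: projective_def)
  show "at_vertex P i \<in> ob C" by (rule rep_vertex[OF Po i])
  fix A B e f assume e: "arr C A B e" and ee: "is_epi C A B e" and f: "arr C (at_vertex P i) B f"
  have A: "A \<in> ob C" and B: "B \<in> ob C" using e by (auto simp: arr_def)
  obtain \<chi> where \<chi>: "arr \<R> (E i A) (E i B) \<chi>"
    and pr\<chi>: "\<And>j p. \<lbrakk>j \<in> verts Q; p \<in> paths Q j i\<rbrakk> \<Longrightarrow> pr i B j p \<cdot> \<chi> j = e \<cdot> pr i A j p"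
    and \<chi>inj: "\<And>j p. \<lbrakk>j \<in> verts Q; p \<in> paths Q j i\<rbrakk> \<Longrightarrow> \<chi> j \<cdot> inj i A j p = inj i B j p \<cdot> e"
    using coinduced_map[OF e] by metis
  have "is_epi C (at_vertex (E i A) j) (at_vertex (E i B) j) (\<chi> j)" if j: "j \<in> verts Q" for j
    unfolding is_epi_iff[OF rep_arrD(1)[OF \<chi> j]]
  proof (intro allI impI)
    fix W x assume x: "arr C (at_vertex (E i B) j) W x" "x \<cdot> \<chi> j = zerom C (at_vertex (E i A) j) W"
    have W: "W \<in> ob C" and EB: "at_vertex (E i B) j \<in> ob C" using x by (auto simp: arr_def)
    show "x = zerom C (at_vertex (E i B) j) W"
    proof (rule direct_sum_joint_epi[OF E_sum[OF B j, of i] x(1) zero_arr[OF EB W]])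
      fix p assume p: "p \<in> paths Q j i"
      note iA = inj_arr[OF A j p] and iB = inj_arr[OF B j p]
      have "(x \<cdot> inj i B j p) \<cdot> e = (x \<cdot> \<chi> j) \<cdot> inj i A j p"
        using assoc[OF e iB x(1)] \<chi>inj[OF j p] assoc[OF iA rep_arrD(1)[OF \<chi> j] x(1)] by simp
      also have "\<dots> = zerom C B W \<cdot> e" using x(2) zero_comp[OF iA W] zero_comp[OF e W] by simp
      finally have "x \<cdot> inj i B j p = zerom C B W"
        using epi_cancel[OF ee comp_arr[OF iB x(1)] zero_arr[OF B W]] by blast
      then show "x \<cdot> inj i B j p = zerom C (at_vertex (E i B) j) W \<cdot> inj i B j p" using zero_comp[OF iB W] by simp
    qed
  qed
  then have \<chi>e: "is_epi \<R> (E i A) (E i B) \<chi>" using is_epi_Rep_iff[OF \<chi>] by blast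
  obtain \<phi> where \<phi>: "arr \<R> P (E i B) \<phi>" "pr i B i [] \<cdot> \<phi> i = f" using coinduced_exists[OF Po i f] .
  obtain g where g: "arr \<R> P (E i A) g" "cmp \<R> \<chi> g = \<phi>"
    using R.projective_lift[OF P \<chi>e \<chi> \<phi>(1)] .
  have nil: "[] \<in> paths Q i i" using path_Nil i by simp
  note gi = rep_arrD(1)[OF g(1) i] and \<chi>i = rep_arrD(1)[OF \<chi> i] and pA = pr_arr[OF A i nil] and pB = pr_arr[OF B i nil]
  have "e \<cdot> (pr i A i [] \<cdot> g i) = f"
    using assoc[OF gi pA e] pr\<chi>[OF i nil] assoc[OF gi \<chi>i pB] fun_cong[OF g(2), of i] i \<phi>(2) by simp
  then show "\<exists>g. arr C (at_vertex P i) A g \<and> e \<cdot> g = f" using comp_arr[OF gi pA] by blast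
qed

text \<open>
  In the opposite category the coinduced representations become the induced ones, which are projective
  when they are induced from projective objects.
\<close>

lemma ex_projective_cover:
  assumes en: "enough_projectives C" and X: "X \<in> ob \<R>"
  obtains P \<phi> where "projective \<R> P" "arr \<R> P X \<phi>"
    "\<And>j. j \<in> verts Q \<Longrightarrow> is_epi C (at_vertex P j) (at_vertex X j) (\<phi> j)"
proof -
  interpret R: preadditive_category "\<R>" by (rule preadditive_Rep)
  interpret op: acyclic_quiver_rep "op_cat C" "op_quiver Q" by (rule acyclic_quiver_rep_op)
  have sub: "Proj C \<subseteq> ob (op_cat C)" by (auto simp: Proj_def projective_def)
  have X': "X \<in> ob (Rep (op_quiver Q) (op_cat C))" using X by (simp add: Rep_op)
  have "\<exists>T m. T \<in> Proj C \<and> is_mono (op_cat C) (at_vertex X j) T m \<and> rel_epi (op_cat (op_cat C)) (Proj C) T (at_vertex X j) m"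
    if "j \<in> verts (op_quiver Q)" for j
  proof -
    have "j \<in> verts Q" using that by simp
    then obtain L k P e where "presentation C (Proj C) L k P e (at_vertex X j)"
      using ex_projective_presentation[OF en rep_vertex[OF X]] by blast
    then show ?thesis by (auto simp: presentation_def short_exact_def)
  qed
  then obtain Z \<phi> where Z: "Z \<in> op.coind_add (Proj C)" and \<phi>: "arr (Rep (op_quiver Q) (op_cat C)) X Z \<phi>"
    and m: "\<And>j. j \<in> verts (op_quiver Q) \<Longrightarrow> is_mono (op_cat C) (at_vertex X j) (at_vertex Z j) (\<phi> j)"
    using op.coind_add_enough[OF sub X'] by metis
  have \<phi>': "arr \<R> Z X \<phi>" using \<phi> by (simp add: Rep_op)
  have "projective \<R> Z"
  proof (rule R.projectiveI)
    show "Z \<in> ob \<R>" using rep_arrD[OF \<phi>'] by simp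
    fix A B e f assume e: "arr \<R> A B e" and ee: "is_epi \<R> A B e" and f: "arr \<R> Z B f"
    have "rel_epi (op_cat (Rep (op_quiver Q) (op_cat C))) (op.coind_add (Proj C)) A B e"
    proof (rule op.coind_add_relative_injective[OF sub])
      show "arr (Rep (op_quiver Q) (op_cat C)) B A e" using e by (simp add: Rep_op)
      show "rel_epi (op_cat (op_cat C)) (Proj C) (at_vertex A j) (at_vertex B j) (e j)" if "j \<in> verts (op_quiver Q)" for j
        using epi_rel_epi_Proj[OF _ rep_arrD(1)[OF e]] ee[unfolded is_epi_Rep_iff[OF e]] that by simp
    qed
    then have "rel_epi \<R> (op.coind_add (Proj C)) A B e" by (simp add: Rep_op)
    then show "\<exists>g. arr \<R> Z A g \<and> cmp \<R> e g = f" using Z f unfolding rel_epi_def by blast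
  qed
  then show thesis using that[OF _ \<phi>'] m by simp
qed

lemma enough_projectives_Rep:
  assumes "enough_projectives C"
  shows "enough_projectives \<R>"
  unfolding enough_projectives_def
proof
  fix X assume "X \<in> ob \<R>"
  from ex_projective_cover[OF assms this] show "\<exists>P e. projective \<R> P \<and> is_epi \<R> P X e"
    using is_epi_Rep_iff by metis
qed

lemma resolved_Proj_Rep:
  assumes en: "enough_projectives C" and Y: "Y \<in> ob \<R>"
    and pd: "\<And>j. j \<in> verts Q \<Longrightarrow> pdim_le C (Proj C) n (at_vertex Y j)"
  shows "resolved \<R> (Proj \<R>) (Suc n) Y"
proof (rule resolved_of_vertexwise_pdim_le[OF additively_closed_Proj _ _ _ Y pd])
  interpret R: preadditive_category "\<R>" by (rule preadditive_Rep)
  show "additively_closed \<R> (Proj \<R>)" by (rule R.additively_closed_Proj)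
  show "rel_epi \<R> (Proj \<R>) X Y \<phi>" if \<phi>: "arr \<R> X Y \<phi>"
    and v: "\<And>j. j \<in> verts Q \<Longrightarrow> rel_epi C (Proj C) (at_vertex X j) (at_vertex Y j) (\<phi> j)" for X Y \<phi>
    using R.epi_rel_epi_Proj[OF _ \<phi>] is_epi_Rep_iff[OF \<phi>] rel_epi_Proj_epi[OF en v] by blast
  show "\<exists>P \<phi>. P \<in> Proj \<R> \<and> arr \<R> P X \<phi> \<and> (\<forall>j\<in>verts Q. at_vertex P j \<in> Proj C \<and>
          is_epi C (at_vertex P j) (at_vertex X j) (\<phi> j) \<and> rel_epi C (Proj C) (at_vertex P j) (at_vertex X j) (\<phi> j))"
    if X: "X \<in> ob \<R>" for X
  proof -
    obtain P \<phi> where P: "projective \<R> P" and \<phi>: "arr \<R> P X \<phi>"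
      and e: "\<And>j. j \<in> verts Q \<Longrightarrow> is_epi C (at_vertex P j) (at_vertex X j) (\<phi> j)"
      using ex_projective_cover[OF en X] by blast
    have "rel_epi C (Proj C) (at_vertex P j) (at_vertex X j) (\<phi> j)" if "j \<in> verts Q" for j
      by (rule epi_rel_epi_Proj[OF e[OF that] rep_arrD(1)[OF \<phi> that]])
    moreover have "P \<in> Proj \<R>" "\<And>j. j \<in> verts Q \<Longrightarrow> at_vertex P j \<in> Proj C"
      using P projective_vertex[OF P] by (auto simp: Proj_def)
    ultimately show ?thesis using \<phi> e by blast
  qed
qed

text \<open>
  Presentations of representations are presentations at the vertices, and the inclusion of a syzygy is
  of the kind to which \<open>coind_add_relative_injective\<close> applies.
\<close>

lemma ext_vanishes_Rep:
  assumes en: "enough_projectives C" and \<T>: "\<T> \<subseteq> ob C" and B: "B \<in> coind_add \<T>"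
  shows "\<lbrakk>\<And>j T. \<lbrakk>j \<in> verts Q; T \<in> \<T>\<rbrakk> \<Longrightarrow> ext_vanishes C (Proj C) m (at_vertex X j) T\<rbrakk> \<Longrightarrow> ext_vanishes \<R> (Proj \<R>) m X B"
proof (induction m arbitrary: X)
  have pv: "presentation C (Proj C) (at_vertex L j) (k j) (at_vertex P j) (e j) (at_vertex X j)"
    if "presentation \<R> (Proj \<R>) L k P e X" "j \<in> verts Q" for L k P e X j
    using that projective_vertex[of P j] short_exact_RepD[of L k P e X j] presentation_of_projective by (auto simp: presentation_def Proj_def)
  {
    case 0
    show ?case
      unfolding ext_vanishes.simps
    proof (intro allI impI)
      fix L k P e assume p: "presentation \<R> (Proj \<R>) L k P e X"
      then have k: "arr \<R> L P k" by (simp add: presentation_def short_exact_def)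
      have "rel_epi (op_cat \<R>) (coind_add \<T>) P L k"
      proof (rule coind_add_relative_injective[OF \<T> k])
        fix j assume j: "j \<in> verts Q"
        have "extends_along C (at_vertex L j) (k j) (at_vertex P j) T" if "T \<in> \<T>" for T
          using 0[OF j that] ext_vanishes_0_iff[OF pv[OF p j]] by blast
        then show "rel_epi (op_cat C) \<T> (at_vertex P j) (at_vertex L j) (k j)"
          using rep_arrD(1)[OF k j] by (simp add: rel_epi_def extends_along_def)
      qed
      then show "extends_along \<R> L k P B" using B by (simp add: rel_epi_def extends_along_def)
    qed
  next
    case (Suc m)
    show ?case
      unfolding ext_vanishes.simps
    proof (intro allI impI)
      fix L k P e assume p: "presentation \<R> (Proj \<R>) L k P e X"
      have "ext_vanishes C (Proj C) m (at_vertex L j) T" if "j \<in> verts Q" "T \<in> \<T>" for j T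
        using Suc(2)[OF that] ext_vanishes_Suc_iff[OF pv[OF p that(1)] ex_projective_presentation[OF en]] by blast
      then show "ext_vanishes \<R> (Proj \<R>) m L B" by (rule Suc(1))
    qed
  }
qed

end

section \<open>Right approximations\<close>

context acyclic_quiver_rep begin

text \<open>
  A morphism \<open>\<psi> : e\<^sub>i\<^sup>\<rho>(T') \<rightarrow> X\<close> amounts to its components \<open>T' \<rightarrow> X\<^sub>j\<close> on the summands of the paths \<open>j \<rightarrow> i\<close>. Being a
  morphism of representations means that \<open>X\<^sub>a\<close> maps the component at \<open>a # p\<close> to the component at \<open>p\<close>, and
  the component at any path out of the tail of \<open>a\<close> that does not start with \<open>a\<close> to zero. The families with
  this property are represented by an equaliser \<open>G\<close> in the base category, and a right \<open>\<T>\<close>-approximation of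
  \<open>G\<close> is all that is needed.
\<close>

lemma coinduced_right_approximation:
  assumes \<T>: "\<T> \<subseteq> ob C" and cf: "contravariantly_finite C \<T>" and X: "X \<in> ob \<R>" and i: "i \<in> verts Q"
  shows "\<exists>T \<phi>. T \<in> \<T> \<and> arr \<R> (E i T) X \<phi> \<and> (\<forall>T'\<in>\<T>. \<forall>\<psi>. arr \<R> (E i T') X \<psi> \<longrightarrow>
    (\<exists>\<chi>. arr \<R> (E i T') (E i T) \<chi> \<and> cmp \<R> \<phi> \<chi> = \<psi>))"
proof -
  let ?I = "Sigma (verts Q) (\<lambda>j. paths Q j i)" and ?J = "Sigma (arcs Q) (\<lambda>a. paths Q (tail Q a) i)"
  let ?X = "\<lambda>x. at_vertex X (fst x)" and ?Y = "\<lambda>y. at_vertex X (head Q (fst y))"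
  have finp: "finite (paths Q j i)" for j by (rule acyclic_finite_paths[OF fin acyclic])
  have "finite ?I" "finite ?J" using finite_verts finite_arcs finp by (auto intro: finite_SigmaI)
  then obtain S \<iota> \<pi> S' \<iota>' \<pi>' where ds: "is_direct_sum C ?I ?X S \<iota> \<pi>" and ds': "is_direct_sum C ?J ?Y S' \<iota>' \<pi>'"
    using ex_finite_direct_sum[of ?I ?X] ex_finite_direct_sum[of ?J ?Y] rep_vertex[OF X] by fastforce
  have S: "S \<in> ob C" and S': "S' \<in> ob C" using ds ds' by (auto simp: is_direct_sum_def)
  have \<pi>a: "arr C S (at_vertex X j) (\<pi> (j, p))" if "p \<in> paths Q j i" for j p
    using direct_sum_arr(2)[OF ds, of "(j, p)"] that paths_verts[OF wf that] by simp
  have \<pi>'a: "arr C S' (at_vertex X (head Q a)) (\<pi>' (a, q))" if "a \<in> arcs Q" "q \<in> paths Q (tail Q a) i" for a q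
    using direct_sum_arr(2)[OF ds', of "(a, q)"] that by simp
  \<comment> \<open>A morphism \<open>E i T \<rightarrow> X\<close> is a morphism \<open>r : T \<rightarrow> S\<close> whose components satisfy \<open>compat\<close>, that is, a
    morphism into the equaliser of \<open>f\<close> and \<open>g\<close>.\<close>
  define f\<^sub>0 where "f\<^sub>0 y = at_arrow X (fst y) \<cdot> \<pi> (tail Q (fst y), snd y)" for y
  define g\<^sub>0 where "g\<^sub>0 y = (if snd y \<noteq> [] \<and> hd (snd y) = fst y then \<pi> (head Q (fst y), tl (snd y))
    else zerom C S (at_vertex X (head Q (fst y))))" for y
  have f0: "arr C S (?Y y) (f\<^sub>0 y)" if "y \<in> ?J" for y
    unfolding f\<^sub>0_def using that comp_arr[OF \<pi>a rep_arrow[OF X]] by auto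
  have tl_path: "tl q \<in> paths Q (head Q a) i" if "q \<in> paths Q (tail Q a) i" "q \<noteq> []" "hd q = a" for a q
    using that path_Cons by (cases q) auto
  have g0: "arr C S (?Y y) (g\<^sub>0 y)" if "y \<in> ?J" for y
    unfolding g\<^sub>0_def using that tl_path \<pi>a S rep_vertex[OF X] by auto
  obtain f where f: "arr C S S' f" "\<And>y. y \<in> ?J \<Longrightarrow> \<pi>' y \<cdot> f = f\<^sub>0 y" using direct_sum_tuple[OF ds' S f0] by blast
  obtain g where g: "arr C S S' g" "\<And>y. y \<in> ?J \<Longrightarrow> \<pi>' y \<cdot> g = g\<^sub>0 y" using direct_sum_tuple[OF ds' S g0] by blast
  define compat where "compat W r \<longleftrightarrow> (\<forall>a\<in>arcs Q. \<forall>q\<in>paths Q (tail Q a) i.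
    at_arrow X a \<cdot> (\<pi> (tail Q a, q) \<cdot> r) = (if q \<noteq> [] \<and> hd q = a then \<pi> (head Q a, tl q) \<cdot> r
      else zerom C W (at_vertex X (head Q a))))" for W r
  have compat_iff: "compat W r \<longleftrightarrow> f \<cdot> r = g \<cdot> r" if r: "arr C W S r" for W r
  proof -
    have ff: "\<pi>' (a, q) \<cdot> (f \<cdot> r) = at_arrow X a \<cdot> (\<pi> (tail Q a, q) \<cdot> r)"
      and gg: "\<pi>' (a, q) \<cdot> (g \<cdot> r) = (if q \<noteq> [] \<and> hd q = a then \<pi> (head Q a, tl q) \<cdot> r
        else zerom C W (at_vertex X (head Q a)))" if a: "a \<in> arcs Q" and q: "q \<in> paths Q (tail Q a) i" for a q
    proof -
      have y: "(a, q) \<in> ?J" using a q by simp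
      show "\<pi>' (a, q) \<cdot> (f \<cdot> r) = at_arrow X a \<cdot> (\<pi> (tail Q a, q) \<cdot> r)"
        using assoc[OF r f(1) \<pi>'a[OF a q]] f(2)[OF y] assoc[OF r \<pi>a[OF q] rep_arrow[OF X a]] by (simp add: f\<^sub>0_def)
      show "\<pi>' (a, q) \<cdot> (g \<cdot> r) = (if q \<noteq> [] \<and> hd q = a then \<pi> (head Q a, tl q) \<cdot> r
        else zerom C W (at_vertex X (head Q a)))"
        using assoc[OF r g(1) \<pi>'a[OF a q]] g(2)[OF y] zero_comp[OF r rep_vertex[OF X arc_ends(1)[OF a]]]
        by (auto simp: g\<^sub>0_def)
    qed
    show ?thesis
    proof
      assume c: "compat W r"
      show "f \<cdot> r = g \<cdot> r"
      proof (rule direct_sum_joint_mono[OF ds' comp_arr[OF r f(1)] comp_arr[OF r g(1)]])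
        fix y assume "y \<in> ?J"
        then obtain a q where "y = (a, q)" "a \<in> arcs Q" "q \<in> paths Q (tail Q a) i" by auto
        then show "\<pi>' y \<cdot> (f \<cdot> r) = \<pi>' y \<cdot> (g \<cdot> r)" using ff gg c unfolding compat_def by simp
      qed
    next
      assume eq: "f \<cdot> r = g \<cdot> r"
      show "compat W r"
        unfolding compat_def
      proof (intro ballI)
        fix a q assume "a \<in> arcs Q" "q \<in> paths Q (tail Q a) i"
        from ff[OF this] gg[OF this] show "at_arrow X a \<cdot> (\<pi> (tail Q a, q) \<cdot> r) =
          (if q \<noteq> [] \<and> hd q = a then \<pi> (head Q a, tl q) \<cdot> r else zerom C W (at_vertex X (head Q a)))"
          using eq by simp
      qed
    qed
  qed
  obtain n where n: "arr C S S' n" "f = addm C g n" using ex_difference[OF f(1) g(1)] .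
  have equaliser: "f \<cdot> r = g \<cdot> r \<longleftrightarrow> n \<cdot> r = zerom C W S'" if r: "arr C W S r" for W r
  proof -
    have gr: "arr C W S' (g \<cdot> r)" and nr: "arr C W S' (n \<cdot> r)" using r g n by blast+
    have z: "arr C W S' (zerom C W S')" using gr by (intro zero_arr) (auto simp: arr_def)
    have "f \<cdot> r = addm C (g \<cdot> r) (n \<cdot> r)" unfolding n(2) by (rule distrib_right[OF r g(1) n(1)])
    then show ?thesis using add_cancel[OF gr nr z] add_zero(1)[OF gr] by metis
  qed
  obtain G \<gamma> where \<gamma>: "is_kernel C S S' n G \<gamma>" using ex_kernel'[OF n(1)] by blast
  have \<gamma>a: "arr C G S \<gamma>" by (rule kernel_arr[OF \<gamma> S])
  obtain T t where T: "T \<in> \<T>" and t: "arr C T G t" and ap: "\<And>T' f. \<lbrakk>T' \<in> \<T>; arr C T' G f\<rbrakk> \<Longrightarrow> \<exists>g. arr C T' T g \<and> t \<cdot> g = f"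
  proof -
    have G: "G \<in> ob C" using \<gamma>a by (simp add: arr_def)
    then obtain T t where "right_approximation C \<T> G T t" using cf unfolding contravariantly_finite_def by blast
    then show thesis using that[of T t] \<T> G unfolding right_approximation_def arr_def by blast
  qed
  have To: "T \<in> ob C" using T \<T> by blast
  define r where "r = \<gamma> \<cdot> t"
  have r: "arr C T S r" unfolding r_def using \<gamma>a t by blast
  have S'o: "zerom C G S' \<cdot> t = zerom C T S'" by (rule zero_comp[OF t S'])
  have "n \<cdot> r = zerom C T S'" unfolding r_def using assoc[OF t \<gamma>a n(1)] kernel_zero[OF \<gamma>] S'o by simp
  then have cr: "compat T r" using compat_iff[OF r] equaliser[OF r] by simp
  have "\<exists>h. arr C (at_vertex (E i T) j) (at_vertex X j) h \<and> (\<forall>p\<in>paths Q j i. h \<cdot> inj i T j p = \<pi> (j, p) \<cdot> r)"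
    if j: "j \<in> verts Q" for j
  proof (rule direct_sum_cotuple[of "paths Q j i" "\<lambda>_. T" _ _ _ "at_vertex X j" "\<lambda>p. \<pi> (j, p) \<cdot> r", OF E_sum[OF To j] rep_vertex[OF X j]])
    show "arr C T (at_vertex X j) (\<pi> (j, p) \<cdot> r)" if "p \<in> paths Q j i" for p by (rule comp_arr[OF r \<pi>a[OF that]])
  qed blast
  then obtain \<phi> where \<phi>: "\<And>j. j \<in> verts Q \<Longrightarrow> arr C (at_vertex (E i T) j) (at_vertex X j) (\<phi> j)"
    and \<phi>i: "\<And>j p. \<lbrakk>j \<in> verts Q; p \<in> paths Q j i\<rbrakk> \<Longrightarrow> \<phi> j \<cdot> inj i T j p = \<pi> (j, p) \<cdot> r" by metis
  have path_cases: "(\<exists>p\<in>paths Q (head Q a) i. q = a # p) \<longleftrightarrow> q \<noteq> [] \<and> hd q = a"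
    if "a \<in> arcs Q" "q \<in> paths Q (tail Q a) i" for a q
    using tl_path[OF that(2)] by (metis list.collapse list.distinct(1) list.sel(1))
  have \<phi>a: "arr \<R> (E i T) X (restrict \<phi> (verts Q))"
  proof (rule rep_arrI[OF E_ob[OF To] X \<phi>])
    fix a assume a: "a \<in> arcs Q"
    note h = arc_ends(1)[OF a] and tt = arc_ends(2)[OF a] and Ea = E_arrow(1)[OF To a, of i] and Xa = rep_arrow[OF X a]
    show "\<phi> (head Q a) \<cdot> at_arrow (E i T) a = at_arrow X a \<cdot> \<phi> (tail Q a)"
    proof (rule direct_sum_joint_epi[OF E_sum[OF To tt, of i] comp_arr[OF Ea \<phi>[OF h]] comp_arr[OF \<phi>[OF tt] Xa]])
      fix q assume q: "q \<in> paths Q (tail Q a) i"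
      note iq = inj_arr[OF To tt q]
      have R: "(at_arrow X a \<cdot> \<phi> (tail Q a)) \<cdot> inj i T (tail Q a) q =
        (if q \<noteq> [] \<and> hd q = a then \<pi> (head Q a, tl q) \<cdot> r else zerom C T (at_vertex X (head Q a)))"
        using assoc[OF iq \<phi>[OF tt] Xa] \<phi>i[OF tt q] cr a q unfolding compat_def by simp
      have L: "(\<phi> (head Q a) \<cdot> at_arrow (E i T) a) \<cdot> inj i T (tail Q a) q = \<phi> (head Q a) \<cdot> (at_arrow (E i T) a \<cdot> inj i T (tail Q a) q)"
        by (rule assoc[OF iq Ea \<phi>[OF h]])
      show "(\<phi> (head Q a) \<cdot> at_arrow (E i T) a) \<cdot> inj i T (tail Q a) q = (at_arrow X a \<cdot> \<phi> (tail Q a)) \<cdot> inj i T (tail Q a) q"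
      proof (cases "q \<noteq> [] \<and> hd q = a")
        case True
        then obtain p where p: "p \<in> paths Q (head Q a) i" "q = a # p" using path_cases[OF a q] by blast
        have "at_arrow (E i T) a \<cdot> inj i T (tail Q a) q = inj i T (head Q a) p" by (rule E_arrow_inj(1)[OF To a q p])
        then show ?thesis using L R \<phi>i[OF h p(1)] p(2) by simp
      next
        case False
        then have "at_arrow (E i T) a \<cdot> inj i T (tail Q a) q = zerom C T (at_vertex (E i T) (head Q a))"
          using E_arrow_inj(2)[OF To a q] path_cases[OF a q] by blast
        then show ?thesis using L R False comp_zero[OF \<phi>[OF h] To] by simp
      qed
    qed
  qed
  have "\<exists>\<chi>. arr \<R> (E i T') (E i T) \<chi> \<and> cmp \<R> (restrict \<phi> (verts Q)) \<chi> = \<psi>"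
    if T': "T' \<in> \<T>" and \<psi>: "arr \<R> (E i T') X \<psi>" for T' \<psi>
  proof -
    have T'o: "T' \<in> ob C" using T' \<T> by blast
    note \<psi>j = rep_arrD(1)[OF \<psi>]
    define r\<^sub>0 where "r\<^sub>0 x = \<psi> (fst x) \<cdot> inj i T' (fst x) (snd x)" for x
    have r0: "arr C T' (?X x) (r\<^sub>0 x)" if "x \<in> ?I" for x
      unfolding r\<^sub>0_def using that comp_arr[OF inj_arr[OF T'o] \<psi>j] by auto
    obtain r' where r': "arr C T' S r'" "\<And>x. x \<in> ?I \<Longrightarrow> \<pi> x \<cdot> r' = r\<^sub>0 x" using direct_sum_tuple[OF ds T'o r0] by blast
    have r'\<pi>: "\<pi> (j, p) \<cdot> r' = \<psi> j \<cdot> inj i T' j p" if "p \<in> paths Q j i" for j p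
      using r'(2)[of "(j, p)"] that paths_verts[OF wf that] by (simp add: r\<^sub>0_def)
    have "compat T' r'"
      unfolding compat_def
    proof (intro ballI)
      fix a q assume a: "a \<in> arcs Q" and q: "q \<in> paths Q (tail Q a) i"
      note h = arc_ends(1)[OF a] and tt = arc_ends(2)[OF a] and Ea = E_arrow(1)[OF T'o a, of i] and Xa = rep_arrow[OF X a]
      note iq = inj_arr[OF T'o tt q]
      have L: "at_arrow X a \<cdot> (\<pi> (tail Q a, q) \<cdot> r') = \<psi> (head Q a) \<cdot> (at_arrow (E i T') a \<cdot> inj i T' (tail Q a) q)"
        using r'\<pi>[OF q] assoc[OF iq \<psi>j[OF tt] Xa] rep_arrD(2)[OF \<psi> a] assoc[OF iq Ea \<psi>j[OF h]] by simp
      show "at_arrow X a \<cdot> (\<pi> (tail Q a, q) \<cdot> r') = (if q \<noteq> [] \<and> hd q = a then \<pi> (head Q a, tl q) \<cdot> r'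
        else zerom C T' (at_vertex X (head Q a)))"
      proof (cases "q \<noteq> [] \<and> hd q = a")
        case True
        then obtain p where p: "p \<in> paths Q (head Q a) i" "q = a # p" using path_cases[OF a q] by blast
        have "at_arrow (E i T') a \<cdot> inj i T' (tail Q a) q = inj i T' (head Q a) p" by (rule E_arrow_inj(1)[OF T'o a q p])
        then show ?thesis using L r'\<pi>[OF p(1)] p(2) by simp
      next
        case False
        then have "at_arrow (E i T') a \<cdot> inj i T' (tail Q a) q = zerom C T' (at_vertex (E i T') (head Q a))"
          using E_arrow_inj(2)[OF T'o a q] path_cases[OF a q] by blast
        then show ?thesis using L False comp_zero[OF \<psi>j[OF h] T'o] by auto
      qed
    qed
    then have "n \<cdot> r' = zerom C T' S'" using compat_iff[OF r'(1)] equaliser[OF r'(1)] by simp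
    then obtain y where y: "arr C T' G y" "\<gamma> \<cdot> y = r'" using kernel_factor[OF \<gamma> r'(1)] by blast
    obtain w where w: "arr C T' T w" "t \<cdot> w = y" using ap[OF T' y(1)] by blast
    have rw: "r \<cdot> w = r'" unfolding r_def using assoc[OF w(1) t \<gamma>a] w(2) y(2) by simp
    obtain \<chi> where \<chi>: "arr \<R> (E i T') (E i T) \<chi>"
      and \<chi>i: "\<And>j p. \<lbrakk>j \<in> verts Q; p \<in> paths Q j i\<rbrakk> \<Longrightarrow> \<chi> j \<cdot> inj i T' j p = inj i T j p \<cdot> w"
      using coinduced_map[OF w(1)] by metis
    have "cmp \<R> (restrict \<phi> (verts Q)) \<chi> = \<psi>"
    proof (rule rep_arr_eqI[OF rep_comp_arr[OF \<chi> \<phi>a] \<psi>])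
      fix j assume j: "j \<in> verts Q"
      note \<chi>j = rep_arrD(1)[OF \<chi> j]
      have "\<phi> j \<cdot> \<chi> j = \<psi> j"
      proof (rule direct_sum_joint_epi[OF E_sum[OF T'o j, of i] comp_arr[OF \<chi>j \<phi>[OF j]] \<psi>j[OF j]])
        fix p assume p: "p \<in> paths Q j i"
        note ip = inj_arr[OF T'o j p] and ip' = inj_arr[OF To j p]
        have "(\<phi> j \<cdot> \<chi> j) \<cdot> inj i T' j p = (\<phi> j \<cdot> inj i T j p) \<cdot> w"
          using assoc[OF ip \<chi>j \<phi>[OF j]] \<chi>i[OF j p] assoc[OF w(1) ip' \<phi>[OF j]] by simp
        then show "(\<phi> j \<cdot> \<chi> j) \<cdot> inj i T' j p = \<psi> j \<cdot> inj i T' j p"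
          using \<phi>i[OF j p] assoc[OF w(1) r \<pi>a[OF p]] rw r'\<pi>[OF p] by simp
      qed
      then show "cmp \<R> (restrict \<phi> (verts Q)) \<chi> j = \<psi> j" using j by simp
    qed
    then show ?thesis using \<chi> by blast
  qed
  then show ?thesis using T \<phi>a by blast
qed

lemma coind_add_contravariantly_finite:
  assumes \<T>: "\<T> \<subseteq> ob C" and cf: "contravariantly_finite C \<T>"
  shows "contravariantly_finite \<R> (coind_add \<T>)"
  unfolding contravariantly_finite_def
proof
  interpret R: abelian_category "\<R>" by (rule abelian_Rep)
  fix X assume X: "X \<in> ob \<R>"
  let ?F = "{e_rho Q C i T | i T. i \<in> verts Q \<and> T \<in> \<T>}"
  obtain T \<phi> where T: "\<And>i. i \<in> verts Q \<Longrightarrow> T i \<in> \<T>" and \<phi>: "\<And>i. i \<in> verts Q \<Longrightarrow> arr \<R> (E i (T i)) X (\<phi> i)"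
    and ap: "\<And>i T' \<psi>. \<lbrakk>i \<in> verts Q; T' \<in> \<T>; arr \<R> (E i T') X \<psi>\<rbrakk> \<Longrightarrow>
      \<exists>\<chi>. arr \<R> (E i T') (E i (T i)) \<chi> \<and> cmp \<R> (\<phi> i) \<chi> = \<psi>"
    using coinduced_right_approximation[OF \<T> cf X] by metis
  have To: "T i \<in> ob C" if "i \<in> verts Q" for i using T[OF that] \<T> by blast
  obtain Z \<iota> \<pi> where ds: "is_direct_sum \<R> (verts Q) (\<lambda>i. E i (T i)) Z \<iota> \<pi>"
    using R.ex_finite_direct_sum[OF finite_verts, of "\<lambda>i. E i (T i)"] E_ob[OF To] by blast
  obtain \<Phi> where \<Phi>: "arr \<R> Z X \<Phi>" "\<And>i. i \<in> verts Q \<Longrightarrow> cmp \<R> \<Phi> (\<iota> i) = \<phi> i"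
    using R.direct_sum_cotuple[OF ds X \<phi>] by blast
  have Zo: "Z \<in> ob \<R>" using ds by (simp add: is_direct_sum_def)
  have Z: "Z \<in> coind_add \<T>"
    unfolding coind_add_def by (rule R.add_hullI[OF ds _ R.retract_refl[OF Zo]]) (use T in blast)
  have "rel_epi \<R> ?F Z X \<Phi>"
    unfolding rel_epi_def
  proof (intro conjI ballI allI impI)
    fix P f assume "P \<in> ?F" and f: "arr \<R> P X f"
    then obtain i T' where i: "i \<in> verts Q" and T': "T' \<in> \<T>" and P: "P = E i T'" by blast
    obtain \<chi> where \<chi>: "arr \<R> P (E i (T i)) \<chi>" "cmp \<R> (\<phi> i) \<chi> = f"
      using ap[OF i T'] f P by blast
    note \<iota>i = R.direct_sum_arr(1)[OF ds i]
    have "cmp \<R> \<Phi> (cmp \<R> (\<iota> i) \<chi>) = f"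
      using R.assoc[OF \<chi>(1) \<iota>i \<Phi>(1)] \<Phi>(2)[OF i] \<chi>(2) by simp
    then show "\<exists>g. arr \<R> P Z g \<and> cmp \<R> \<Phi> g = f" using rep_comp_arr[OF \<chi>(1) \<iota>i] by blast
  qed (rule \<Phi>(1))
  then have "rel_epi \<R> (coind_add \<T>) Z X \<Phi>" unfolding coind_add_def by (rule R.rel_epi_add_hull)
  then have "right_approximation \<R> (coind_add \<T>) X Z \<Phi>"
    unfolding right_approximation_def rel_epi_def arr_def
    using Z X Zo additively_closed_ob[OF coind_add_additively_closed[of \<T>]] by blast
  then show "\<exists>Z \<Phi>. right_approximation \<R> (coind_add \<T>) X Z \<Phi>" by blast
qed

section \<open>Coresolutions\<close>

text \<open>
  This is \<open>resolved_of_vertexwise_pdim_le\<close> in the opposite category; \<open>coind_add_relative_injective\<close> and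
  \<open>coind_add_enough\<close> supply what it requires of \<open>\<S>'\<close>.
\<close>

lemma resolved_op_coind_add:
  assumes \<T>: "additively_closed C \<T>" and Y: "Y \<in> ob \<R>"
    and pd: "\<And>j. j \<in> verts Q \<Longrightarrow> pdim_le (op_cat C) \<T> n (at_vertex Y j)"
  shows "resolved (op_cat \<R>) (coind_add \<T>) (Suc n) Y"
proof -
  interpret op: quiver_rep "op_cat C" "op_quiver Q" by (rule quiver_rep_op)
  have \<T>o: "\<T> \<subseteq> ob C" by (rule additively_closed_ob[OF \<T>])
  have "resolved (Rep (op_quiver Q) (op_cat C)) (coind_add \<T>) (Suc n) Y"
  proof (rule op.resolved_of_vertexwise_pdim_le)
    show "additively_closed (op_cat C) \<T>" using \<T> by simp
    show "additively_closed (Rep (op_quiver Q) (op_cat C)) (coind_add \<T>)"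
      using coind_add_additively_closed by (simp add: Rep_op)
    show "rel_epi (Rep (op_quiver Q) (op_cat C)) (coind_add \<T>) X Y \<phi>"
      if "arr (Rep (op_quiver Q) (op_cat C)) X Y \<phi>"
        "\<And>j. j \<in> verts (op_quiver Q) \<Longrightarrow> rel_epi (op_cat C) \<T> (at_vertex X j) (at_vertex Y j) (\<phi> j)" for X Y \<phi>
      using coind_add_relative_injective[OF \<T>o, of Y X \<phi>] that by (simp add: Rep_op)
    show "Y \<in> ob (Rep (op_quiver Q) (op_cat C))" using Y by (simp add: Rep_op)
    show "pdim_le (op_cat C) \<T> n (at_vertex Y j)" if "j \<in> verts (op_quiver Q)" for j using pd that by simp
    fix X assume X: "X \<in> ob (Rep (op_quiver Q) (op_cat C))"
      and ex: "\<And>j. j \<in> verts (op_quiver Q) \<Longrightarrow> \<exists>L k P e. presentation (op_cat C) \<T> L k P e (at_vertex X j)"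
    have X': "X \<in> ob \<R>" using X by (simp add: Rep_op)
    have v: "\<exists>T m. T \<in> \<T> \<and> is_mono C (at_vertex X j) T m \<and> rel_epi (op_cat C) \<T> T (at_vertex X j) m" if "j \<in> verts Q" for j
    proof -
      obtain L k P e where "presentation (op_cat C) \<T> L k P e (at_vertex X j)" using ex[of j] \<open>j \<in> verts Q\<close> by auto
      then have "P \<in> \<T>" "is_mono C (at_vertex X j) P e" "rel_epi (op_cat C) \<T> P (at_vertex X j) e"
        by (auto simp: presentation_def short_exact_def)
      then show ?thesis by blast
    qed
    obtain Z \<phi> where Z: "Z \<in> coind_add \<T>" and \<phi>: "arr \<R> X Z \<phi>"
      and m: "\<And>j. j \<in> verts Q \<Longrightarrow> is_mono C (at_vertex X j) (at_vertex Z j) (\<phi> j)"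
      and r: "\<And>j. j \<in> verts Q \<Longrightarrow> rel_epi (op_cat C) \<T> (at_vertex Z j) (at_vertex X j) (\<phi> j)"
      using coind_add_enough[OF \<T>o X' v] by blast
    have "arr (Rep (op_quiver Q) (op_cat C)) Z X \<phi>" using \<phi> by (simp add: Rep_op)
    then show "\<exists>P \<phi>. P \<in> coind_add \<T> \<and> arr (Rep (op_quiver Q) (op_cat C)) P X \<phi> \<and> (\<forall>j\<in>verts (op_quiver Q).
        at_vertex P j \<in> \<T> \<and> is_epi (op_cat C) (at_vertex P j) (at_vertex X j) (\<phi> j) \<and>
        rel_epi (op_cat C) \<T> (at_vertex P j) (at_vertex X j) (\<phi> j))"
      using Z m r coind_add_vertex[OF \<T> Z] by (metis is_epi_op op_quiver_simps(1))
  qed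
  then show ?thesis by (simp add: Rep_op)
qed

end

lemma (in abelian_category) resolved_op_iff_coresolution:
  assumes \<T>: "additively_closed C \<T>"
  shows "resolved (op_cat C) \<T> n P \<longleftrightarrow> (\<exists>X d. exact_sequence C (n + 3) X d \<and> is_zero_object C (X 0) \<and> X 1 = P \<and>
    (\<forall>k\<le>n. X (k + 2) \<in> \<T>) \<and> is_zero_object C (X (n + 3)))"
proof
  interpret op: abelian_category "op_cat C" by (rule abelian_op) unfold_locales
  assume "resolved (op_cat C) \<T> n P"
  then obtain X d where ex: "exact_sequence (op_cat C) (n + 3) X d" and z: "is_zero_object C (X 0)"
    and T: "\<And>k. k \<le> n \<Longrightarrow> X (k + 1) \<in> \<T>" and P: "X (n + 2) = P" and z': "is_zero_object C (X (n + 3))"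
    using op.exact_sequence_of_resolved[of \<T> n P] additively_closed_ob[OF \<T>] by auto
  have "exact_sequence (op_cat (op_cat C)) (n + 2 + 1) (\<lambda>k. X (n + 2 + 1 - k)) (\<lambda>k. d (n + 2 - k))"
    by (rule op.exact_sequence_op) (use ex in \<open>simp add: numeral_eq_Suc\<close>)
  then have 1: "exact_sequence C (n + 3) (\<lambda>k. X (n + 3 - k)) (\<lambda>k. d (n + 2 - k))" by (simp add: numeral_eq_Suc)
  have "X (n + 3 - (k + 2)) \<in> \<T>" if "k \<le> n" for k
  proof -
    have "n + 3 - (k + 2) = (n - k) + 1" using that by simp
    then show ?thesis using T[of "n - k"] by simp
  qed
  then show "\<exists>X d. exact_sequence C (n + 3) X d \<and> is_zero_object C (X 0) \<and> X 1 = P \<and>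
    (\<forall>k\<le>n. X (k + 2) \<in> \<T>) \<and> is_zero_object C (X (n + 3))"
    using 1 z z' P by (intro exI[of _ "\<lambda>k. X (n + 3 - k)"] exI[of _ "\<lambda>k. d (n + 2 - k)"]) simp
next
  interpret op: abelian_category "op_cat C" by (rule abelian_op) unfold_locales
  assume "\<exists>X d. exact_sequence C (n + 3) X d \<and> is_zero_object C (X 0) \<and> X 1 = P \<and>
    (\<forall>k\<le>n. X (k + 2) \<in> \<T>) \<and> is_zero_object C (X (n + 3))"
  then obtain X d where ex: "exact_sequence C (n + 3) X d" and z: "is_zero_object C (X 0)" and P: "X 1 = P"
    and T: "\<And>k. k \<le> n \<Longrightarrow> X (k + 2) \<in> \<T>" and z': "is_zero_object C (X (n + 3))" by blast
  have "exact_sequence (op_cat C) (n + 2 + 1) (\<lambda>k. X (n + 2 + 1 - k)) (\<lambda>k. d (n + 2 - k))"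
    by (rule exact_sequence_op) (use ex in \<open>simp add: numeral_eq_Suc\<close>)
  then have 1: "exact_sequence (op_cat C) (n + 3) (\<lambda>k. X (n + 3 - k)) (\<lambda>k. d (n + 2 - k))" by (simp add: numeral_eq_Suc)
  have "resolved (op_cat C) \<T> n ((\<lambda>k. X (n + 3 - k)) (n + 2))"
  proof (rule op.resolved_of_exact_sequence[OF _ 1])
    show "additively_closed (op_cat C) \<T>" using \<T> by simp
    show "X (n + 3 - (k + 1)) \<in> \<T>" if "k \<le> n" for k
    proof -
      have "n + 3 - (k + 1) = (n - k) + 2" using that by simp
      then show ?thesis using T[of "n - k"] by simp
    qed
  qed (use z z' in simp_all)
  moreover have "n + 3 - (n + 2) = 1" by simp
  ultimately show "resolved (op_cat C) \<T> n P" using P by simp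
qed

section \<open>The tilting subcategory of representations\<close>

theorem theorem1p6:
  fixes \<A> :: "('o, 'm) add_cat" and Q :: "('v, 'e) pre_digraph" and n :: nat and \<T> :: "'o set"
  assumes "abelian_category \<A>" and "enough_projectives \<A>"
    and "fin_digraph Q" and "acyclic_quiver Q"
    and "n_tilting_subcategory \<A> n \<T>"
  shows "n_tilting_subcategory (Rep Q \<A>) (n + 1)
           (add_hull (Rep Q \<A>) {e_rho Q \<A> i T | i T. i \<in> verts Q \<and> T \<in> \<T>})"
proof -
  interpret T: n_tilting_subcategory \<A> n \<T> by fact
  have wf: "wf_digraph Q" using assms(3) by (simp add: fin_digraph_def)
  interpret Q: acyclic_quiver_rep \<A> Q
    using assms(3,4) wf by unfold_locales (auto simp: fin_digraph_def fin_digraph_axioms_def wf_digraph_def)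
  interpret R: abelian_category "Rep Q \<A>" by (rule Q.abelian_Rep)
  note en = assms(2) and enR = Q.enough_projectives_Rep[OF assms(2)]
  have \<T>: "\<T> \<subseteq> ob \<A>" by (rule additively_closed_ob[OF T.closed])
  have closed: "additively_closed (Rep Q \<A>) (Q.coind_add \<T>)" by (rule Q.coind_add_additively_closed)
  have ext_vanishes: "ext_vanishes \<A> (Proj \<A>) m T\<^sub>1 T\<^sub>2" if "T\<^sub>1 \<in> \<T>" "T\<^sub>2 \<in> \<T>" for m T\<^sub>1 T\<^sub>2
    using T.Ext_vanishing[OF that, of "Suc m"] T.trivial_Ext_iff[OF en, of T\<^sub>1 T\<^sub>2 m] that \<T> by auto
  have "n_tilting_subcategory (Rep Q \<A>) (n + 1) (Q.coind_add \<T>)"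
  proof (intro n_tilting_subcategory.intro n_tilting_subcategory_axioms.intro)
    show "abelian_category (Rep Q \<A>)" by (rule Q.abelian_Rep)
    show "enough_projectives (Rep Q \<A>)" by (rule enR)
    show "additively_closed (Rep Q \<A>) (Q.coind_add \<T>)" by (rule closed)
    show "contravariantly_finite (Rep Q \<A>) (Q.coind_add \<T>)"
      by (rule Q.coind_add_contravariantly_finite[OF \<T> T.contravariant])
  next
    fix X Y and i :: nat assume X: "X \<in> Q.coind_add \<T>" and Y: "Y \<in> Q.coind_add \<T>" and "1 \<le> i"
    then obtain m where i: "i = Suc m" by (cases i) auto
    have ob: "X \<in> ob (Rep Q \<A>)" "Y \<in> ob (Rep Q \<A>)" using additively_closed_ob[OF closed] X Y by auto
    have "ext_vanishes (Rep Q \<A>) (Proj (Rep Q \<A>)) m X Y"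
      by (rule Q.ext_vanishes_Rep[OF en \<T> Y]) (rule ext_vanishes[OF Q.coind_add_vertex[OF T.closed X]])
    then show "trivial_group (Ext (Rep Q \<A>) i X Y)" using R.trivial_Ext_iff[OF enR ob] i by simp
  next
    fix X assume X: "X \<in> Q.coind_add \<T>"
    have "pdim_le \<A> (Proj \<A>) n (at_vertex X j)" if "j \<in> verts Q" for j
    proof -
      have "proj_dim \<A> (at_vertex X j) \<le> enat n" by (rule T.proj_dim_le[OF Q.coind_add_vertex[OF T.closed X that]])
      then obtain m where "m \<le> n" "resolved \<A> (Proj \<A>) m (at_vertex X j)" using T.proj_dim_le_iff by blast
      then show ?thesis using T.pdim_le_mono[OF T.additively_closed_Proj] T.resolved_pdim_le by blast
    qed
    then have "resolved (Rep Q \<A>) (Proj (Rep Q \<A>)) (Suc n) X"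
      using Q.resolved_Proj_Rep[OF en] additively_closed_ob[OF closed] X by blast
    then show "proj_dim (Rep Q \<A>) X \<le> enat (n + 1)" unfolding R.proj_dim_le_iff Suc_eq_plus1[symmetric] by blast
  next
    fix P assume P: "projective (Rep Q \<A>) P"
    have "pdim_le (op_cat \<A>) \<T> n (at_vertex P j)" if "j \<in> verts Q" for j
    proof -
      have "resolved (op_cat \<A>) \<T> n (at_vertex P j)"
        using T.tilting_coresolution[OF Q.projective_vertex[OF P that]]
        unfolding T.resolved_op_iff_coresolution[OF T.closed] .
      then show ?thesis using T.resolved_op_pdim_le[OF en \<T> ext_vanishes] by blast
    qed
    then have "resolved (op_cat (Rep Q \<A>)) (Q.coind_add \<T>) (n + 1) P"
      using Q.resolved_op_coind_add[OF T.closed] P by (simp add: projective_def del: resolved.simps)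
    then show "\<exists>X d. exact_sequence (Rep Q \<A>) (n + 1 + 3) X d \<and> is_zero_object (Rep Q \<A>) (X 0) \<and> X 1 = P \<and>
        (\<forall>k\<le>n + 1. X (k + 2) \<in> Q.coind_add \<T>) \<and> is_zero_object (Rep Q \<A>) (X (n + 1 + 3))"
      unfolding R.resolved_op_iff_coresolution[OF closed] .
  qed
  then show ?thesis by (simp add: Q.coind_add_def)
qed

end
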